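(* Let $g$ be an integer with $3 \le g \le 9$, and let $X = X_{2g-2} \subset \mathbf{P}^{g+1}$ be a smooth prime Fano threefold. Then $X$ does not contain the tangent scroll $S_{2g-2}$ to a rational normal curve $C_g$ of degree $g$ (in $\mathbf{P}^{g+1}$).
   Context: All varieties are over $\mathbf{C}$. A smooth projective variety $X$ is Fano if its anticanonical bundle $-K_X$ is ample; its index $r(X)$ is the largest positive integer $r$ such that $-K_X = rH$ for some line bundle $H$ on $X$. A smooth Fano threefold $X = X_d \subset \mathbf{P}^{g+1}$ of degree $d$ is called prime if $\rho(X) = \operatorname{rank} \operatorname{Pic}(X) = 1$, $r(X) = 1$, and $-K_X$ is the hyperplane bundle on $X$ (i.e. $X$ is anticanonically embedded); then $d = 2g-2$. A rational normal curve $C_g$ of degree $g$ in $\mathbf{P}^{g+1}$ is a smooth rational curve of degree $g$ spanning a $g$-dimensional projective subspace, i.e. in suitable coordinates it is the curve $\{(s_0^g : s_0^{g-1}s_1 : \dots : s_1^g)\}$ in some $\mathbf{P}^g \subset \mathbf{P}^{g+1}$. The tangent scroll to $C_g$ is the surface swept out by the tangent lines to $C_g$; it has degree $2g-2$ and is denoted $S_{2g-2}$. *)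

theory Defs
  imports
    "HOL-Analysis.Analysis"
    "HOL-Library.Poly_Mapping"
    "HOL-Computational_Algebra.Polynomial"
    "HOL-Algebra.FiniteProduct"
begin

text \<open>
  Varieties are classical: irreducible Zariski-closed sets of points of a complex projective
  space.  The space \<open>P(complex^'n)\<close> has dimension \<open>CARD('n) - 1\<close>.
\<close>

section \<open>Polynomials and projective space\<close>

type_synonym 'i mpoly = "('i \<Rightarrow>\<^sub>0 nat) \<Rightarrow>\<^sub>0 complex"

definition mdeg :: "('i \<Rightarrow>\<^sub>0 nat) \<Rightarrow> nat" where
  "mdeg m = (\<Sum>i\<in>Poly_Mapping.keys m. Poly_Mapping.lookup m i)"

definition homogeneous :: "nat \<Rightarrow> 'i mpoly \<Rightarrow> bool" where
  "homogeneous d F \<longleftrightarrow> (\<forall>m\<in>Poly_Mapping.keys F. mdeg m = d)"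

definition mpeval :: "'i mpoly \<Rightarrow> ('i \<Rightarrow> complex) \<Rightarrow> complex" where
  "mpeval F x = (\<Sum>m\<in>Poly_Mapping.keys F. Poly_Mapping.lookup F m *
      (\<Prod>i\<in>Poly_Mapping.keys m. x i ^ Poly_Mapping.lookup m i))"

definition mpscale :: "complex \<Rightarrow> 'i mpoly \<Rightarrow> 'i mpoly" where
  "mpscale c F = Poly_Mapping.single 0 c * F"

typedef (overloaded) 'n proj = "{L :: (complex^'n::finite) set. vec.subspace L \<and> vec.dim L = 1}"
  morphisms line_of Proj
proof -
  obtain i :: 'n where True by blast
  have "vec.dim (vec.span {axis i 1 :: complex^'n}) = card {axis i 1 :: complex^'n}"
    by (rule vec.dim_span_eq_card_independent) (simp add: axis_eq_0_iff)
  then have "vec.span {axis i 1 :: complex^'n} \<in> {L. vec.subspace L \<and> vec.dim L = 1}"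
    by simp
  then show ?thesis by blast
qed

definition coords :: "'n::finite proj \<Rightarrow> complex^'n" where
  "coords p = (SOME v. v \<in> line_of p \<and> v \<noteq> 0)"

text \<open>Only whether the value is zero, and quotients of values of forms of the same degree,
  are independent of the choice of \<^const>\<open>coords\<close>.\<close>

abbreviation form_at :: "'n::finite mpoly \<Rightarrow> 'n proj \<Rightarrow> complex" where
  "form_at F p \<equiv> mpeval F (vec_nth (coords p))"

definition zariski :: "'n::finite proj topology" where
  "zariski = topology_generated_by {{p. form_at F p \<noteq> 0} | F d. homogeneous d F}"

definition irreducible_set :: "'n::finite proj set \<Rightarrow> bool" where
  "irreducible_set Z \<longleftrightarrow> Z \<noteq> {} \<and>
     (\<forall>A B. closedin zariski A \<longrightarrow> closedin zariski B \<longrightarrow> Z \<subseteq> A \<union> B \<longrightarrow> Z \<subseteq> A \<or> Z \<subseteq> B)"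

text \<open>Krull dimension, by chains of irreducible closed subsets.\<close>

definition zdim :: "'n::finite proj set \<Rightarrow> enat" where
  "zdim X = (SUP k\<in>{k. \<exists>Z :: nat \<Rightarrow> 'n proj set.
      (\<forall>i\<le>k. closedin zariski (Z i) \<and> irreducible_set (Z i) \<and> Z i \<subseteq> X) \<and>
      (\<forall>i<k. Z i \<subset> Z (Suc i))}. enat k)"

definition projective_variety :: "'n::finite proj set \<Rightarrow> bool" where
  "projective_variety X \<longleftrightarrow> closedin zariski X \<and> irreducible_set X"

definition homog_ideal :: "'n::finite proj set \<Rightarrow> nat \<Rightarrow> 'n mpoly set" where
  "homog_ideal X d = {F. homogeneous d F \<and> (\<forall>p\<in>X. form_at F p = 0)}"

text \<open>The linear subspace of \<open>complex^'n\<close> whose projectivization is the embedded projective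
  tangent space of \<open>X\<close> at \<open>p\<close>; the Zariski tangent space of \<open>X\<close> at \<open>p\<close> is its quotient by
  (a twist of) the line \<open>p\<close>.\<close>

definition tangent_space :: "'n::finite proj set \<Rightarrow> 'n proj \<Rightarrow> (complex^'n) set" where
  "tangent_space X p = {v. \<forall>d. \<forall>F\<in>homog_ideal X d.
      deriv (\<lambda>t. mpeval F (vec_nth (coords p + t *s v))) 0 = 0}"

definition smooth_projective_variety :: "'n::finite proj set \<Rightarrow> nat \<Rightarrow> bool" where
  "smooth_projective_variety X d \<longleftrightarrow> projective_variety X \<and> zdim X = enat d \<and>
     (\<forall>p\<in>X. vec.dim (tangent_space X p) = d + 1)"

text \<open>The degree is read off the leading coefficient of the Hilbert polynomial.\<close>

definition hilbert_function :: "'n::finite proj set \<Rightarrow> nat \<Rightarrow> nat" where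
  "hilbert_function X m =
     vector_space.dim mpscale {F :: 'n mpoly. homogeneous m F} -
     vector_space.dim mpscale (homog_ideal X m)"

definition has_degree :: "'n::finite proj set \<Rightarrow> nat \<Rightarrow> bool" where
  "has_degree X d \<longleftrightarrow> (\<exists>P :: real poly.
     (\<forall>\<^sub>F m in sequentially. real (hilbert_function X m) = poly P (real m)) \<and>
     zdim X = enat (degree P) \<and> fact (degree P) * lead_coeff P = real d)"


section \<open>Regular functions\<close>

definition local_quotient ::
    "'n::finite proj set \<Rightarrow> 'n proj \<Rightarrow> ('n proj \<Rightarrow> complex) \<Rightarrow> 'n mpoly \<Rightarrow> 'n mpoly \<Rightarrow> bool" where
  "local_quotient X p f F G \<longleftrightarrow> (\<exists>d. homogeneous d F \<and> homogeneous d G) \<and>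
     (\<exists>W. openin (subtopology zariski X) W \<and> p \<in> W \<and>
        (\<forall>y\<in>W. form_at G y \<noteq> 0 \<and> f y = form_at F y / form_at G y))"

text \<open>\<open>f\<close> is used here only on \<open>U\<close>, which is meant to be open in \<open>X\<close>; values elsewhere are
  irrelevant.\<close>

definition regular_on :: "'n::finite proj set \<Rightarrow> 'n proj set \<Rightarrow> ('n proj \<Rightarrow> complex) \<Rightarrow> bool" where
  "regular_on X U f \<longleftrightarrow> (\<forall>p\<in>U. \<exists>F G. local_quotient X p f F G)"

definition unit_on :: "'n::finite proj set \<Rightarrow> 'n proj set \<Rightarrow> ('n proj \<Rightarrow> complex) \<Rightarrow> bool" where
  "unit_on X U f \<longleftrightarrow> regular_on X U f \<and> (\<forall>p\<in>U. f p \<noteq> 0)"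

text \<open>The differential of \<open>f\<close> at \<open>p\<close>, as a linear form on \<^const>\<open>tangent_space\<close> (vanishing on the
  line \<open>p\<close> itself).  It scales with the choice of \<^const>\<open>coords\<close>.\<close>

definition differential ::
    "'n::finite proj set \<Rightarrow> ('n proj \<Rightarrow> complex) \<Rightarrow> 'n proj \<Rightarrow> complex^'n \<Rightarrow> complex" where
  "differential X f p v = (THE D. \<exists>F G. local_quotient X p f F G \<and>
     D = deriv (\<lambda>t. mpeval F (vec_nth (coords p + t *s v)) /
                     mpeval G (vec_nth (coords p + t *s v))) 0)"


section \<open>Line bundles and the Picard group\<close>

text \<open>
  A line bundle on \<open>X\<close> is given by trivializations over an open cover, indexed by the points of \<open>X\<close>
  so that \<open>p \<in> chart L p\<close>, and transition functions.  Convention: a section with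
  component \<open>s p\<close> over \<open>chart L p\<close> satisfies \<open>s p = transition L p q * s q\<close>; equivalently the
  local frames satisfy \<open>e q = transition L p q * e p\<close>.
\<close>

datatype 'n lbundle =
  LBundle (chart: "'n::finite proj \<Rightarrow> 'n proj set") (transition: "'n proj \<Rightarrow> 'n proj \<Rightarrow> 'n proj \<Rightarrow> complex")

definition line_bundle :: "'n::finite proj set \<Rightarrow> 'n lbundle \<Rightarrow> bool" where
  "line_bundle X L \<longleftrightarrow>
     (\<forall>p\<in>X. openin (subtopology zariski X) (chart L p) \<and> p \<in> chart L p) \<and>
     (\<forall>p\<in>X. \<forall>q\<in>X. unit_on X (chart L p \<inter> chart L q) (transition L p q)) \<and>
     (\<forall>p\<in>X. \<forall>q\<in>X. \<forall>r\<in>X. \<forall>x\<in>chart L p \<inter> chart L q \<inter> chart L r.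
        transition L p q x * transition L q r x = transition L p r x)"

text \<open>Isomorphisms over \<open>X\<close>: \<open>\<phi> p q\<close> is the matrix from the \<open>p\<close>-th trivialization of \<open>L\<close> to the
  \<open>q\<close>-th trivialization of \<open>M\<close>.\<close>

definition bundle_iso :: "'n::finite proj set \<Rightarrow> 'n lbundle \<Rightarrow> 'n lbundle \<Rightarrow> bool" where
  "bundle_iso X L M \<longleftrightarrow> (\<exists>\<phi>.
     (\<forall>p\<in>X. \<forall>q\<in>X. unit_on X (chart L p \<inter> chart M q) (\<phi> p q)) \<and>
     (\<forall>p\<in>X. \<forall>p'\<in>X. \<forall>q\<in>X. \<forall>q'\<in>X. \<forall>x\<in>chart L p \<inter> chart L p' \<inter> chart M q \<inter> chart M q'.
        \<phi> p' q' x = transition M q' q x * \<phi> p q x * transition L p p' x))"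

definition bundle_tensor :: "'n::finite lbundle \<Rightarrow> 'n lbundle \<Rightarrow> 'n lbundle" where
  "bundle_tensor L M =
     LBundle (\<lambda>p. chart L p \<inter> chart M p) (\<lambda>p q x. transition L p q x * transition M p q x)"

definition trivial_bundle :: "'n::finite proj set \<Rightarrow> 'n lbundle" where
  "trivial_bundle X = LBundle (\<lambda>p. X) (\<lambda>p q x. 1)"

definition bundle_iso_rel :: "'n::finite proj set \<Rightarrow> ('n lbundle \<times> 'n lbundle) set" where
  "bundle_iso_rel X = {(L, M). line_bundle X L \<and> line_bundle X M \<and> bundle_iso X L M}"

text \<open>The group operation is written multiplicatively.\<close>

definition Pic :: "'n::finite proj set \<Rightarrow> 'n lbundle set monoid" where
  "Pic X = \<lparr>carrier = {L. line_bundle X L} // bundle_iso_rel X,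
     mult = (\<lambda>A B. \<Union>L\<in>A. \<Union>M\<in>B. bundle_iso_rel X `` {bundle_tensor L M}),
     one = bundle_iso_rel X `` {trivial_bundle X}\<rparr>"

definition abelian_group_rank :: "('a, 'b) monoid_scheme \<Rightarrow> enat" where
  "abelian_group_rank G = (SUP S\<in>{S. S \<subseteq> carrier G \<and> finite S \<and>
     (\<forall>c :: 'a \<Rightarrow> int. finprod G (\<lambda>x. x [^]\<^bsub>G\<^esub> c x) S = \<one>\<^bsub>G\<^esub> \<longrightarrow> (\<forall>x\<in>S. c x = 0))}.
     enat (card S))"

definition picard_number :: "'n::finite proj set \<Rightarrow> enat" where
  "picard_number X = abelian_group_rank (Pic X)"


section \<open>Hyperplane bundle, canonical class, ampleness\<close>

text \<open>In the trivialization at \<open>p\<close>, a linear form is divided by the homogeneous coordinate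
  \<open>pivot p\<close>, which does not vanish at \<open>p\<close>.\<close>

definition pivot :: "'n::finite proj \<Rightarrow> 'n" where
  "pivot p = (SOME i. coords p $ i \<noteq> 0)"

definition hyperplane_bundle :: "'n::finite proj set \<Rightarrow> 'n lbundle" where
  "hyperplane_bundle X = LBundle (\<lambda>p. {x\<in>X. coords x $ pivot p \<noteq> 0})
     (\<lambda>p q x. coords x $ pivot q / coords x $ pivot p)"

text \<open>For a smooth threefold: local parameters \<open>u p 1, u p 2, u p 3\<close> on \<open>chart K p\<close> give the
  nowhere vanishing 3-form \<open>du p 1 \<and> du p 2 \<and> du p 3\<close> as local frame of the
  canonical bundle, and the transition functions are their quotients.\<close>

definition jacobian :: "'n::finite proj set \<Rightarrow> (3 \<Rightarrow> 'n proj \<Rightarrow> complex) \<Rightarrow> 'n proj \<Rightarrow>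
    (3 \<Rightarrow> complex^'n) \<Rightarrow> complex" where
  "jacobian X u x v = det (\<chi> i j. differential X (u i) x (v j))"

definition canonical_bundle_threefold :: "'n::finite proj set \<Rightarrow> 'n lbundle \<Rightarrow> bool" where
  "canonical_bundle_threefold X K \<longleftrightarrow> line_bundle X K \<and>
     (\<exists>u :: 'n proj \<Rightarrow> 3 \<Rightarrow> 'n proj \<Rightarrow> complex.
        (\<forall>p\<in>X. \<forall>i. regular_on X (chart K p) (u p i)) \<and>
        (\<forall>p\<in>X. \<forall>x\<in>chart K p. \<exists>v. (\<forall>j. v j \<in> tangent_space X x) \<and> jacobian X (u p) x v \<noteq> 0) \<and>
        (\<forall>p\<in>X. \<forall>q\<in>X. \<forall>x\<in>chart K p \<inter> chart K q. \<forall>v. (\<forall>j. v j \<in> tangent_space X x) \<longrightarrow>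
           jacobian X (u q) x v = transition K p q x * jacobian X (u p) x v))"

definition canonical_class :: "'n::finite proj set \<Rightarrow> 'n lbundle set" where
  "canonical_class X = bundle_iso_rel X `` {K. canonical_bundle_threefold X K}"

definition anticanonical_class :: "'n::finite proj set \<Rightarrow> 'n lbundle set" where
  "anticanonical_class X = inv\<^bsub>Pic X\<^esub> (canonical_class X)"

definition global_section ::
    "'n::finite proj set \<Rightarrow> 'n lbundle \<Rightarrow> ('n proj \<Rightarrow> 'n proj \<Rightarrow> complex) \<Rightarrow> bool" where
  "global_section X L s \<longleftrightarrow> (\<forall>p\<in>X. regular_on X (chart L p) (s p)) \<and>
     (\<forall>p\<in>X. \<forall>q\<in>X. \<forall>x\<in>chart L p \<inter> chart L q. s p x = transition L p q x * s q x)"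

text \<open>Homogeneous coordinates in \<open>P^N\<close> of the image of \<open>x\<close> under the map given by the sections
  \<open>s 0, \<dots>, s N\<close>, computed in the trivialization around \<open>x\<close> itself.\<close>

definition section_map ::
    "nat \<Rightarrow> (nat \<Rightarrow> 'n::finite proj \<Rightarrow> 'n proj \<Rightarrow> complex) \<Rightarrow> 'n proj \<Rightarrow> nat \<Rightarrow> complex" where
  "section_map N s x = (\<lambda>i. if i \<le> N then s i x x else 0)"

text \<open>\<open>L\<close> is very ample if finitely many global sections define a closed immersion into some
  \<open>P^N\<close>: the map is well defined, injective, closed, and surjective on local rings.
  Forms on \<open>P^N\<close> are polynomials in variables indexed by \<open>nat\<close>; those beyond \<open>N\<close> are evaluated at 0.\<close>

definition very_ample :: "'n::finite proj set \<Rightarrow> 'n lbundle \<Rightarrow> bool" where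
  "very_ample X L \<longleftrightarrow> (\<exists>N s. (\<forall>i\<le>N. global_section X L (s i)) \<and>
     (\<forall>x\<in>X. section_map N s x \<noteq> (\<lambda>_. 0)) \<and>
     (\<forall>x\<in>X. \<forall>y\<in>X. (\<exists>c. section_map N s x = (\<lambda>i. c * section_map N s y i)) \<longrightarrow> x = y) \<and>
     (\<forall>Z. Z \<subseteq> X \<longrightarrow> closedin zariski Z \<longrightarrow>
        (\<exists>T :: nat mpoly set. (\<forall>F\<in>T. \<exists>d. homogeneous d F) \<and>
           (\<forall>y. y \<noteq> (\<lambda>_. 0) \<longrightarrow> (\<forall>i>N. y i = 0) \<longrightarrow>
              ((\<forall>F\<in>T. mpeval F y = 0) \<longleftrightarrow>
               (\<exists>x\<in>Z. \<exists>c. y = (\<lambda>i. c * section_map N s x i)))))) \<and>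
     (\<forall>x\<in>X. \<forall>f. (\<exists>F G. local_quotient X x f F G) \<longrightarrow>
        (\<exists>A B :: nat mpoly. (\<exists>d. homogeneous d A \<and> homogeneous d B) \<and>
           (\<exists>W. openin (subtopology zariski X) W \<and> x \<in> W \<and>
              (\<forall>y\<in>W. mpeval B (section_map N s y) \<noteq> 0 \<and>
                 f y = mpeval A (section_map N s y) / mpeval B (section_map N s y))))))"

definition ample_class :: "'n::finite proj set \<Rightarrow> 'n lbundle set \<Rightarrow> bool" where
  "ample_class X A \<longleftrightarrow> A \<in> carrier (Pic X) \<and>
     (\<exists>m>0. \<exists>L\<in>A [^]\<^bsub>Pic X\<^esub> (m::nat). very_ample X L)"


section \<open>Fano threefolds\<close>

definition fano_threefold :: "'n::finite proj set \<Rightarrow> bool" where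
  "fano_threefold X \<longleftrightarrow> smooth_projective_variety X 3 \<and> ample_class X (anticanonical_class X)"

definition fano_index :: "'n::finite proj set \<Rightarrow> nat" where
  "fano_index X = (GREATEST r. r > 0 \<and>
     (\<exists>H\<in>carrier (Pic X). anticanonical_class X = H [^]\<^bsub>Pic X\<^esub> r))"

definition prime_fano_threefold :: "'n::finite proj set \<Rightarrow> bool" where
  "prime_fano_threefold X \<longleftrightarrow> fano_threefold X \<and> picard_number X = 1 \<and> fano_index X = 1 \<and>
     hyperplane_bundle X \<in> anticanonical_class X"


section \<open>Rational normal curves and tangent scrolls\<close>

text \<open>The vectors \<open>e 0, \<dots>, e g\<close> are the suitable coordinates on the span of the curve.\<close>

definition rational_normal_curve :: "nat \<Rightarrow> 'n::finite proj set \<Rightarrow> bool" where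
  "rational_normal_curve g C \<longleftrightarrow> (\<exists>e :: nat \<Rightarrow> complex^'n.
     inj_on e {..g} \<and> vec.independent (e ` {..g}) \<and>
     C = {p. \<exists>s0 s1. (s0, s1) \<noteq> (0, 0) \<and> (\<Sum>i\<le>g. (s0 ^ (g - i) * s1 ^ i) *s e i) \<in> line_of p})"

definition tangent_scroll :: "'n::finite proj set \<Rightarrow> 'n proj set" where
  "tangent_scroll C = {q. \<exists>p\<in>C. line_of q \<subseteq> tangent_space C p}"

end

theory Submission
  imports Defs "HOL-Complex_Analysis.Cauchy_Integral_Formula"
begin

text \<open>
  The scroll is cuspidal along \<open>C\<close>, so its Zariski tangent space at a point of \<open>C\<close> is the osculating
  3-space of \<open>C\<close>, and a smooth threefold \<open>X\<close> containing the scroll has exactly this tangent space.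
  Hence the tangent bundle of \<open>X\<close> restricted to \<open>C\<close> is determined by \<open>C\<close>: with \<open>c\<close> an affine
  parametrization of \<open>C\<close>, it is framed by \<open>c', c'', c'''\<close> modulo \<open>c\<close>.  Comparing these frames in the
  two standard charts of \<open>C\<close> shows that \<open>- K\<^sub>X\<close> has degree 12 on \<open>C\<close>.  But \<open>- K\<^sub>X\<close> is the hyperplane
  bundle, whose degree on \<open>C\<close> is \<open>g\<close>, so \<open>g = 12\<close>.
\<close>

section \<open>Polynomials\<close>

text \<open>The number 12 is 2 + 4 + 6. If t = 1/s, then modulo lower derivatives the k-th
  derivative of the parametrization is (-1)^k t^g s^(2k) times the k-th derivative in the other
  chart. The factor t^g is the change of representative of the point, so the tangent bundle of X
  along C is filtered with quotients O(2), O(4), O(6). Degrees of line bundles are never defined. A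
  trivialization of K tensored with the hyperplane bundle, read in the frames given by c, c', c'',
  c''', is a nowhere vanishing entire function f(t), which in the other chart becomes s^(12 - g)
  f(1/s). If g < 12, then 1/f tends to 0 at infinity, against Liouville's theorem; only the
  inequality 12 \<le> g is extracted. Two obstacles shape the rest. The representatives
  \<open>coords\<close> are arbitrary choices, so nothing is visibly holomorphic in t until
  homogeneity has cancelled them. And the hyperplane bundle is given as a member of an inverse in
  the group \<open>Pic X\<close>, so the group law and the canonical class must be made explicit,
  which needs tangent frames with polynomial entries.\<close>

lemma mpeval_UNIV:
  fixes F :: "'n::finite mpoly"
  assumes "finite A" "Poly_Mapping.keys F \<subseteq> A"
  shows "mpeval F x = (\<Sum>m\<in>A. Poly_Mapping.lookup F m * (\<Prod>i\<in>UNIV. x i ^ Poly_Mapping.lookup m i))"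
proof -
  have "(\<Prod>i\<in>Poly_Mapping.keys m. x i ^ Poly_Mapping.lookup m i)
      = (\<Prod>i\<in>UNIV. x i ^ Poly_Mapping.lookup m i)" for m :: "'n \<Rightarrow>\<^sub>0 nat"
    by (rule prod.mono_neutral_left) (auto simp: in_keys_iff)
  then have "mpeval F x = (\<Sum>m\<in>Poly_Mapping.keys F. Poly_Mapping.lookup F m *
      (\<Prod>i\<in>UNIV. x i ^ Poly_Mapping.lookup m i))"
    by (simp add: mpeval_def)
  also have "\<dots> = (\<Sum>m\<in>A. Poly_Mapping.lookup F m * (\<Prod>i\<in>UNIV. x i ^ Poly_Mapping.lookup m i))"
    using assms by (intro sum.mono_neutral_left) (auto simp: in_keys_iff)
  finally show ?thesis .
qed

lemma mpeval_zero [simp]: "mpeval 0 x = 0"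
  by (simp add: mpeval_def)

lemma mpeval_single:
  fixes m :: "'n::finite \<Rightarrow>\<^sub>0 nat"
  shows "mpeval (Poly_Mapping.single m c) x = c * (\<Prod>i\<in>UNIV. x i ^ Poly_Mapping.lookup m i)"
  by (subst mpeval_UNIV[where A="{m}"]) (auto simp: lookup_single)

lemma mpeval_const [simp]: "mpeval (Poly_Mapping.single 0 c) (x :: 'n::finite \<Rightarrow> complex) = c"
  by (simp add: mpeval_single)

lemma mpeval_one [simp]: "mpeval 1 (x :: 'n::finite \<Rightarrow> complex) = 1"
  using mpeval_const[of 1 x] by simp

lemma mpeval_add:
  fixes F G :: "'n::finite mpoly"
  shows "mpeval (F + G) x = mpeval F x + mpeval G x"
proof -
  let ?A = "Poly_Mapping.keys F \<union> Poly_Mapping.keys G"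
  show ?thesis
    using keys_add[of F G]
    by (simp add: mpeval_UNIV[where A="?A"] lookup_add sum.distrib distrib_right)
qed

lemma mpeval_sum:
  fixes F :: "'a \<Rightarrow> 'n::finite mpoly"
  shows "mpeval (\<Sum>a\<in>A. F a) x = (\<Sum>a\<in>A. mpeval (F a) x)"
  by (induction A rule: infinite_finite_induct) (auto simp: mpeval_add)

lemma poly_mapping_sum_single:
  "F = (\<Sum>m\<in>Poly_Mapping.keys F. Poly_Mapping.single m (Poly_Mapping.lookup F m))"
proof (rule poly_mapping_eqI)
  fix k
  have "(\<Sum>m\<in>Poly_Mapping.keys F. (Poly_Mapping.lookup F m when m = k)) =
      (\<Sum>m\<in>Poly_Mapping.keys F. if m = k then Poly_Mapping.lookup F k else 0)"
    by (rule sum.cong) auto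
  then show "Poly_Mapping.lookup F k = Poly_Mapping.lookup
      (\<Sum>m\<in>Poly_Mapping.keys F. Poly_Mapping.single m (Poly_Mapping.lookup F m)) k"
    by (auto simp: lookup_sum lookup_single in_keys_iff)
qed

lemma mpeval_mult:
  fixes F G :: "'n::finite mpoly"
  shows "mpeval (F * G) x = mpeval F x * mpeval G x"
proof -
  have *: "mpeval (Poly_Mapping.single m a * Poly_Mapping.single m' b) x =
     mpeval (Poly_Mapping.single m a) x * mpeval (Poly_Mapping.single m' b) x"
    for m m' :: "'n \<Rightarrow>\<^sub>0 nat" and a b
    by (simp add: mult_single mpeval_single lookup_add power_add prod.distrib)
  have "F * G = (\<Sum>m\<in>Poly_Mapping.keys F. \<Sum>m'\<in>Poly_Mapping.keys G.
      Poly_Mapping.single m (Poly_Mapping.lookup F m) * Poly_Mapping.single m' (Poly_Mapping.lookup G m'))"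
    unfolding sum_product[symmetric] by (simp only: flip: poly_mapping_sum_single)
  then have "mpeval (F * G) x = (\<Sum>m\<in>Poly_Mapping.keys F. \<Sum>m'\<in>Poly_Mapping.keys G.
      mpeval (Poly_Mapping.single m (Poly_Mapping.lookup F m)) x *
      mpeval (Poly_Mapping.single m' (Poly_Mapping.lookup G m')) x)"
    by (simp add: mpeval_sum *)
  also have "\<dots> = mpeval F x * mpeval G x"
    unfolding sum_product[symmetric] mpeval_sum[symmetric]
    by (simp only: flip: poly_mapping_sum_single)
  finally show ?thesis .
qed

lemma mpeval_uminus: "mpeval (- F) (x :: 'n::finite \<Rightarrow> complex) = - mpeval F x"
  using mpeval_add[of F "- F" x] by (simp add: eq_neg_iff_add_eq_0 add.commute)

lemma mpeval_diff: "mpeval (F - G) (x :: 'n::finite \<Rightarrow> complex) = mpeval F x - mpeval G x"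
  using mpeval_add[of F "- G" x] by (simp add: mpeval_uminus)

lemma mpeval_prod:
  fixes F :: "'a \<Rightarrow> 'n::finite mpoly"
  shows "mpeval (\<Prod>a\<in>A. F a) x = (\<Prod>a\<in>A. mpeval (F a) x)"
  by (induction A rule: infinite_finite_induct) (auto simp: mpeval_mult)

lemma mpeval_of_int: "mpeval (of_int k) (x :: 'n::finite \<Rightarrow> complex) = of_int k"
  using mpeval_const[of "of_int k" x] by simp

text \<open>Determinants are formed over the ring of polynomials, so that Cramer's rule and
  jacobians yield forms. Evaluation is a ring homomorphism, hence commutes with the Leibniz
  expansion.\<close>

lemma mpeval_det:
  fixes M :: "'n::finite mpoly^'m^'m"
  shows "mpeval (det M) x = det (\<chi> i j. mpeval (M $ i $ j) x)"
  by (simp add: det_def mpeval_sum mpeval_mult mpeval_prod mpeval_of_int)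

lemma mdeg_UNIV: "mdeg (m :: 'n::finite \<Rightarrow>\<^sub>0 nat) = (\<Sum>i\<in>UNIV. Poly_Mapping.lookup m i)"
  unfolding mdeg_def by (rule sum.mono_neutral_left) (auto simp: in_keys_iff)

lemma mdeg_add: "mdeg (m + k :: 'n::finite \<Rightarrow>\<^sub>0 nat) = mdeg m + mdeg k"
  by (simp add: mdeg_UNIV lookup_add sum.distrib)

lemma homogeneous_zero [simp]: "homogeneous d 0"
  by (simp add: homogeneous_def)

lemma homogeneous_const [simp]: "homogeneous 0 (Poly_Mapping.single 0 c)"
  by (simp add: homogeneous_def mdeg_def)

lemma homogeneous_one [simp]: "homogeneous 0 1"
  by (simp add: homogeneous_def mdeg_def)

lemma homogeneous_uminus: "homogeneous d F \<Longrightarrow> homogeneous d (- F)"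
  by (simp add: homogeneous_def in_keys_iff)

lemma homogeneous_add: "homogeneous d F \<Longrightarrow> homogeneous d G \<Longrightarrow> homogeneous d (F + G)"
  using keys_add[of F G] by (auto simp: homogeneous_def)

lemma homogeneous_diff: "homogeneous d F \<Longrightarrow> homogeneous d G \<Longrightarrow> homogeneous d (F - G)"
  using homogeneous_add[of d F "- G"] homogeneous_uminus[of d G] by simp

lemma homogeneous_sum: "(\<And>a. a \<in> A \<Longrightarrow> homogeneous d (F a)) \<Longrightarrow> homogeneous d (\<Sum>a\<in>A. F a)"
  by (induction A rule: infinite_finite_induct) (auto intro: homogeneous_add)

lemma homogeneous_mult:
  fixes F G :: "'n::finite mpoly"
  assumes "homogeneous a F" "homogeneous b G"
  shows "homogeneous (a + b) (F * G)"
  unfolding homogeneous_def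
proof
  fix m assume "m \<in> Poly_Mapping.keys (F * G)"
  then obtain k l where "m = k + l" "k \<in> Poly_Mapping.keys F" "l \<in> Poly_Mapping.keys G"
    using keys_mult[of F G] by blast
  then show "mdeg m = a + b"
    using assms by (simp add: homogeneous_def mdeg_add)
qed

lemma homogeneous_prod:
  fixes F :: "'a \<Rightarrow> 'n::finite mpoly"
  assumes "\<And>a. a \<in> A \<Longrightarrow> homogeneous (d a) (F a)" "finite A"
  shows "homogeneous (\<Sum>a\<in>A. d a) (\<Prod>a\<in>A. F a)"
  using assms(2,1) by (induction A rule: finite_induct) (auto intro: homogeneous_mult)

lemma homogeneous_of_int [simp]: "homogeneous 0 (of_int k :: 'n mpoly)"
  using homogeneous_const[of "of_int k"] by simp

text \<open>Each term of the Leibniz expansion takes one entry from every row, so the degree may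
  vary with the row but not with the column.\<close>

lemma homogeneous_det:
  fixes M :: "'n::finite mpoly^'m^'m"
  assumes "\<And>i j. homogeneous (d i) (M $ i $ j)"
  shows "homogeneous (\<Sum>i\<in>UNIV. d i) (det M)"
  unfolding det_def
proof (rule homogeneous_sum)
  fix p
  have "homogeneous (\<Sum>i\<in>UNIV. d i) (\<Prod>i\<in>UNIV. M $ i $ p i)"
    by (rule homogeneous_prod) (auto intro: assms)
  then show "homogeneous (\<Sum>i\<in>UNIV. d i) (of_int (sign p) * (\<Prod>i\<in>UNIV. M $ i $ p i))"
    using homogeneous_mult[OF homogeneous_of_int[of "sign p"]] by (metis add_0)
qed

lemma mpeval_scale:
  fixes F :: "'n::finite mpoly"
  assumes "homogeneous d F"
  shows "mpeval F (\<lambda>i. c * x i) = c ^ d * mpeval F x"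
proof -
  have "(\<Prod>i\<in>UNIV. (c * x i) ^ Poly_Mapping.lookup m i) =
      c ^ d * (\<Prod>i\<in>UNIV. x i ^ Poly_Mapping.lookup m i)" if "m \<in> Poly_Mapping.keys F" for m
    using assms that
    by (simp add: power_mult_distrib prod.distrib homogeneous_def mdeg_UNIV flip: power_sum)
  then show ?thesis
    by (simp add: mpeval_UNIV[OF finite_keys order_refl] sum_distrib_left algebra_simps)
qed

lemma mpeval_scaleC:
  assumes "homogeneous d F"
  shows "mpeval F (vec_nth (c *s x)) = c ^ d * mpeval F (vec_nth x)"
proof -
  have "vec_nth (c *s x) = (\<lambda>i. c * x $ i)" by auto
  then show ?thesis using mpeval_scale[OF assms, of c "vec_nth x"] by simp
qed

section \<open>Coordinate functions and formal partial derivatives\<close>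

definition var :: "'i \<Rightarrow> 'i mpoly" where
  "var i = Poly_Mapping.single (Poly_Mapping.single i 1) 1"

lemma homogeneous_var: "homogeneous 1 (var i :: 'n::finite mpoly)"
  by (simp add: homogeneous_def var_def mdeg_def)

lemma mpeval_var: "mpeval (var i) (x :: 'n::finite \<Rightarrow> complex) = x i"
proof -
  have "(\<Prod>k\<in>UNIV. x k ^ (1 when i = k)) = (\<Prod>k\<in>UNIV. if k = i then x k else 1)"
    by (rule prod.cong) auto
  then show ?thesis
    by (simp add: var_def mpeval_single lookup_single)
qed

text \<open>The truncated subtraction of exponents is harmless: where the variable i is absent from
  m, the coefficient \<open>lookup m i\<close> is 0.\<close>

definition mpderiv :: "'n \<Rightarrow> 'n mpoly \<Rightarrow> 'n mpoly" where
  "mpderiv i F = (\<Sum>m\<in>Poly_Mapping.keys F. Poly_Mapping.single (m - Poly_Mapping.single i 1)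
      (of_nat (Poly_Mapping.lookup m i) * Poly_Mapping.lookup F m))"

lemma prod_lookup_diff_single:
  fixes m :: "'n::finite \<Rightarrow>\<^sub>0 nat"
  shows "(\<Prod>k\<in>UNIV. x k ^ Poly_Mapping.lookup (m - Poly_Mapping.single i 1) k) =
     (x i ^ (Poly_Mapping.lookup m i - 1) * (\<Prod>k\<in>UNIV - {i}. x k ^ Poly_Mapping.lookup m k) :: complex)"
proof -
  have "(\<Prod>k\<in>UNIV. x k ^ Poly_Mapping.lookup (m - Poly_Mapping.single i 1) k) =
    x i ^ (Poly_Mapping.lookup (m - Poly_Mapping.single i 1) i) *
      (\<Prod>k\<in>UNIV - {i}. x k ^ Poly_Mapping.lookup (m - Poly_Mapping.single i 1) k)"
    by (rule prod.remove) auto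
  also have "(\<Prod>k\<in>UNIV - {i}. x k ^ Poly_Mapping.lookup (m - Poly_Mapping.single i 1) k) =
      (\<Prod>k\<in>UNIV - {i}. x k ^ Poly_Mapping.lookup m k)"
    by (rule prod.cong) (auto simp: lookup_minus lookup_single)
  finally show ?thesis by (simp add: lookup_minus lookup_single)
qed

lemma mpeval_mpderiv:
  fixes F :: "'n::finite mpoly"
  shows "mpeval (mpderiv i F) x = (\<Sum>m\<in>Poly_Mapping.keys F. Poly_Mapping.lookup F m *
     (of_nat (Poly_Mapping.lookup m i) * x i ^ (Poly_Mapping.lookup m i - 1) *
       (\<Prod>k\<in>UNIV - {i}. x k ^ Poly_Mapping.lookup m k)))"
  unfolding mpderiv_def mpeval_sum mpeval_single prod_lookup_diff_single
  by (simp add: algebra_simps)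

lemma has_field_derivative_mpeval:
  fixes F :: "'n::finite mpoly"
  assumes "\<And>i. ((\<lambda>t. \<gamma> t i) has_field_derivative \<gamma>' i) (at t)"
  shows "((\<lambda>t. mpeval F (\<gamma> t)) has_field_derivative
     (\<Sum>i\<in>UNIV. mpeval (mpderiv i F) (\<gamma> t) * \<gamma>' i)) (at t)"
proof -
  have d: "((\<lambda>t. Poly_Mapping.lookup F m * (\<Prod>i\<in>UNIV. \<gamma> t i ^ Poly_Mapping.lookup m i)) has_field_derivative
     Poly_Mapping.lookup F m * (\<Sum>i\<in>UNIV. (of_nat (Poly_Mapping.lookup m i) * \<gamma>' i *
        \<gamma> t i ^ (Poly_Mapping.lookup m i - 1)) *
       (\<Prod>k\<in>UNIV - {i}. \<gamma> t k ^ Poly_Mapping.lookup m k))) (at t)" for m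
    by (rule DERIV_cmult[OF has_field_derivative_prod])
       (auto intro!: derivative_eq_intros assms)
  have "((\<lambda>t. \<Sum>m\<in>Poly_Mapping.keys F. Poly_Mapping.lookup F m * (\<Prod>i\<in>UNIV. \<gamma> t i ^ Poly_Mapping.lookup m i)) has_field_derivative
     (\<Sum>m\<in>Poly_Mapping.keys F. Poly_Mapping.lookup F m * (\<Sum>i\<in>UNIV. (of_nat (Poly_Mapping.lookup m i) * \<gamma>' i *
        \<gamma> t i ^ (Poly_Mapping.lookup m i - 1)) *
       (\<Prod>k\<in>UNIV - {i}. \<gamma> t k ^ Poly_Mapping.lookup m k)))) (at t)"
    by (rule DERIV_sum) (rule d)
  also have "(\<Sum>m\<in>Poly_Mapping.keys F. Poly_Mapping.lookup F m * (\<Sum>i\<in>UNIV. (of_nat (Poly_Mapping.lookup m i) * \<gamma>' i *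
        \<gamma> t i ^ (Poly_Mapping.lookup m i - 1)) *
       (\<Prod>k\<in>UNIV - {i}. \<gamma> t k ^ Poly_Mapping.lookup m k))) =
     (\<Sum>i\<in>UNIV. mpeval (mpderiv i F) (\<gamma> t) * \<gamma>' i)"
    unfolding mpeval_mpderiv sum_distrib_left sum_distrib_right
    by (subst sum.swap) (intro sum.cong refl, simp only: mult_ac)
  finally show ?thesis
    by (simp add: mpeval_UNIV[OF finite_keys order_refl])
qed

text \<open>At d = 0 the truncated degree is still correct: the derivative is then zero, and zero is
  homogeneous of every degree.\<close>

lemma homogeneous_mpderiv:
  fixes F :: "'n::finite mpoly"
  assumes "homogeneous d F"
  shows "homogeneous (d - 1) (mpderiv i F)"
  unfolding mpderiv_def
proof (rule homogeneous_sum)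
  fix m assume m: "m \<in> Poly_Mapping.keys F"
  show "homogeneous (d - 1) (Poly_Mapping.single (m - Poly_Mapping.single i 1)
      (of_nat (Poly_Mapping.lookup m i) * Poly_Mapping.lookup F m))"
  proof (cases "Poly_Mapping.lookup m i = 0")
    case False
    have "mdeg (m - Poly_Mapping.single i 1) + 1 = mdeg m"
    proof -
      have "m = (m - Poly_Mapping.single i 1) + Poly_Mapping.single i 1"
      proof (rule poly_mapping_eqI)
        fix k
        show "Poly_Mapping.lookup m k =
            Poly_Mapping.lookup (m - Poly_Mapping.single i 1 + Poly_Mapping.single i 1) k"
        proof (cases "k = i")
          case True
          then show ?thesis using False by (simp only: lookup_add lookup_minus lookup_single_eq)
        next
          case False
          then have "Poly_Mapping.lookup (Poly_Mapping.single i (1::nat)) k = 0"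
            by (intro lookup_single_not_eq) metis
          then show ?thesis by (simp only: lookup_add lookup_minus diff_zero add_0_right)
        qed
      qed
      then have "mdeg m = mdeg (m - Poly_Mapping.single i 1 + Poly_Mapping.single i 1)"
        by (rule arg_cong[where f = mdeg])
      moreover have "mdeg (Poly_Mapping.single i (1::nat)) = 1"
        by (simp add: mdeg_def)
      ultimately show ?thesis unfolding mdeg_add by linarith
    qed
    moreover have "mdeg m = d"
      using assms m unfolding homogeneous_def by blast
    ultimately have "mdeg (m - Poly_Mapping.single i 1) = d - 1"
      by linarith
    then show ?thesis
      unfolding homogeneous_def by (metis empty_iff insertE keys_single)
  qed simp
qed

text \<open>Multiplying the derivative of a monomial by x i restores the monomial times its
  exponent, and the exponents add up to d. This puts the representative of p itself into the tangent
  space and makes differentials of quotients of degree 0 vanish on the line p.\<close>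

lemma euler_identity:
  fixes F :: "'n::finite mpoly"
  assumes "homogeneous d F"
  shows "(\<Sum>i\<in>UNIV. mpeval (mpderiv i F) x * x i) = of_nat d * mpeval F x"
proof -
  have *: "of_nat (Poly_Mapping.lookup m i) * x i ^ (Poly_Mapping.lookup m i - 1) *
      (\<Prod>k\<in>UNIV - {i}. x k ^ Poly_Mapping.lookup m k) * x i =
      of_nat (Poly_Mapping.lookup m i) * (\<Prod>k\<in>UNIV. x k ^ Poly_Mapping.lookup m k)" for m i
  proof -
    have "(\<Prod>k\<in>UNIV. x k ^ Poly_Mapping.lookup m k) =
        x i ^ Poly_Mapping.lookup m i * (\<Prod>k\<in>UNIV - {i}. x k ^ Poly_Mapping.lookup m k)"
      by (rule prod.remove) auto
    then show ?thesis by (cases "Poly_Mapping.lookup m i") simp_all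
  qed
  have "(\<Sum>i\<in>UNIV. mpeval (mpderiv i F) x * x i) = (\<Sum>m\<in>Poly_Mapping.keys F. \<Sum>i\<in>UNIV.
      Poly_Mapping.lookup F m * (of_nat (Poly_Mapping.lookup m i) * (\<Prod>k\<in>UNIV. x k ^ Poly_Mapping.lookup m k)))"
    unfolding mpeval_mpderiv sum_distrib_right mult.assoc[of "Poly_Mapping.lookup F _"] *
    by (rule sum.swap)
  also have "\<dots> = (\<Sum>m\<in>Poly_Mapping.keys F. of_nat d * (Poly_Mapping.lookup F m *
      (\<Prod>k\<in>UNIV. x k ^ Poly_Mapping.lookup m k)))"
    using assms by (intro sum.cong refl)
      (simp add: homogeneous_def mdeg_UNIV flip: sum_distrib_left sum_distrib_right of_nat_sum)
  finally show ?thesis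
    by (simp add: mpeval_UNIV[OF finite_keys order_refl] sum_distrib_left)
qed

section \<open>Points, tangent spaces and differentials\<close>

lemma line_of_subspace: "vec.subspace (line_of p)" and dim_line_of: "vec.dim (line_of p) = 1"
  using line_of[of p] by auto

lemma coords_in_line: "coords p \<in> line_of p" and coords_nonzero: "coords p \<noteq> 0"
proof -
  have "\<not> line_of p \<subseteq> {0}"
    using dim_line_of[of p] vec.dim_eq_0[of "line_of p"] by auto
  then have "\<exists>v. v \<in> line_of p \<and> v \<noteq> 0" by auto
  then have "coords p \<in> line_of p \<and> coords p \<noteq> 0"
    unfolding coords_def by (rule someI_ex)
  then show "coords p \<in> line_of p" "coords p \<noteq> 0" by auto
qed

lemma line_of_eq_span:
  assumes "v \<in> line_of p" "v \<noteq> 0"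
  shows "line_of p = vec.span {v}"
proof -
  have "vec.dim (vec.span {v}) = 1"
    using assms by (subst vec.dim_span_eq_card_independent) auto
  then have "vec.span {v} = line_of p"
    using assms line_of_subspace[of p] dim_line_of[of p]
    by (intro vec.subspace_dim_equal vec.span_minimal) auto
  then show ?thesis ..
qed

lemma coords_scale:
  assumes "v \<in> line_of p" "v \<noteq> 0"
  obtains c where "c \<noteq> 0" "coords p = c *s v"
proof -
  have "coords p \<in> vec.span {v}"
    using coords_in_line line_of_eq_span[OF assms] by blast
  then obtain c where "coords p = c *s v"
    by (auto simp: vec.span_singleton)
  with coords_nonzero[of p] that show ?thesis by auto
qed

text \<open>Meaningful only for v \<noteq> 0, which is why the representatives used below are shown
  to be nonzero.\<close>

definition pt :: "complex^'n::finite \<Rightarrow> 'n proj" where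
  "pt v = Proj (vec.span {v})"

lemma line_of_pt: "v \<noteq> 0 \<Longrightarrow> line_of (pt v) = vec.span {v}"
  unfolding pt_def
  by (rule Proj_inverse) (auto simp: vec.dim_span_eq_card_independent)

lemma pt_scale: "c \<noteq> 0 \<Longrightarrow> pt (c *s v) = pt v"
  unfolding pt_def using vec.span_image_scale[of "{v}" "\<lambda>_. c"] by simp

lemma coords_pt:
  assumes "v \<noteq> 0"
  obtains c where "c \<noteq> 0" "coords (pt v) = c *s v"
  using coords_scale[of v "pt v"] assms line_of_pt[OF assms] vec.span_base by blast

lemma form_zero_iff:
  assumes "homogeneous d F" "coords p = c *s v" "c \<noteq> 0"
  shows "form_at F p = 0 \<longleftrightarrow> mpeval F (vec_nth v) = 0"
  using assms by (simp add: mpeval_scaleC)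

text \<open>The factors c^d cancel. Together with the zero test above, this replaces the arbitrary
  \<open>coords p\<close> by an explicit vector.\<close>

lemma form_quotient_scale:
  assumes "homogeneous d F" "homogeneous d G" "coords p = c *s v" "c \<noteq> 0"
  shows "form_at F p / form_at G p = mpeval F (vec_nth v) / mpeval G (vec_nth v)"
  using assms by (simp add: mpeval_scaleC)

definition grad :: "'n::finite mpoly \<Rightarrow> complex^'n \<Rightarrow> complex^'n \<Rightarrow> complex" where
  "grad F x v = (\<Sum>i\<in>UNIV. mpeval (mpderiv i F) (vec_nth x) * v $ i)"

lemma grad_add: "grad F x (v + w) = grad F x v + grad F x w"
  by (simp add: grad_def distrib_left sum.distrib)

lemma grad_scale: "grad F x (c *s v) = c * grad F x v"
  by (simp add: grad_def sum_distrib_left algebra_simps)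

lemma grad_zero [simp]: "grad F x 0 = 0"
  by (simp add: grad_def)

lemma DERIV_mpeval:
  fixes \<gamma> :: "complex \<Rightarrow> complex^'n::finite"
  assumes "\<And>i. ((\<lambda>t. \<gamma> t $ i) has_field_derivative v $ i) (at t)"
  shows "((\<lambda>t. mpeval F (vec_nth (\<gamma> t))) has_field_derivative grad F (\<gamma> t) v) (at t)"
  unfolding grad_def by (rule has_field_derivative_mpeval) (rule assms)

lemma DERIV_line:
  "((\<lambda>t. mpeval F (vec_nth (x + t *s v))) has_field_derivative grad F x v) (at 0)"
proof -
  have "((\<lambda>t. mpeval F (vec_nth (x + t *s v))) has_field_derivative grad F (x + 0 *s v) v) (at 0)"
    by (rule DERIV_mpeval) (auto intro!: derivative_eq_intros)
  then show ?thesis by simp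
qed

text \<open>Scaling the tangent vector together with the point gives the full exponent d, without d
  - 1 and its truncation at d = 0.\<close>

lemma grad_scale_base:
  assumes "homogeneous d F"
  shows "grad F (c *s x) (c *s v) = c ^ d * grad F x v"
proof -
  have "(\<lambda>t. mpeval F (vec_nth (c *s x + t *s (c *s v)))) = (\<lambda>t. c ^ d * mpeval F (vec_nth (x + t *s v)))"
  proof
    fix t
    have "c *s x + t *s (c *s v) = c *s (x + t *s v)"
      by (simp add: vec_eq_iff algebra_simps)
    then show "mpeval F (vec_nth (c *s x + t *s (c *s v))) = c ^ d * mpeval F (vec_nth (x + t *s v))"
      using mpeval_scaleC[OF assms] by metis
  qed
  then show ?thesis
    using DERIV_unique[OF DERIV_line[of F "c *s x" "c *s v"]]
      DERIV_cmult[OF DERIV_line[of F x v], of "c ^ d"] by metis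
qed

lemma grad_self: "homogeneous d F \<Longrightarrow> grad F x x = of_nat d * mpeval F (vec_nth x)"
  unfolding grad_def by (rule euler_identity)

lemma grad_mult:
  "grad (F * G) x v = grad F x v * mpeval G (vec_nth x) + mpeval F (vec_nth x) * grad G x v"
proof -
  have "((\<lambda>t. mpeval (F * G) (vec_nth (x + t *s v))) has_field_derivative
     grad F x v * mpeval G (vec_nth x) + mpeval F (vec_nth x) * grad G x v) (at 0)"
    unfolding mpeval_mult by (auto intro!: derivative_eq_intros DERIV_line)
  then show ?thesis by (rule DERIV_unique[OF DERIV_line])
qed

lemma grad_diff: "grad (F - G) x v = grad F x v - grad G x v"
proof -
  have "((\<lambda>t. mpeval (F - G) (vec_nth (x + t *s v))) has_field_derivative
     grad F x v - grad G x v) (at 0)"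
    unfolding mpeval_diff by (auto intro!: derivative_eq_intros DERIV_line)
  then show ?thesis by (rule DERIV_unique[OF DERIV_line])
qed

lemma tangent_space_alt:
  "tangent_space X p = {v. \<forall>d. \<forall>F\<in>homog_ideal X d. grad F (coords p) v = 0}"
  unfolding tangent_space_def by (simp add: DERIV_imp_deriv[OF DERIV_line])

lemma tangent_space_scale:
  assumes "coords p = c *s x" "c \<noteq> 0"
  shows "v \<in> tangent_space X p \<longleftrightarrow> (\<forall>d. \<forall>F\<in>homog_ideal X d. grad F x v = 0)"
proof -
  have "grad F (coords p) v = 0 \<longleftrightarrow> grad F x v = 0" if "F \<in> homog_ideal X d" for d F
  proof -
    have "grad F (coords p) (c *s v) = c ^ d * grad F x v"
      using assms grad_scale_base that by (auto simp: homog_ideal_def)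
    then show ?thesis using assms(2) by (auto simp: grad_scale)
  qed
  then show ?thesis by (auto simp: tangent_space_alt)
qed

lemma tangent_space_subspace: "vec.subspace (tangent_space X p)"
  by (rule vec.subspaceI) (auto simp: tangent_space_alt grad_add grad_scale)

lemma coords_tangent: "p \<in> X \<Longrightarrow> coords p \<in> tangent_space X p"
  by (auto simp: tangent_space_alt homog_ideal_def grad_self)

text \<open>The quotient rule for F / G. For forms of equal degree it is unchanged when x and v are
  scaled together by a nonzero scalar, so tangent vectors will carry the same scalar as the
  representative of their base point.\<close>

definition qdiff :: "'n::finite mpoly \<Rightarrow> 'n mpoly \<Rightarrow> complex^'n \<Rightarrow> complex^'n \<Rightarrow> complex" where
  "qdiff F G x v = (grad F x v * mpeval G (vec_nth x) - mpeval F (vec_nth x) * grad G x v) /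
     (mpeval G (vec_nth x))\<^sup>2"

lemma deriv_quotient:
  assumes "mpeval G (vec_nth x) \<noteq> 0"
  shows "deriv (\<lambda>t. mpeval F (vec_nth (x + t *s v)) / mpeval G (vec_nth (x + t *s v))) 0 = qdiff F G x v"
proof (rule DERIV_imp_deriv)
  have "mpeval G (vec_nth (x + 0 *s v)) \<noteq> 0" using assms by simp
  then show "((\<lambda>t. mpeval F (vec_nth (x + t *s v)) / mpeval G (vec_nth (x + t *s v)))
      has_field_derivative qdiff F G x v) (at 0)"
    using DERIV_divide[OF DERIV_line[of F x v] DERIV_line[of G x v]]
    by (simp add: qdiff_def power2_eq_square)
qed

lemma qdiff_scale:
  assumes "homogeneous d F" "homogeneous d G" "c \<noteq> 0"
  shows "qdiff F G (c *s x) (c *s v) = qdiff F G x v"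
  using assms
  by (simp add: qdiff_def grad_scale_base mpeval_scaleC power_mult_distrib power2_eq_square
      divide_simps) (simp add: algebra_simps)

lemma qdiff_add: "qdiff F G x (v + w) = qdiff F G x v + qdiff F G x w"
  by (simp add: qdiff_def grad_add add_divide_distrib[symmetric] algebra_simps)

lemma qdiff_cmult: "qdiff F G x (c *s v) = c * qdiff F G x v"
  by (simp add: qdiff_def grad_scale algebra_simps)

text \<open>Quotients of forms of equal degree are constant along the line through x: by Euler's
  identity the two terms cancel. Differentials thus live on the tangent space modulo the
  line.\<close>

lemma qdiff_self: "homogeneous d F \<Longrightarrow> homogeneous d G \<Longrightarrow> qdiff F G x x = 0"
  by (simp add: qdiff_def grad_self)


section \<open>Zariski topology and regular functions\<close>

lemma openin_zariski_basic: "homogeneous d F \<Longrightarrow> openin zariski {p. form_at F p \<noteq> 0}"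
  unfolding zariski_def by (rule topology_generated_by_Basis) auto

text \<open>The generating sets already form a basis, because the intersection of two nonvanishing
  loci is the nonvanishing locus of the product form.\<close>

lemma zariski_basis:
  assumes "openin zariski V" "p \<in> V"
  obtains d A where "homogeneous d A" "form_at A p \<noteq> 0" "{q. form_at A q \<noteq> 0} \<subseteq> V"
proof -
  have "generate_topology_on {{p. form_at F p \<noteq> 0} | F d. homogeneous d F} V"
    using assms(1) unfolding zariski_def openin_topology_generated_by_iff .
  then have "\<forall>p\<in>V. \<exists>A d. homogeneous d A \<and> form_at A p \<noteq> 0 \<and> {q. form_at A q \<noteq> 0} \<subseteq> V"
  proof induction
    case (Int U W)
    show ?case
    proof
      fix p assume p: "p \<in> U \<inter> W"
      then obtain A d B e where
        "homogeneous d A" "form_at A p \<noteq> 0" "{q. form_at A q \<noteq> 0} \<subseteq> U"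
        "homogeneous e B" "form_at B p \<noteq> 0" "{q. form_at B q \<noteq> 0} \<subseteq> W"
        using Int.IH by (meson IntD1 IntD2)
      then show "\<exists>A d. homogeneous d A \<and> form_at A p \<noteq> 0 \<and> {q. form_at A q \<noteq> 0} \<subseteq> U \<inter> W"
        by (intro exI[of _ "A * B"] exI[of _ "d + e"]) (auto simp: homogeneous_mult mpeval_mult)
    qed
  next
    case (UN K)
    then show ?case by (meson UnionE Union_upper order_trans)
  qed auto
  with assms(2) that show thesis by blast
qed

lemma subtopology_zariski_basis:
  assumes "openin (subtopology zariski X) W" "p \<in> W"
  obtains d A where "homogeneous d A" "form_at A p \<noteq> 0" "{q\<in>X. form_at A q \<noteq> 0} \<subseteq> W"
proof -
  obtain V where "openin zariski V" "W = V \<inter> X"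
    using assms(1) by (auto simp: openin_subtopology)
  moreover from this assms(2) obtain d A where
    "homogeneous d A" "form_at A p \<noteq> 0" "{q. form_at A q \<noteq> 0} \<subseteq> V"
    using zariski_basis[of V p] by blast
  ultimately show thesis by (intro that[of d A]) auto
qed

lemma openin_subtopology_basic:
  "homogeneous d F \<Longrightarrow> openin (subtopology zariski X) {p\<in>X. form_at F p \<noteq> 0}"
  using openin_zariski_basic openin_subtopology by fastforce

lemma topspace_zariski: "topspace zariski = UNIV"
proof -
  have "{p :: 'a proj. form_at 1 p \<noteq> 0} = UNIV" by simp
  then have "openin zariski (UNIV :: 'a proj set)"
    using openin_zariski_basic[OF homogeneous_one] by metis
  then show ?thesis using openin_subset by blast
qed

lemma openin_zariski_self: "openin (subtopology zariski X) X"
  by (metis inf_top_left openin_topspace topspace_subtopology topspace_zariski)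

lemma openin_zariski_subset: "openin (subtopology zariski X) W \<Longrightarrow> W \<subseteq> X"
  using openin_subset topspace_subtopology by fastforce

text \<open>\<open>local_quotient\<close> with the open set made explicit, so that several functions
  can share one neighbourhood and the base point can move inside it.\<close>

definition quotient_on ::
  "'n::finite proj set \<Rightarrow> 'n proj set \<Rightarrow> ('n proj \<Rightarrow> complex) \<Rightarrow> 'n mpoly \<Rightarrow> 'n mpoly \<Rightarrow> bool" where
  "quotient_on X W f F G \<longleftrightarrow> (\<exists>d. homogeneous d F \<and> homogeneous d G) \<and>
     openin (subtopology zariski X) W \<and> (\<forall>y\<in>W. form_at G y \<noteq> 0 \<and> f y = form_at F y / form_at G y)"

lemma local_quotient_iff: "local_quotient X p f F G \<longleftrightarrow> (\<exists>W. p \<in> W \<and> quotient_on X W f F G)"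
  by (auto simp: local_quotient_def quotient_on_def)

lemma quotient_on_subset:
  "quotient_on X W f F G \<Longrightarrow> openin (subtopology zariski X) V \<Longrightarrow> V \<subseteq> W \<Longrightarrow> quotient_on X V f F G"
  by (auto simp: quotient_on_def)

text \<open>Justifies the definite description in \<open>differential\<close>. If F / G and F' / G'
  agree on X near p, then F G' - F' G vanishes on X near p; its gradient kills the tangent space,
  and this amounts to the equality of the two quotient rules.\<close>

lemma differential_eq:
  assumes "local_quotient X p f F G" "p \<in> X" "v \<in> tangent_space X p"
  shows "differential X f p v = qdiff F G (coords p) v"
proof -
  let ?x = "coords p"
  have nz: "form_at G p \<noteq> 0" if "local_quotient X p f F G" for F G
    using that by (auto simp: local_quotient_def)
  have uniq: "qdiff F' G' ?x v = qdiff F G ?x v" if F': "local_quotient X p f F' G'" for F' G'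
  proof -
    obtain W d W' d' where
      W: "p \<in> W" "openin (subtopology zariski X) W" "homogeneous d F" "homogeneous d G"
         "\<And>y. y \<in> W \<Longrightarrow> form_at G y \<noteq> 0 \<and> f y = form_at F y / form_at G y" and
      W': "p \<in> W'" "openin (subtopology zariski X) W'" "homogeneous d' F'" "homogeneous d' G'"
         "\<And>y. y \<in> W' \<Longrightarrow> form_at G' y \<noteq> 0 \<and> f y = form_at F' y / form_at G' y"
      using assms(1) F' unfolding local_quotient_def by blast
    \<comment> \<open>A form nonzero at p and zero on X off the common neighbourhood: multiplying by
      it turns vanishing near p into membership in the ideal of X.\<close>
    obtain e A where A: "homogeneous e A" "form_at A p \<noteq> 0" "{q\<in>X. form_at A q \<noteq> 0} \<subseteq> W \<inter> W'"
      using subtopology_zariski_basis[of X "W \<inter> W'" p] W W' by blast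
    define H where "H = F * G' - F' * G"
    have H: "homogeneous (d + d') H"
      unfolding H_def using W W' homogeneous_mult homogeneous_diff by (metis add.commute)
    have "form_at (A * H) q = 0" if "q \<in> X" for q
    proof (cases "form_at A q = 0")
      case False
      then have "q \<in> W" "q \<in> W'" using A that by auto
      then have "form_at G q \<noteq> 0" "form_at G' q \<noteq> 0" "form_at F q / form_at G q = form_at F' q / form_at G' q"
        using W(5) W'(5) by metis+
      then have "form_at H q = 0"
        by (simp add: H_def mpeval_diff mpeval_mult frac_eq_eq)
      then show ?thesis by (simp add: mpeval_mult)
    qed (simp add: mpeval_mult)
    then have "A * H \<in> homog_ideal X (e + (d + d'))"
      by (simp add: homog_ideal_def homogeneous_mult[OF A(1) H])
    then have "grad (A * H) ?x v = 0"
      using assms(3) by (auto simp: tangent_space_alt)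
    moreover have eq: "form_at F p * form_at G' p = form_at F' p * form_at G p"
      using W(5)[OF W(1)] W'(5)[OF W'(1)] by (metis frac_eq_eq)
    then have "form_at H p = 0"
      by (simp add: H_def mpeval_diff mpeval_mult)
    \<comment> \<open>Product rule: H vanishes at p and A does not, so only A(p) times the gradient
      of H is left.\<close>
    ultimately have "grad H ?x v = 0"
      using A(2) by (simp add: grad_mult)
    then have g: "grad F ?x v * form_at G' p + form_at F p * grad G' ?x v =
        grad F' ?x v * form_at G p + form_at F' p * grad G ?x v"
      by (simp add: H_def grad_diff grad_mult)
    have nG: "form_at G p \<noteq> 0" "form_at G' p \<noteq> 0"
      using W(5)[OF W(1)] W'(5)[OF W'(1)] by auto
    define a b a' b' ga gb ga' gb' where
      defs: "a = form_at F p" "b = form_at G p" "a' = form_at F' p" "b' = form_at G' p"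
        "ga = grad F ?x v" "gb = grad G ?x v" "ga' = grad F' ?x v" "gb' = grad G' ?x v"
    have "(ga' * b' - a' * gb') / b'\<^sup>2 = (ga * b - a * gb) / b\<^sup>2"
    proof -
      have "a * b' = a' * b" "ga * b' + a * gb' = ga' * b + a' * gb"
        using eq g unfolding defs .
      then have "(ga' * b' - a' * gb') * b\<^sup>2 = (ga * b - a * gb) * b'\<^sup>2"
        by algebra
      then show ?thesis using nG unfolding defs[symmetric] by (simp add: frac_eq_eq)
    qed
    then show ?thesis unfolding qdiff_def defs .
  qed
  show ?thesis
    unfolding differential_def
  proof (rule the_equality)
    show "\<exists>F' G'. local_quotient X p f F' G' \<and> qdiff F G ?x v =
        deriv (\<lambda>t. mpeval F' (vec_nth (?x + t *s v)) / mpeval G' (vec_nth (?x + t *s v))) 0"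
      by (rule exI[of _ F], rule exI[of _ G]) (simp add: assms(1) deriv_quotient[OF nz[OF assms(1)]])
  next
    fix D
    assume "\<exists>F' G'. local_quotient X p f F' G' \<and> D =
        deriv (\<lambda>t. mpeval F' (vec_nth (?x + t *s v)) / mpeval G' (vec_nth (?x + t *s v))) 0"
    then obtain F' G' where *: "local_quotient X p f F' G'"
      "D = deriv (\<lambda>t. mpeval F' (vec_nth (?x + t *s v)) / mpeval G' (vec_nth (?x + t *s v))) 0"
      by blast
    then have "D = qdiff F' G' ?x v" by (simp only: deriv_quotient[OF nz[OF *(1)]])
    then show "D = qdiff F G ?x v" using uniq[OF *(1)] by simp
  qed
qed

section \<open>Operations on regular functions and units\<close>

lemma regular_on_subset: "regular_on X U f \<Longrightarrow> V \<subseteq> U \<Longrightarrow> regular_on X V f"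
  by (auto simp: regular_on_def)

lemma regular_onE:
  assumes "regular_on X U f" "p \<in> U"
  obtains W F G where "p \<in> W" "quotient_on X W f F G"
  using assms unfolding regular_on_def local_quotient_iff by blast

lemma regular_onI:
  "(\<And>p. p \<in> U \<Longrightarrow> \<exists>W F G. p \<in> W \<and> quotient_on X W f F G) \<Longrightarrow> regular_on X U f"
  unfolding regular_on_def local_quotient_iff by blast

lemma regular_on_local:
  assumes "\<And>p. p \<in> U \<Longrightarrow> \<exists>V g. openin (subtopology zariski X) V \<and> p \<in> V \<and> regular_on X V g \<and>
     (\<forall>y\<in>V. f y = g y)"
  shows "regular_on X U f"
proof (rule regular_onI)
  fix p assume "p \<in> U"
  then obtain V g where V: "openin (subtopology zariski X) V" "p \<in> V" "regular_on X V g" "\<forall>y\<in>V. f y = g y"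
    using assms by blast
  then obtain W F G where W: "p \<in> W" "quotient_on X W g F G" by (meson regular_onE)
  then have "quotient_on X (W \<inter> V) f F G"
    using V by (auto simp: quotient_on_def)
  then show "\<exists>W F G. p \<in> W \<and> quotient_on X W f F G" using W V by blast
qed

lemma regular_on_const: "U \<subseteq> X \<Longrightarrow> regular_on X U (\<lambda>_. c)"
proof (rule regular_onI)
  fix p assume "U \<subseteq> X" "p \<in> U"
  moreover have "quotient_on X X (\<lambda>_. c) (Poly_Mapping.single 0 c) 1"
    unfolding quotient_on_def using openin_zariski_self homogeneous_const homogeneous_one by fastforce
  ultimately show "\<exists>W F G. p \<in> W \<and> quotient_on X W (\<lambda>_. c) F G" by blast
qed

lemma regular_on_mult:
  assumes "regular_on X U f" "regular_on X U g"
  shows "regular_on X U (\<lambda>y. f y * g y)"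
proof (rule regular_onI)
  fix p assume p: "p \<in> U"
  obtain W F G where W: "p \<in> W" "quotient_on X W f F G" using assms p regular_onE by metis
  obtain W' F' G' where W': "p \<in> W'" "quotient_on X W' g F' G'" using assms p regular_onE by metis
  have "quotient_on X (W \<inter> W') (\<lambda>y. f y * g y) (F * F') (G * G')"
    unfolding quotient_on_def
  proof (intro conjI ballI)
    show "\<exists>d. homogeneous d (F * F') \<and> homogeneous d (G * G')"
      using W(2) W'(2) unfolding quotient_on_def by (meson homogeneous_mult)
  qed (use W(2) W'(2) in \<open>auto simp: quotient_on_def mpeval_mult\<close>)
  then show "\<exists>W F G. p \<in> W \<and> quotient_on X W (\<lambda>y. f y * g y) F G" using W W' by blast
qed

lemma unit_on_inverse:
  assumes "unit_on X U f"
  shows "unit_on X U (\<lambda>y. inverse (f y))"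
  unfolding unit_on_def
proof
  show "regular_on X U (\<lambda>y. inverse (f y))"
  proof (rule regular_onI)
    fix p assume p: "p \<in> U"
    then obtain W F G where W: "p \<in> W" "quotient_on X W f F G"
      using assms unfolding unit_on_def by (meson regular_onE)
    then obtain d where d: "homogeneous d F" "homogeneous d G" by (auto simp: quotient_on_def)
    let ?W = "W \<inter> {y\<in>X. form_at F y \<noteq> 0}"
    have "quotient_on X ?W (\<lambda>y. inverse (f y)) G F"
      using W d openin_subtopology_basic[OF d(1), of X] by (auto simp: quotient_on_def)
    moreover have "p \<in> ?W"
      using W assms p openin_zariski_subset by (fastforce simp: quotient_on_def unit_on_def)
    ultimately show "\<exists>W F G. p \<in> W \<and> quotient_on X W (\<lambda>y. inverse (f y)) F G"
      by (intro exI conjI)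
  qed
qed (use assms in \<open>auto simp: unit_on_def\<close>)

lemma unit_on_mult: "unit_on X U f \<Longrightarrow> unit_on X U g \<Longrightarrow> unit_on X U (\<lambda>y. f y * g y)"
  by (auto simp: unit_on_def regular_on_mult)

lemma unit_on_subset: "unit_on X U f \<Longrightarrow> V \<subseteq> U \<Longrightarrow> unit_on X V f"
  by (auto simp: unit_on_def regular_on_subset)

lemma unit_on_const: "U \<subseteq> X \<Longrightarrow> c \<noteq> 0 \<Longrightarrow> unit_on X U (\<lambda>_. c)"
  by (simp add: unit_on_def regular_on_const)

lemma unit_on_local:
  assumes "\<And>p. p \<in> U \<Longrightarrow> \<exists>V g. openin (subtopology zariski X) V \<and> p \<in> V \<and> unit_on X V g \<and>
     (\<forall>y\<in>V. f y = g y)"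
  shows "unit_on X U f"
  unfolding unit_on_def
proof
  show "regular_on X U f"
    by (rule regular_on_local) (use assms in \<open>meson unit_on_def\<close>)
  show "\<forall>p\<in>U. f p \<noteq> 0"
    using assms by (metis unit_on_def)
qed

section \<open>The Picard group\<close>

lemma line_bundle_chart:
  assumes "line_bundle X L" "p \<in> X"
  shows "openin (subtopology zariski X) (chart L p)" "p \<in> chart L p" "chart L p \<subseteq> X"
  using assms openin_zariski_subset unfolding line_bundle_def by blast+

lemma line_bundle_unit:
  "line_bundle X L \<Longrightarrow> p \<in> X \<Longrightarrow> q \<in> X \<Longrightarrow> unit_on X (chart L p \<inter> chart L q) (transition L p q)"
  unfolding line_bundle_def by blast

lemma transition_cocycle:
  "line_bundle X L \<Longrightarrow> p \<in> X \<Longrightarrow> q \<in> X \<Longrightarrow> r \<in> X \<Longrightarrow> x \<in> chart L p \<Longrightarrow> x \<in> chart L q \<Longrightarrow> x \<in> chart L r \<Longrightarrow>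
   transition L p q x * transition L q r x = transition L p r x"
  unfolding line_bundle_def by blast

lemma transition_nonzero:
  "line_bundle X L \<Longrightarrow> p \<in> X \<Longrightarrow> q \<in> X \<Longrightarrow> x \<in> chart L p \<Longrightarrow> x \<in> chart L q \<Longrightarrow> transition L p q x \<noteq> 0"
  using line_bundle_unit unfolding unit_on_def by blast

lemma transition_refl:
  "line_bundle X L \<Longrightarrow> p \<in> X \<Longrightarrow> x \<in> chart L p \<Longrightarrow> transition L p p x = 1"
  using transition_cocycle[of X L p p p x] transition_nonzero[of X L p p x] by simp

lemma transition_inverse:
  "line_bundle X L \<Longrightarrow> p \<in> X \<Longrightarrow> q \<in> X \<Longrightarrow> x \<in> chart L p \<Longrightarrow> x \<in> chart L q \<Longrightarrow>
   transition L p q x * transition L q p x = 1"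
  using transition_cocycle[of X L p q p x] transition_refl[of X L p x] by simp

text \<open>The transition functions of L are the matrices of the identity map between the charts.
  Commutativity, associativity and the unit law of the Picard group follow from this, since the two
  sides have the same charts and transition functions.\<close>

lemma bundle_iso_same:
  assumes L: "line_bundle X L" and "\<And>p. p \<in> X \<Longrightarrow> chart M p = chart L p"
    "\<And>p q x. p \<in> X \<Longrightarrow> q \<in> X \<Longrightarrow> x \<in> chart L p \<inter> chart L q \<Longrightarrow> transition M p q x = transition L p q x"
  shows "bundle_iso X L M"
  unfolding bundle_iso_def
proof (intro exI[of _ "\<lambda>p q. transition L q p"] conjI ballI)
  fix p q assume "p \<in> X" "q \<in> X"
  then show "unit_on X (chart L p \<inter> chart M q) (transition L q p)"
    using line_bundle_unit[OF L, of q p] assms(2) by (simp add: Int_commute)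
next
  fix p p' q q' x
  assume *: "p \<in> X" "p' \<in> X" "q \<in> X" "q' \<in> X" "x \<in> chart L p \<inter> chart L p' \<inter> chart M q \<inter> chart M q'"
  then have "transition M q' q x = transition L q' q x" using assms(2,3) by simp
  moreover have "transition L q' q x * transition L q p x = transition L q' p x"
      "transition L q' p x * transition L p p' x = transition L q' p' x"
    using * assms(2) by (simp_all add: transition_cocycle[OF L])
  ultimately show "transition L q' p' x = transition M q' q x * transition L q p x * transition L p p' x"
    by simp
qed

lemma bundle_iso_refl: "line_bundle X L \<Longrightarrow> bundle_iso X L L"
  by (rule bundle_iso_same) auto

lemma bundle_iso_sym:
  assumes L: "line_bundle X L" and M: "line_bundle X M" and "bundle_iso X L M"
  shows "bundle_iso X M L"
proof -
  obtain \<phi> where \<phi>: "\<And>p q. p \<in> X \<Longrightarrow> q \<in> X \<Longrightarrow> unit_on X (chart L p \<inter> chart M q) (\<phi> p q)"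
    "\<And>p p' q q' x. p \<in> X \<Longrightarrow> p' \<in> X \<Longrightarrow> q \<in> X \<Longrightarrow> q' \<in> X \<Longrightarrow>
      x \<in> chart L p \<inter> chart L p' \<inter> chart M q \<inter> chart M q' \<Longrightarrow>
      \<phi> p' q' x = transition M q' q x * \<phi> p q x * transition L p p' x"
    using assms(3) unfolding bundle_iso_def by blast
  show ?thesis
    unfolding bundle_iso_def
  proof (intro exI[of _ "\<lambda>q p x. inverse (\<phi> p q x)"] conjI ballI)
    fix p q assume "p \<in> X" "q \<in> X"
    then show "unit_on X (chart M p \<inter> chart L q) (\<lambda>x. inverse (\<phi> q p x))"
      using unit_on_inverse[OF \<phi>(1)[of q p]] by (simp add: Int_commute)
  next
    fix q q' p p' x
    assume *: "q \<in> X" "q' \<in> X" "p \<in> X" "p' \<in> X" "x \<in> chart M q \<inter> chart M q' \<inter> chart L p \<inter> chart L p'"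
    have "\<phi> p' q' x = transition M q' q x * \<phi> p q x * transition L p p' x"
      using \<phi>(2)[of p p' q q' x] * by auto
    moreover have "inverse (transition M q' q x) = transition M q q' x"
      by (rule inverse_unique) (use * transition_inverse[OF M] in auto)
    moreover have "inverse (transition L p p' x) = transition L p' p x"
      by (rule inverse_unique) (use * transition_inverse[OF L] in auto)
    ultimately show "inverse (\<phi> p' q' x) = transition L p' p x * inverse (\<phi> p q x) * transition M q q' x"
      by simp
  qed
qed

text \<open>The composite of \<phi> p q and \<psi> q r makes sense only over
  \<open>chart M q\<close>, and a single q need not cover the overlap of a chart of L with one of N.
  At a point x the index q = x is taken, as x lies in its own chart; since the value does not depend
  on q, it agrees near each point with the regular function for a fixed q.\<close>

lemma bundle_iso_trans:
  assumes L: "line_bundle X L" and M: "line_bundle X M" and N: "line_bundle X N"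
    and "bundle_iso X L M" "bundle_iso X M N"
  shows "bundle_iso X L N"
proof -
  obtain \<phi> where \<phi>: "\<And>p q. p \<in> X \<Longrightarrow> q \<in> X \<Longrightarrow> unit_on X (chart L p \<inter> chart M q) (\<phi> p q)"
    "\<And>p p' q q' x. p \<in> X \<Longrightarrow> p' \<in> X \<Longrightarrow> q \<in> X \<Longrightarrow> q' \<in> X \<Longrightarrow>
      x \<in> chart L p \<inter> chart L p' \<inter> chart M q \<inter> chart M q' \<Longrightarrow>
      \<phi> p' q' x = transition M q' q x * \<phi> p q x * transition L p p' x"
    using assms(4) unfolding bundle_iso_def by blast
  obtain \<psi> where \<psi>: "\<And>p q. p \<in> X \<Longrightarrow> q \<in> X \<Longrightarrow> unit_on X (chart M p \<inter> chart N q) (\<psi> p q)"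
    "\<And>p p' q q' x. p \<in> X \<Longrightarrow> p' \<in> X \<Longrightarrow> q \<in> X \<Longrightarrow> q' \<in> X \<Longrightarrow>
      x \<in> chart M p \<inter> chart M p' \<inter> chart N q \<inter> chart N q' \<Longrightarrow>
      \<psi> p' q' x = transition N q' q x * \<psi> p q x * transition M p p' x"
    using assms(5) unfolding bundle_iso_def by blast
  \<comment> \<open>Independence of the middle index: passing from q to y inserts a transition
    function of M and its inverse.\<close>
  have key: "\<phi> p' y y * \<psi> y r' y = transition N r' r y * (\<phi> p q y * \<psi> q r y) * transition L p p' y"
    if "p \<in> X" "p' \<in> X" "q \<in> X" "r \<in> X" "r' \<in> X" "y \<in> chart L p" "y \<in> chart L p'"
      "y \<in> chart M q" "y \<in> chart N r" "y \<in> chart N r'" for p p' q r r' y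
  proof -
    have y: "y \<in> X" "y \<in> chart M y"
      using line_bundle_chart[OF L] line_bundle_chart[OF M] that by blast+
    have "\<phi> p' y y = transition M y q y * \<phi> p q y * transition L p p' y"
      using \<phi>(2)[of p p' q y y] that y by auto
    moreover have "\<psi> y r' y = transition N r' r y * \<psi> q r y * transition M q y y"
      using \<psi>(2)[of q y r r' y] that y by auto
    moreover have "transition M y q y * transition M q y y = 1"
      using transition_inverse[OF M] that y by auto
    ultimately show ?thesis by algebra
  qed
  show ?thesis
    unfolding bundle_iso_def
  proof (intro exI[of _ "\<lambda>p r x. \<phi> p x x * \<psi> x r x"] conjI ballI)
    fix p r assume pr: "p \<in> X" "r \<in> X"
    show "unit_on X (chart L p \<inter> chart N r) (\<lambda>x. \<phi> p x x * \<psi> x r x)"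
    proof (rule unit_on_local)
      fix q assume q: "q \<in> chart L p \<inter> chart N r"
      then have qX: "q \<in> X" using line_bundle_chart[OF L] pr by blast
      let ?V = "chart L p \<inter> chart N r \<inter> chart M q"
      have "openin (subtopology zariski X) ?V"
        by (intro openin_Int line_bundle_chart[OF L] line_bundle_chart[OF M] line_bundle_chart[OF N] pr qX)
      moreover have "q \<in> ?V" using q qX line_bundle_chart[OF M] by auto
      moreover have "unit_on X ?V (\<lambda>y. \<phi> p q y * \<psi> q r y)"
        by (rule unit_on_mult; rule unit_on_subset[OF \<phi>(1)[OF pr(1) qX]]
            unit_on_subset[OF \<psi>(1)[OF qX pr(2)]]) auto
      moreover have "\<phi> p y y * \<psi> y r y = \<phi> p q y * \<psi> q r y" if "y \<in> ?V" for y
        using key[of p p q r r y] that pr qX transition_refl[OF L] transition_refl[OF N] by auto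
      ultimately show "\<exists>V g. openin (subtopology zariski X) V \<and> q \<in> V \<and> unit_on X V g \<and>
          (\<forall>y\<in>V. \<phi> p y y * \<psi> y r y = g y)" by blast
    qed
  next
    fix p p' r r' x
    assume *: "p \<in> X" "p' \<in> X" "r \<in> X" "r' \<in> X" "x \<in> chart L p \<inter> chart L p' \<inter> chart N r \<inter> chart N r'"
    then have "x \<in> X" "x \<in> chart M x"
      using line_bundle_chart[OF L] line_bundle_chart[OF M] by blast+
    then show "\<phi> p' x x * \<psi> x r' x = transition N r' r x * (\<phi> p x x * \<psi> x r x) * transition L p p' x"
      using key[of p p' x r r' x] * by auto
  qed
qed

lemma equiv_bundle_iso_rel: "equiv {L. line_bundle X L} (bundle_iso_rel X)"
  unfolding bundle_iso_rel_def
  by (intro equivI refl_onI symI transI)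
     (auto intro: bundle_iso_refl bundle_iso_sym bundle_iso_trans)

lemma chart_tensor [simp]: "chart (bundle_tensor L M) p = chart L p \<inter> chart M p"
  and transition_tensor [simp]:
    "transition (bundle_tensor L M) p q x = transition L p q x * transition M p q x"
  by (simp_all add: bundle_tensor_def)

lemma line_bundle_tensor:
  assumes L: "line_bundle X L" and M: "line_bundle X M"
  shows "line_bundle X (bundle_tensor L M)"
  unfolding line_bundle_def
proof (intro conjI ballI)
  fix p q assume pq: "p \<in> X" "q \<in> X"
  have "unit_on X (chart L p \<inter> chart M p \<inter> (chart L q \<inter> chart M q)) (\<lambda>x. transition L p q x * transition M p q x)"
    by (rule unit_on_mult; rule unit_on_subset[OF line_bundle_unit[OF L pq]]
        unit_on_subset[OF line_bundle_unit[OF M pq]]) auto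
  then show "unit_on X (chart (bundle_tensor L M) p \<inter> chart (bundle_tensor L M) q)
      (transition (bundle_tensor L M) p q)"
    by (simp add: bundle_tensor_def)
next
  fix p q r x
  assume *: "p \<in> X" "q \<in> X" "r \<in> X" "x \<in> chart (bundle_tensor L M) p \<inter> chart (bundle_tensor L M) q \<inter>
      chart (bundle_tensor L M) r"
  have 1: "transition L p q x * transition L q r x = transition L p r x"
    and 2: "transition M p q x * transition M q r x = transition M p r x"
    using * transition_cocycle[OF L] transition_cocycle[OF M] by auto
  then show "transition (bundle_tensor L M) p q x * transition (bundle_tensor L M) q r x =
      transition (bundle_tensor L M) p r x"
    unfolding transition_tensor 1[symmetric] 2[symmetric] by (simp only: mult_ac)
next
  fix p assume "p \<in> X"
  then show "openin (subtopology zariski X) (chart (bundle_tensor L M) p)"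
      "p \<in> chart (bundle_tensor L M) p"
    using line_bundle_chart[OF L] line_bundle_chart[OF M] unfolding chart_tensor
    by (blast intro: openin_Int)+
qed

lemma bundle_iso_tensor:
  assumes "bundle_iso X L L'" "bundle_iso X M M'"
  shows "bundle_iso X (bundle_tensor L M) (bundle_tensor L' M')"
proof -
  obtain \<phi> where \<phi>: "\<And>p q. p \<in> X \<Longrightarrow> q \<in> X \<Longrightarrow> unit_on X (chart L p \<inter> chart L' q) (\<phi> p q)"
    "\<And>p p' q q' x. p \<in> X \<Longrightarrow> p' \<in> X \<Longrightarrow> q \<in> X \<Longrightarrow> q' \<in> X \<Longrightarrow>
      x \<in> chart L p \<inter> chart L p' \<inter> chart L' q \<inter> chart L' q' \<Longrightarrow>
      \<phi> p' q' x = transition L' q' q x * \<phi> p q x * transition L p p' x"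
    using assms(1) unfolding bundle_iso_def by blast
  obtain \<psi> where \<psi>: "\<And>p q. p \<in> X \<Longrightarrow> q \<in> X \<Longrightarrow> unit_on X (chart M p \<inter> chart M' q) (\<psi> p q)"
    "\<And>p p' q q' x. p \<in> X \<Longrightarrow> p' \<in> X \<Longrightarrow> q \<in> X \<Longrightarrow> q' \<in> X \<Longrightarrow>
      x \<in> chart M p \<inter> chart M p' \<inter> chart M' q \<inter> chart M' q' \<Longrightarrow>
      \<psi> p' q' x = transition M' q' q x * \<psi> p q x * transition M p p' x"
    using assms(2) unfolding bundle_iso_def by blast
  show ?thesis
    unfolding bundle_iso_def
  proof (intro exI[of _ "\<lambda>p q x. \<phi> p q x * \<psi> p q x"] conjI ballI)
    fix p q assume pq: "p \<in> X" "q \<in> X"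
    show "unit_on X (chart (bundle_tensor L M) p \<inter> chart (bundle_tensor L' M') q) (\<lambda>x. \<phi> p q x * \<psi> p q x)"
      by (rule unit_on_mult; rule unit_on_subset[OF \<phi>(1)[OF pq]] unit_on_subset[OF \<psi>(1)[OF pq]]) auto
  next
    fix p p' q q' x
    assume *: "p \<in> X" "p' \<in> X" "q \<in> X" "q' \<in> X" "x \<in> chart (bundle_tensor L M) p \<inter> chart (bundle_tensor L M) p' \<inter>
      chart (bundle_tensor L' M') q \<inter> chart (bundle_tensor L' M') q'"
    have "\<phi> p' q' x = transition L' q' q x * \<phi> p q x * transition L p p' x"
      using \<phi>(2)[of p p' q q' x] * by auto
    moreover have "\<psi> p' q' x = transition M' q' q x * \<psi> p q x * transition M p p' x"
      using \<psi>(2)[of p p' q q' x] * by auto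
    ultimately show "\<phi> p' q' x * \<psi> p' q' x = transition (bundle_tensor L' M') q' q x * (\<phi> p q x * \<psi> p q x) *
        transition (bundle_tensor L M) p p' x"
      by (simp add: mult_ac)
  qed
qed

lemma line_bundle_trivial: "line_bundle X (trivial_bundle X)"
  unfolding line_bundle_def trivial_bundle_def
  by (auto intro: openin_zariski_self unit_on_const)

definition dual_bundle :: "'n::finite lbundle \<Rightarrow> 'n lbundle" where
  "dual_bundle L = LBundle (chart L) (\<lambda>p q x. inverse (transition L p q x))"

lemma line_bundle_dual:
  assumes L: "line_bundle X L"
  shows "line_bundle X (dual_bundle L)"
  unfolding line_bundle_def
proof (intro conjI ballI)
  fix p q r x
  assume *: "p \<in> X" "q \<in> X" "r \<in> X" "x \<in> chart (dual_bundle L) p \<inter> chart (dual_bundle L) q \<inter> chart (dual_bundle L) r"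
  have "transition L p q x * transition L q r x = transition L p r x"
    using * transition_cocycle[OF L] by (auto simp: dual_bundle_def)
  then show "transition (dual_bundle L) p q x * transition (dual_bundle L) q r x = transition (dual_bundle L) p r x"
    by (simp add: dual_bundle_def flip: inverse_mult_distrib)
qed (use line_bundle_chart[OF L] unit_on_inverse[OF line_bundle_unit[OF L]] in \<open>auto simp: dual_bundle_def\<close>)

lemma bundle_iso_dual:
  assumes L: "line_bundle X L"
  shows "bundle_iso X (bundle_tensor (dual_bundle L) L) (trivial_bundle X)"
  unfolding bundle_iso_def
proof (intro exI[of _ "\<lambda>p q x. 1"] conjI ballI)
  fix p q assume "p \<in> X" "q \<in> X"
  then show "unit_on X (chart (bundle_tensor (dual_bundle L) L) p \<inter> chart (trivial_bundle X) q) (\<lambda>x. 1)"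
    by (intro unit_on_const) (auto simp: trivial_bundle_def)
next
  fix p p' q q' x
  assume "p \<in> X" "p' \<in> X" "q \<in> X" "q' \<in> X" "x \<in> chart (bundle_tensor (dual_bundle L) L) p \<inter>
     chart (bundle_tensor (dual_bundle L) L) p' \<inter> chart (trivial_bundle X) q \<inter> chart (trivial_bundle X) q'"
  then have "transition L p p' x \<noteq> 0"
    using transition_nonzero[OF L] by auto
  then show "1 = transition (trivial_bundle X) q' q x * 1 * transition (bundle_tensor (dual_bundle L) L) p p' x"
    by (simp add: trivial_bundle_def dual_bundle_def)
qed

section \<open>The group law on isomorphism classes\<close>

abbreviation bundle_class :: "'n::finite proj set \<Rightarrow> 'n lbundle \<Rightarrow> 'n lbundle set" where
  "bundle_class X L \<equiv> bundle_iso_rel X `` {L}"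

lemma bundle_class_eq_iff:
  "line_bundle X L \<Longrightarrow> line_bundle X M \<Longrightarrow> bundle_class X L = bundle_class X M \<longleftrightarrow> bundle_iso X L M"
  using eq_equiv_class_iff[OF equiv_bundle_iso_rel, of L X M] by (simp add: bundle_iso_rel_def)

lemma carrier_Pic: "carrier (Pic X) = {bundle_class X L | L. line_bundle X L}"
  by (auto simp: Pic_def quotient_def)

lemma one_Pic: "\<one>\<^bsub>Pic X\<^esub> = bundle_class X (trivial_bundle X)"
  by (simp add: Pic_def)

text \<open>The product of classes is a union over all representatives; tensoring isomorphisms shows
  that all members of this union are one and the same class.\<close>

lemma mult_Pic:
  assumes L: "line_bundle X L" and M: "line_bundle X M"
  shows "bundle_class X L \<otimes>\<^bsub>Pic X\<^esub> bundle_class X M = bundle_class X (bundle_tensor L M)"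
proof -
  have "bundle_class X (bundle_tensor L' M') = bundle_class X (bundle_tensor L M)"
    if "L' \<in> bundle_class X L" "M' \<in> bundle_class X M" for L' M'
  proof -
    have *: "line_bundle X L'" "line_bundle X M'" "bundle_iso X L L'" "bundle_iso X M M'"
      using that by (auto simp: bundle_iso_rel_def)
    then have "bundle_iso X (bundle_tensor L' M') (bundle_tensor L M)"
      using bundle_iso_tensor[OF bundle_iso_sym[OF L *(1) *(3)] bundle_iso_sym[OF M *(2) *(4)]] by simp
    then show ?thesis
      using * L M by (simp add: bundle_class_eq_iff line_bundle_tensor)
  qed
  moreover have "L \<in> bundle_class X L" "M \<in> bundle_class X M"
    using L M by (auto simp: bundle_iso_rel_def bundle_iso_refl)
  ultimately have "(\<Union>A\<in>bundle_class X L. \<Union>B\<in>bundle_class X M. bundle_class X (bundle_tensor A B)) =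
      bundle_class X (bundle_tensor L M)"
    by blast
  then show ?thesis by (simp add: Pic_def)
qed

lemma comm_group_Pic: "comm_group (Pic X)"
proof (rule comm_groupI)
  show "\<one>\<^bsub>Pic X\<^esub> \<in> carrier (Pic X)"
    unfolding carrier_Pic one_Pic using line_bundle_trivial by blast
next
  fix a b assume "a \<in> carrier (Pic X)" "b \<in> carrier (Pic X)"
  then obtain L M where *: "line_bundle X L" "line_bundle X M" "a = bundle_class X L" "b = bundle_class X M"
    by (auto simp: carrier_Pic)
  then show "a \<otimes>\<^bsub>Pic X\<^esub> b \<in> carrier (Pic X)"
    using line_bundle_tensor by (auto simp: mult_Pic carrier_Pic)
  have "bundle_iso X (bundle_tensor L M) (bundle_tensor M L)"
    by (rule bundle_iso_same) (use * line_bundle_tensor in \<open>auto simp: mult.commute\<close>)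
  then show "a \<otimes>\<^bsub>Pic X\<^esub> b = b \<otimes>\<^bsub>Pic X\<^esub> a"
    using * by (simp add: mult_Pic bundle_class_eq_iff line_bundle_tensor)
next
  fix a b c assume "a \<in> carrier (Pic X)" "b \<in> carrier (Pic X)" "c \<in> carrier (Pic X)"
  then obtain L M N where *: "line_bundle X L" "line_bundle X M" "line_bundle X N"
      "a = bundle_class X L" "b = bundle_class X M" "c = bundle_class X N"
    by (auto simp: carrier_Pic)
  have "bundle_iso X (bundle_tensor (bundle_tensor L M) N) (bundle_tensor L (bundle_tensor M N))"
    by (rule bundle_iso_same) (use * in \<open>auto simp: mult.assoc intro: line_bundle_tensor\<close>)
  then show "a \<otimes>\<^bsub>Pic X\<^esub> b \<otimes>\<^bsub>Pic X\<^esub> c = a \<otimes>\<^bsub>Pic X\<^esub> (b \<otimes>\<^bsub>Pic X\<^esub> c)"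
    using * by (simp add: mult_Pic bundle_class_eq_iff line_bundle_tensor)
next
  fix a assume "a \<in> carrier (Pic X)"
  then obtain L where *: "line_bundle X L" "a = bundle_class X L"
    by (auto simp: carrier_Pic)
  have "bundle_iso X L (bundle_tensor (trivial_bundle X) L)"
    by (rule bundle_iso_same) (use * line_bundle_chart[OF *(1)] in \<open>auto simp: trivial_bundle_def\<close>)
  then have "bundle_iso X (bundle_tensor (trivial_bundle X) L) L"
    by (rule bundle_iso_sym[rotated 2]) (use * in \<open>auto intro: line_bundle_tensor line_bundle_trivial\<close>)
  then show "\<one>\<^bsub>Pic X\<^esub> \<otimes>\<^bsub>Pic X\<^esub> a = a"
    using * by (simp add: one_Pic mult_Pic line_bundle_trivial bundle_class_eq_iff line_bundle_tensor)
  have "bundle_class X (dual_bundle L) \<otimes>\<^bsub>Pic X\<^esub> a = \<one>\<^bsub>Pic X\<^esub>"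
    using * bundle_iso_dual[OF *(1)]
    by (simp add: one_Pic mult_Pic line_bundle_trivial line_bundle_dual bundle_class_eq_iff line_bundle_tensor)
  then show "\<exists>b\<in>carrier (Pic X). b \<otimes>\<^bsub>Pic X\<^esub> a = \<one>\<^bsub>Pic X\<^esub>"
    using line_bundle_dual[OF *(1)] by (auto simp: carrier_Pic)
qed

text \<open>Turns the inverse in the group back into an actual trivialization, which can be
  evaluated along a curve.\<close>

lemma inverse_class_iso:
  assumes K: "line_bundle X K" and "H \<in> inv\<^bsub>Pic X\<^esub> (bundle_class X K)"
  shows "bundle_iso X (bundle_tensor K H) (trivial_bundle X)"
proof -
  interpret comm_group "Pic X" by (rule comm_group_Pic)
  have Kc: "bundle_class X K \<in> carrier (Pic X)" using K by (auto simp: carrier_Pic)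
  then obtain D where D: "line_bundle X D" "inv\<^bsub>Pic X\<^esub> (bundle_class X K) = bundle_class X D"
    using inv_closed[OF Kc] by (auto simp: carrier_Pic)
  with assms(2) have H: "line_bundle X H" "bundle_iso X D H" by (auto simp: bundle_iso_rel_def)
  then have "bundle_class X D = bundle_class X H" using D by (simp add: bundle_class_eq_iff)
  then have "bundle_class X K \<otimes>\<^bsub>Pic X\<^esub> bundle_class X H = \<one>\<^bsub>Pic X\<^esub>"
    using r_inv[OF Kc] D(2) by simp
  then show ?thesis
    using K H by (simp add: one_Pic mult_Pic line_bundle_trivial bundle_class_eq_iff line_bundle_tensor)
qed

section \<open>Jacobians\<close>

lemma in_span_frame:
  fixes b :: "complex^'n::finite" and w :: "3 \<Rightarrow> complex^'n"
  assumes "v \<in> vec.span (insert b (range w))"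
  obtains \<beta> a where "v = \<beta> *s b + (\<Sum>k\<in>UNIV. a k *s w k)"
proof -
  let ?S = "{\<beta> *s b + (\<Sum>k\<in>UNIV. a k *s w k) | \<beta> a. True}"
  have "vec.span (insert b (range w)) \<subseteq> ?S"
  proof (rule vec.span_minimal)
    show "vec.subspace ?S"
    proof (rule vec.subspaceI)
      show "0 \<in> ?S"
        by (intro CollectI exI[of _ 0] exI[of _ "\<lambda>_. 0"]) simp
    next
      fix x y assume "x \<in> ?S" "y \<in> ?S"
      then obtain \<beta> a \<beta>' a' where "x = \<beta> *s b + (\<Sum>k\<in>UNIV. a k *s w k)" "y = \<beta>' *s b + (\<Sum>k\<in>UNIV. a' k *s w k)"
        by blast
      then show "x + y \<in> ?S"
        by (intro CollectI exI[of _ "\<beta> + \<beta>'"] exI[of _ "\<lambda>k. a k + a' k"])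
           (simp add: vec.scale_left_distrib sum.distrib)
    next
      fix c x assume "x \<in> ?S"
      then obtain \<beta> a where "x = \<beta> *s b + (\<Sum>k\<in>UNIV. a k *s w k)" by blast
      then show "c *s x \<in> ?S"
        by (intro CollectI exI[of _ "c * \<beta>"] exI[of _ "\<lambda>k. c * a k"])
           (simp add: vec.scale_right_distrib vec.scale_sum_right)
    qed
    have "b = 1 *s b + (\<Sum>k\<in>UNIV. 0 *s w k)" by simp
    then have "b \<in> ?S" by (intro CollectI exI[of _ 1] exI[of _ "\<lambda>_. 0"]) simp
    moreover have "w j \<in> ?S" for j
    proof -
      have "(\<Sum>k\<in>UNIV. (if k = j then 1 else 0) *s w k) = w j"
        by (simp add: if_distrib[of "\<lambda>c. c *s _"] cong: if_cong)
      then show ?thesis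
        by (intro CollectI exI[of _ 0] exI[of _ "\<lambda>k. if k = j then 1 else 0"]) simp
    qed
    ultimately show "insert b (range w) \<subseteq> ?S" by blast
  qed
  with assms that show thesis by blast
qed

text \<open>The factor a is the determinant of the coefficients of v in terms of w. It is quantified
  before D on purpose: different systems of local parameters must share the same factor. Components
  along b contribute nothing, as every D i vanishes there.\<close>

lemma det_change_frame:
  fixes b :: "complex^'n::finite" and v w :: "3 \<Rightarrow> complex^'n"
  assumes "\<And>j. v j \<in> vec.span (insert b (range w))"
  obtains a where "\<forall>D :: 3 \<Rightarrow> complex^'n \<Rightarrow> complex. (\<forall>i x y. D i (x + y) = D i x + D i y) \<longrightarrow>
     (\<forall>i c x. D i (c *s x) = c * D i x) \<longrightarrow> (\<forall>i. D i b = 0) \<longrightarrow> det (\<chi> i j. D i (v j)) = det (\<chi> i j. D i (w j)) * a"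
proof -
  have "\<forall>j. \<exists>\<beta> a. v j = \<beta> *s b + (\<Sum>k\<in>UNIV. a k *s w k)"
    using in_span_frame[OF assms] by metis
  then obtain \<beta> A where v: "\<And>j. v j = \<beta> j *s b + (\<Sum>k\<in>UNIV. A j k *s w k)"
    by metis
  have "det (\<chi> i j. D i (v j)) = det (\<chi> i j. D i (w j)) * det (\<chi> k j. A j k)"
    if add: "\<And>i x y. D i (x + y) = D i x + D i y" and scale: "\<And>i c x. D i (c *s x) = c * D i x"
      and b: "\<And>i. D i b = 0" for D :: "3 \<Rightarrow> complex^'n \<Rightarrow> complex"
  proof -
    have zero: "D i 0 = 0" for i using scale[of i 0 0] by simp
    have sum: "D i (\<Sum>k\<in>S. f k) = (\<Sum>k\<in>S. D i (f k))" if "finite S" for i S and f :: "3 \<Rightarrow> complex^'n"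
      using that by induction (simp_all add: add zero)
    then have "D i (v j) = (\<Sum>k\<in>UNIV. D i (w k) * A j k)" for i j
      by (simp only: v add scale b mult_zero_right add_0 sum[OF finite]) (simp only: mult.commute)
    then have "(\<chi> i j. D i (v j)) = (\<chi> i j. D i (w j)) ** (\<chi> k j. A j k)"
      by (simp add: matrix_matrix_mult_def)
    then show ?thesis by (simp add: det_mul)
  qed
  then show thesis by (intro that[of "det (\<chi> k j. A j k)"] allI impI) simp
qed

text \<open>Multiplying numerator and denominator by a coordinate that is nonzero at p makes the
  degree positive, so that partial derivatives have degree exactly one less and the degree counts
  for jacobians involve no truncation.\<close>

lemma quotient_on_pos:
  assumes "p \<in> W" "quotient_on X W f F G"
  obtains W' F' G' d where "p \<in> W'" "quotient_on X W' f F' G'"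
    "homogeneous (Suc d) F'" "homogeneous (Suc d) G'"
proof -
  obtain d where d: "homogeneous d F" "homogeneous d G" using assms(2) by (auto simp: quotient_on_def)
  obtain i where i: "coords p $ i \<noteq> 0"
    using coords_nonzero[of p] by (auto simp: vec_eq_iff)
  let ?W = "W \<inter> {y\<in>X. form_at (var i) y \<noteq> 0}"
  have h: "homogeneous (Suc d) (F * var i)" "homogeneous (Suc d) (G * var i)"
    using homogeneous_mult[OF d(1) homogeneous_var[of i]] homogeneous_mult[OF d(2) homogeneous_var[of i]] by auto
  have "p \<in> X" using assms openin_zariski_subset unfolding quotient_on_def by blast
  then have "p \<in> ?W" using i assms(1) by (simp add: mpeval_var)
  moreover have "openin (subtopology zariski X) ?W"
    using assms(2) openin_subtopology_basic[OF homogeneous_var[of i], of X]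
    unfolding quotient_on_def by (intro openin_Int) auto
  then have "quotient_on X ?W f (F * var i) (G * var i)"
    using h assms(2) unfolding quotient_on_def by (auto simp: mpeval_mult)
  ultimately show thesis using h by (intro that)
qed

lemma regular_triple:
  fixes u :: "3 \<Rightarrow> 'n::finite proj \<Rightarrow> complex"
  assumes "\<And>i. regular_on X U (u i)" "p \<in> U"
  obtains W F G d where "p \<in> W" "\<forall>i. quotient_on X W (u i) (F i) (G i)"
    "\<forall>i. homogeneous (Suc (d i)) (F i)" "\<forall>i. homogeneous (Suc (d i)) (G i)"
proof -
  have "\<exists>W F G d. p \<in> W \<and> quotient_on X W (u i) F G \<and> homogeneous (Suc d) F \<and> homogeneous (Suc d) G" for i
    using regular_onE[OF assms(1)[of i] assms(2)] quotient_on_pos by metis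
  then obtain W F G d where *: "\<And>i. p \<in> W i" "\<And>i. quotient_on X (W i) (u i) (F i) (G i)"
      "\<And>i. homogeneous (Suc (d i)) (F i)" "\<And>i. homogeneous (Suc (d i)) (G i)"
    by metis
  have "openin (subtopology zariski X) (\<Inter>i. W i)"
    using *(2) by (intro openin_INT2) (auto simp: quotient_on_def)
  then have "quotient_on X (\<Inter>i. W i) (u i) (F i) (G i)" for i
    by (rule quotient_on_subset[OF *(2)]) auto
  with * show thesis by (intro that[of "\<Inter>i. W i" F G d] allI) auto
qed

lemma jacobian_quotient:
  fixes u :: "3 \<Rightarrow> 'n::finite proj \<Rightarrow> complex"
  assumes "\<And>i. quotient_on X W (u i) (F i) (G i)" "y \<in> W" "\<And>j. v j \<in> tangent_space X y"
  shows "jacobian X u y v = det (\<chi> i j. qdiff (F i) (G i) (coords y) (v j))"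
proof -
  have "y \<in> X" using assms(1,2) openin_zariski_subset unfolding quotient_on_def by blast
  moreover have "local_quotient X y (u i) (F i) (G i)" for i
    using assms(1,2) local_quotient_iff by blast
  ultimately have "differential X (u i) y (v j) = qdiff (F i) (G i) (coords y) (v j)" for i j
    using assms(3) by (intro differential_eq)
  then show ?thesis by (simp add: jacobian_def)
qed

text \<open>Spanning is meant modulo the line y. At a point of X whose tangent space has dimension
  4, this makes the three vectors a basis of the quotient.\<close>

definition tangent_frame :: "'n::finite proj set \<Rightarrow> 'n proj \<Rightarrow> (3 \<Rightarrow> complex^'n) \<Rightarrow> bool" where
  "tangent_frame X y w \<longleftrightarrow> (\<forall>j. w j \<in> tangent_space X y) \<and>
     tangent_space X y \<subseteq> vec.span (insert (coords y) (range w))"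

lemma jacobian_change_frame:
  fixes u u' :: "3 \<Rightarrow> 'n::finite proj \<Rightarrow> complex"
  assumes "\<And>i. regular_on X U (u i)" "y \<in> U" "\<And>i. regular_on X U' (u' i)" "y \<in> U'"
    "tangent_frame X y w" "\<And>j. v j \<in> tangent_space X y"
  obtains a where "jacobian X u y v = jacobian X u y w * a" "jacobian X u' y v = jacobian X u' y w * a"
proof -
  have "v j \<in> vec.span (insert (coords y) (range w))" for j
    using assms(5,6) unfolding tangent_frame_def by blast
  then obtain a where a: "\<forall>D :: 3 \<Rightarrow> complex^'n \<Rightarrow> complex. (\<forall>i x y. D i (x + y) = D i x + D i y) \<longrightarrow>
     (\<forall>i c x. D i (c *s x) = c * D i x) \<longrightarrow> (\<forall>i. D i (coords y) = 0) \<longrightarrow> det (\<chi> i j. D i (v j)) = det (\<chi> i j. D i (w j)) * a"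
    by (rule det_change_frame[of v "coords y" w])
  have w: "\<And>j. w j \<in> tangent_space X y" using assms(5) by (auto simp: tangent_frame_def)
  have "jacobian X f y v = jacobian X f y w * a" if f: "\<And>i. regular_on X V (f i)" "y \<in> V" for f V
  proof -
    obtain W F G d where W0: "y \<in> W" "\<forall>i. quotient_on X W (f i) (F i) (G i)"
      "\<forall>i. homogeneous (Suc (d i)) (F i)" "\<forall>i. homogeneous (Suc (d i)) (G i)"
      by (rule regular_triple[where u = f, OF f])
    note W = W0(1) W0(2)[rule_format]
    have "qdiff (F i) (G i) (coords y) (coords y) = 0" for i
    proof -
      obtain d where "homogeneous d (F i)" "homogeneous d (G i)"
        using W(2)[of i] unfolding quotient_on_def by blast
      then show ?thesis by (rule qdiff_self)
    qed
    then have "det (\<chi> i j. qdiff (F i) (G i) (coords y) (v j)) = det (\<chi> i j. qdiff (F i) (G i) (coords y) (w j)) * a"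
      by (intro a[rule_format]) (auto simp: qdiff_add qdiff_cmult)
    then show ?thesis
      using jacobian_quotient[OF W(2,1) assms(6)] jacobian_quotient[OF W(2,1) w] by simp
  qed
  from this[OF assms(1,2)] this[OF assms(3,4)] show thesis by (rule that)
qed

text \<open>Two 3-forms on a 3-dimensional space are proportional: the jacobians of u and u' change
  by the same factor when a frame is replaced by other vectors. The product form avoids dividing by
  a jacobian that may vanish.\<close>

lemma jacobian_cross:
  fixes u u' :: "3 \<Rightarrow> 'n::finite proj \<Rightarrow> complex"
  assumes "\<And>i. regular_on X U (u i)" "y \<in> U" "\<And>i. regular_on X U' (u' i)" "y \<in> U'"
    "tangent_frame X y w" "\<And>j. v j \<in> tangent_space X y"
  shows "jacobian X u' y v * jacobian X u y w = jacobian X u y v * jacobian X u' y w"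
proof -
  obtain a where "jacobian X u y v = jacobian X u y w * a" "jacobian X u' y v = jacobian X u' y w * a"
    by (rule jacobian_change_frame[where u = u and u' = u' and v = v and w = w, OF assms])
  then show ?thesis by simp
qed

lemma jacobian_frame_nonzero:
  fixes u :: "3 \<Rightarrow> 'n::finite proj \<Rightarrow> complex"
  assumes "\<And>i. regular_on X U (u i)" "y \<in> U" "tangent_frame X y w" "\<And>j. v j \<in> tangent_space X y"
    "jacobian X u y v \<noteq> 0"
  shows "jacobian X u y w \<noteq> 0"
proof -
  obtain a where "jacobian X u y v = jacobian X u y w * a"
    by (rule jacobian_change_frame[where u = u and u' = u and v = v and w = w, OF assms(1,2,1,2,3,4)])
  then show ?thesis using assms(5) by auto
qed

definition form_vector :: "('n::finite \<Rightarrow> 'n mpoly) \<Rightarrow> 'n proj \<Rightarrow> complex^'n" where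
  "form_vector W y = (\<chi> k. form_at (W k) y)"

text \<open>By the quotient rule, row i of the jacobian matrix has the common denominator (G i)^2;
  these come out of the determinant, and Q is their product. The degrees of P and Q differ by 3 e -
  3 for every system u, so the ratio of the jacobians of two systems on the same vectors has degree
  0.\<close>

lemma jacobian_form:
  fixes u :: "3 \<Rightarrow> 'n::finite proj \<Rightarrow> complex" and w :: "3 \<Rightarrow> 'n \<Rightarrow> 'n mpoly"
  assumes q: "\<And>i. quotient_on X W (u i) (F i) (G i)"
    and F: "\<And>i. homogeneous (Suc (d i)) (F i)" and G: "\<And>i. homogeneous (Suc (d i)) (G i)"
    and w: "\<And>j k. homogeneous e (w j k)"
  obtains P Q D where "homogeneous (D + 3 * e) P" "homogeneous (D + 3) Q"
    "\<forall>y\<in>W. (\<forall>j. form_vector (w j) y \<in> tangent_space X y) \<longrightarrow>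
       form_at Q y \<noteq> 0 \<and> jacobian X u y (\<lambda>j. form_vector (w j) y) = form_at P y / form_at Q y"
proof -
  define M where "M = (\<chi> i j. (\<Sum>k\<in>UNIV. (mpderiv k (F i) * G i - F i * mpderiv k (G i)) * w j k))"
  define P where "P = det M"
  define Q where "Q = (\<Prod>i\<in>UNIV. G i * G i)"
  define D where "D = (\<Sum>i\<in>UNIV. 2 * d i + 1)"
  have "homogeneous (2 * d i + 1 + e) (M $ i $ j)" for i j
  proof -
    have 1: "homogeneous (d i + Suc (d i)) (mpderiv k (F i) * G i)" for k
      using homogeneous_mult[OF homogeneous_mpderiv[OF F[of i], of k] G[of i]] by simp
    have 2: "homogeneous (Suc (d i) + d i) (F i * mpderiv k (G i))" for k
      using homogeneous_mult[OF F[of i] homogeneous_mpderiv[OF G[of i], of k]] by simp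
    have "homogeneous (2 * d i + 1) (mpderiv k (F i) * G i - F i * mpderiv k (G i))" for k
      using homogeneous_diff[of "2 * d i + 1"] 1[of k] 2[of k] by (simp add: mult_2)
    then have "homogeneous (2 * d i + 1 + e) ((mpderiv k (F i) * G i - F i * mpderiv k (G i)) * w j k)" for k
      by (intro homogeneous_mult w)
    then show ?thesis
      unfolding M_def by (simp add: homogeneous_sum)
  qed
  then have "homogeneous (\<Sum>i\<in>UNIV. 2 * d i + 1 + e) P"
    unfolding P_def by (rule homogeneous_det)
  moreover have "(\<Sum>i\<in>UNIV. 2 * d i + 1 + e) = D + 3 * e"
    unfolding D_def by (simp only: sum_3)
  ultimately have hP: "homogeneous (D + 3 * e) P" by simp
  have "homogeneous (\<Sum>i\<in>UNIV. Suc (d i) + Suc (d i)) Q"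
    unfolding Q_def by (rule homogeneous_prod[OF homogeneous_mult[OF G G]]) simp
  moreover have "(\<Sum>i\<in>UNIV. Suc (d i) + Suc (d i)) = D + 3"
    unfolding D_def by (simp only: sum_3)
  ultimately have hQ: "homogeneous (D + 3) Q" by simp
  have "form_at Q y \<noteq> 0 \<and> jacobian X u y (\<lambda>j. form_vector (w j) y) = form_at P y / form_at Q y"
    if y: "y \<in> W" "\<And>j. form_vector (w j) y \<in> tangent_space X y" for y
  proof -
    have G0: "form_at (G i) y \<noteq> 0" for i using q y(1) by (auto simp: quotient_on_def)
    then have Q0: "form_at Q y \<noteq> 0" by (simp add: Q_def mpeval_prod mpeval_mult)
    define c where "c i = inverse (form_at (G i) y * form_at (G i) y)" for i
    have entry: "qdiff (F i) (G i) (coords y) (form_vector (w j) y) = c i * form_at (M $ i $ j) y" for i j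
    proof -
      have "form_at (M $ i $ j) y = grad (F i) (coords y) (form_vector (w j) y) * form_at (G i) y -
          form_at (F i) y * grad (G i) (coords y) (form_vector (w j) y)"
        unfolding M_def
        by (simp add: mpeval_sum mpeval_mult mpeval_diff grad_def form_vector_def sum_distrib_left sum_distrib_right
            flip: sum_subtractf) (simp add: algebra_simps)
      then show ?thesis by (simp add: qdiff_def c_def power2_eq_square divide_inverse mult.commute)
    qed
    have "jacobian X u y (\<lambda>j. form_vector (w j) y) = det (\<chi> i j. c i * form_at (M $ i $ j) y)"
      by (subst jacobian_quotient[OF q y]) (simp add: entry)
    also have "(\<chi> i j. c i * form_at (M $ i $ j) y) = (\<chi> i. c i *s (\<chi> j. form_at (M $ i $ j) y))"
      by (simp add: vec_eq_iff)
    also have "det \<dots> = (\<Prod>i\<in>UNIV. c i) * det (\<chi> i j. form_at (M $ i $ j) y)"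
      by (rule det_rows_mul)
    also have "(\<Prod>i\<in>UNIV. c i) = inverse (form_at Q y)"
      by (simp add: c_def Q_def mpeval_prod mpeval_mult flip: prod_inversef prod.distrib)
    also have "det (\<chi> i j. form_at (M $ i $ j) y) = form_at P y"
      by (simp add: P_def mpeval_det)
    finally show ?thesis using Q0 by (simp add: divide_inverse mult.commute)
  qed
  then show thesis by (intro that[OF hP hQ]) blast
qed

lemma jacobian_ratio_unit:
  fixes u u' :: "3 \<Rightarrow> 'n::finite proj \<Rightarrow> complex" and w :: "3 \<Rightarrow> 'n \<Rightarrow> 'n mpoly"
  assumes U: "openin (subtopology zariski X) U" and u: "\<And>i. regular_on X U (u i)"
    and u': "\<And>i. regular_on X U (u' i)"
    and w: "\<And>j k. homogeneous e (w j k)" "\<And>y j. y \<in> U \<Longrightarrow> form_vector (w j) y \<in> tangent_space X y"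
    and nz: "\<And>y. y \<in> U \<Longrightarrow> jacobian X u y (\<lambda>j. form_vector (w j) y) \<noteq> 0"
      "\<And>y. y \<in> U \<Longrightarrow> jacobian X u' y (\<lambda>j. form_vector (w j) y) \<noteq> 0"
  shows "unit_on X U (\<lambda>y. jacobian X u' y (\<lambda>j. form_vector (w j) y) / jacobian X u y (\<lambda>j. form_vector (w j) y))"
  unfolding unit_on_def
proof
  show "regular_on X U (\<lambda>y. jacobian X u' y (\<lambda>j. form_vector (w j) y) / jacobian X u y (\<lambda>j. form_vector (w j) y))"
  proof (rule regular_onI)
    fix p assume p: "p \<in> U"
    obtain W F G d where W: "p \<in> W" "\<forall>i. quotient_on X W (u i) (F i) (G i)"
      "\<forall>i. homogeneous (Suc (d i)) (F i)" "\<forall>i. homogeneous (Suc (d i)) (G i)"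
      by (rule regular_triple[where u = u, OF u p])
    obtain W' F' G' d' where W': "p \<in> W'" "\<forall>i. quotient_on X W' (u' i) (F' i) (G' i)"
      "\<forall>i. homogeneous (Suc (d' i)) (F' i)" "\<forall>i. homogeneous (Suc (d' i)) (G' i)"
      by (rule regular_triple[where u = u', OF u' p])
    obtain P Q D where PQ: "homogeneous (D + 3 * e) P" "homogeneous (D + 3) Q"
      "\<forall>y\<in>W. (\<forall>j. form_vector (w j) y \<in> tangent_space X y) \<longrightarrow>
       form_at Q y \<noteq> 0 \<and> jacobian X u y (\<lambda>j. form_vector (w j) y) = form_at P y / form_at Q y"
      by (rule jacobian_form[where u = u and w = w, OF W(2-4)[rule_format] w(1)])
    obtain P' Q' D' where PQ': "homogeneous (D' + 3 * e) P'" "homogeneous (D' + 3) Q'"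
      "\<forall>y\<in>W'. (\<forall>j. form_vector (w j) y \<in> tangent_space X y) \<longrightarrow>
       form_at Q' y \<noteq> 0 \<and> jacobian X u' y (\<lambda>j. form_vector (w j) y) = form_at P' y / form_at Q' y"
      by (rule jacobian_form[where u = u' and w = w, OF W'(2-4)[rule_format] w(1)])
    have "quotient_on X (U \<inter> W \<inter> W')
      (\<lambda>y. jacobian X u' y (\<lambda>j. form_vector (w j) y) / jacobian X u y (\<lambda>j. form_vector (w j) y)) (P' * Q) (P * Q')"
      unfolding quotient_on_def
    proof (intro conjI ballI)
      have "homogeneous (D + D' + 3 * e + 3) (P' * Q)" "homogeneous (D + D' + 3 * e + 3) (P * Q')"
        using homogeneous_mult[OF PQ'(1) PQ(2)] homogeneous_mult[OF PQ(1) PQ'(2)] by (simp_all add: algebra_simps)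
      then show "\<exists>d. homogeneous d (P' * Q) \<and> homogeneous d (P * Q')" by blast
      show "openin (subtopology zariski X) (U \<inter> W \<inter> W')"
        using U W(2) W'(2) unfolding quotient_on_def by (intro openin_Int) auto
    next
      fix y assume y: "y \<in> U \<inter> W \<inter> W'"
      then have *: "form_at Q y \<noteq> 0" "jacobian X u y (\<lambda>j. form_vector (w j) y) = form_at P y / form_at Q y"
        "form_at Q' y \<noteq> 0" "jacobian X u' y (\<lambda>j. form_vector (w j) y) = form_at P' y / form_at Q' y"
        using PQ(3) PQ'(3) w(2) by auto
      moreover have "form_at P y \<noteq> 0" using nz(1)[of y] y * by auto
      ultimately show "form_at (P * Q') y \<noteq> 0"
        "jacobian X u' y (\<lambda>j. form_vector (w j) y) / jacobian X u y (\<lambda>j. form_vector (w j) y) =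
          form_at (P' * Q) y / form_at (P * Q') y"
        by (simp_all add: mpeval_mult)
    qed
    then show "\<exists>W F G. p \<in> W \<and> quotient_on X W
      (\<lambda>y. jacobian X u' y (\<lambda>j. form_vector (w j) y) / jacobian X u y (\<lambda>j. form_vector (w j) y)) F G"
      using p W(1) W'(1) by (intro exI conjI) auto
  qed
qed (use nz in auto)

section \<open>Polynomial tangent frames\<close>

text \<open>A maximal independent subset of R, completed to a basis and written as the rows of a
  square matrix; S indexes the added rows. R will consist of gradients at a point, and squareness
  makes determinants and Cramer's rule available.\<close>

lemma basis_matrix:
  fixes R :: "(complex^'n::finite) set"
  obtains f :: "'n \<Rightarrow> complex^'n" and S where "det (\<chi> i. f i) \<noteq> 0" "\<And>i. i \<notin> S \<Longrightarrow> f i \<in> R"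
    "R \<subseteq> vec.span (f ` (- S))"
proof -
  obtain B where B: "B \<subseteq> R" "vec.independent B" "R \<subseteq> vec.span B"
    by (rule vec.maximal_independent_subset)
  obtain B' where B': "B \<subseteq> B'" "vec.independent B'" "UNIV \<subseteq> vec.span B'"
    using vec.maximal_independent_subset_extend[OF subset_UNIV B(2)] by metis
  have fin: "finite B'" using B'(2) by (rule vec.finiteI_independent)
  have "card B' = vec.dim (UNIV :: (complex^'n) set)"
    using B' by (intro vec.basis_card_eq_dim) auto
  then have "card B' = CARD('n)" by (simp only: vec_dim_card)
  then obtain f where f: "bij_betw f (UNIV :: 'n set) B'"
    using fin finite_same_card_bij[of "UNIV :: 'n set" B'] by auto
  define S where "S = {i. f i \<notin> B}"
  have "f ` (- S) = B"
    using f B'(1) unfolding S_def bij_betw_def by auto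
  moreover have "det (\<chi> i. f i) \<noteq> 0"
  proof -
    have "c i = 0" if c: "(\<Sum>i\<in>UNIV. c i *s f i) = 0" for c i
    proof -
      have "(\<Sum>v\<in>B'. c (inv_into UNIV f v) *s v) = (\<Sum>i\<in>UNIV. c i *s f i)"
        using f by (subst sum.reindex_bij_betw[OF f, symmetric]) (simp add: bij_betw_def inv_into_f_f)
      then have "c (inv_into UNIV f (f i)) = 0"
        using c vec.independentD[OF B'(2) fin order_refl, of "\<lambda>v. c (inv_into UNIV f v)" "f i"]
          bij_betwE[OF f] by auto
      then show ?thesis using f by (simp add: bij_betw_def)
    qed
    then have "\<exists>B. (\<chi> i. f i) ** B = mat 1"
      unfolding matrix_right_invertible_independent_rows by (simp add: row_def vec_nth_inverse)
    then show ?thesis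
      by (simp add: invertible_det_nz[symmetric] invertible_right_inverse)
  qed
  ultimately show thesis
    using B(1,3) by (intro that[of f S]) (auto simp: S_def)
qed

text \<open>Column s of the adjugate matrix. It is defined over any commutative ring, so it can be
  formed from polynomial entries and evaluated afterwards.\<close>

definition cramer_column :: "'a::comm_ring_1^'n::finite^'n \<Rightarrow> 'n \<Rightarrow> 'a^'n" where
  "cramer_column M s = (\<chi> k. det (\<chi> i j. if j = k then (if i = s then 1 else 0) else M $ i $ j))"

lemma mult_cramer_column:
  fixes M :: "complex^'n::finite^'n"
  assumes "det M \<noteq> 0"
  shows "M *v cramer_column M s = det M *s axis s 1"
proof -
  let ?x = "(\<chi> k. det (\<chi> i j. if j = k then axis s 1 $ i else M $ i $ j) / det M)"
  have axis: "axis s (1 :: complex) $ i = (if i = s then 1 else 0)" for i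
    by (simp add: axis_def)
  have "cramer_column M s = det M *s ?x"
    using assms unfolding cramer_column_def axis by (simp add: vec_eq_iff)
  moreover have "M *v ?x = axis s 1"
    using cramer[OF assms, of ?x "axis s 1"] by simp
  ultimately show ?thesis by (simp add: vector_scalar_commute)
qed

lemma linear_matrix_vector: "Vector_Spaces.linear (*s) (*s) ((*v) (M :: complex^'n^'m))"
  by (rule matrix_vector_mul_linear_gen)

text \<open>The vector M v is supported on S, hence a combination of unit vectors of index s in S,
  and \<open>cramer_column M s\<close> is det M times the preimage of such a unit vector.\<close>

lemma kernel_expansion:
  fixes M :: "complex^'n::finite^'n"
  assumes "det M \<noteq> 0" and v: "\<And>i. i \<notin> S \<Longrightarrow> (M *v v) $ i = 0"
  shows "v = (\<Sum>s\<in>S. ((M *v v) $ s / det M) *s cramer_column M s)"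
proof -
  have inj: "inj ((*v) M)"
    using assms(1) by (intro inj_matrix_vector_mult) (simp add: invertible_det_nz)
  have "M *v (\<Sum>s\<in>S. ((M *v v) $ s / det M) *s cramer_column M s) =
      (\<Sum>s\<in>S. ((M *v v) $ s / det M) *s (M *v cramer_column M s))"
    by (simp add: vec.linear_sum[OF linear_matrix_vector] vector_scalar_commute)
  also have "\<dots> = (\<Sum>s\<in>S. (M *v v) $ s *s axis s 1)"
    using assms(1) by (simp add: mult_cramer_column vec.scale_scale)
  also have "\<dots> = M *v v"
  proof (subst vec_eq_iff, intro allI)
    fix i
    have "(\<Sum>s\<in>S. (M *v v) $ s *s axis s 1) $ i = (\<Sum>s\<in>S. if s = i then (M *v v) $ i else 0)"
      unfolding sum_component by (rule sum.cong) (auto simp: axis_def)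
    then show "(\<Sum>s\<in>S. (M *v v) $ s *s axis s 1) $ i = (M *v v) $ i"
      using v by simp
  qed
  finally show ?thesis using inj by (simp add: inj_eq)
qed

text \<open>M maps this space isomorphically onto the coordinate subspace belonging to S.\<close>

lemma dim_kernel:
  fixes M :: "complex^'n::finite^'n"
  assumes "det M \<noteq> 0"
  shows "vec.dim {v. \<forall>i. i \<notin> S \<longrightarrow> (M *v v) $ i = 0} = card S"
proof -
  have inv: "invertible M" using assms by (simp add: invertible_det_nz)
  have inj: "inj ((*v) M)" by (rule inj_matrix_vector_mult[OF inv])
  obtain M' where M': "M ** M' = mat 1" using inv unfolding invertible_right_inverse by blast
  have "(*v) M ` {v. \<forall>i. i \<notin> S \<longrightarrow> (M *v v) $ i = 0} = {z. \<forall>i. i \<notin> S \<longrightarrow> z $ i = 0}"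
  proof (intro equalityI subsetI)
    fix z :: "complex^'n" assume "z \<in> {z. \<forall>i. i \<notin> S \<longrightarrow> z $ i = 0}"
    moreover have "z = M *v (M' *v z)" by (simp add: matrix_vector_mul_assoc M')
    ultimately show "z \<in> (*v) M ` {v. \<forall>i. i \<notin> S \<longrightarrow> (M *v v) $ i = 0}"
      by (intro image_eqI[of _ _ "M' *v z"]) auto
  qed auto
  moreover have "vec.dim {z :: complex^'n. \<forall>i. i \<notin> S \<longrightarrow> z $ i = 0} = card S"
    by (rule dim_substandard_cart)
  ultimately show ?thesis
    using vec.dim_image_eq[OF linear_matrix_vector inj_on_subset[OF inj subset_UNIV], of "{v. \<forall>i. i \<notin> S \<longrightarrow> (M *v v) $ i = 0}"]
    by simp
qed

lemma subspace_kernel: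
  "vec.subspace {v. \<forall>i. i \<notin> S \<longrightarrow> ((M :: complex^'n::finite^'n) *v v) $ i = 0}"
  by (rule vec.subspaceI) (auto simp: matrix_vector_right_distrib vector_scalar_commute)

lemma mpeval_linear_form:
  "mpeval (\<Sum>k\<in>UNIV. Poly_Mapping.single 0 (a k) * var k) (x :: 'n::finite \<Rightarrow> complex) = (\<Sum>k\<in>UNIV. a k * x k)"
  by (simp add: mpeval_sum mpeval_mult mpeval_var)

lemma homogeneous_linear_form:
  "homogeneous (Suc 0) (\<Sum>k\<in>UNIV. Poly_Mapping.single 0 (a k) * var (k :: 'n::finite))"
  using homogeneous_mult[OF homogeneous_const homogeneous_var] by (intro homogeneous_sum) simp

lemma grad_linear_form:
  "grad (\<Sum>k\<in>UNIV. Poly_Mapping.single 0 (a k) * var k) x v = (\<Sum>k\<in>UNIV. a k * v $ k)"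
proof (rule DERIV_unique[OF DERIV_line])
  show "((\<lambda>t. mpeval (\<Sum>k\<in>UNIV. Poly_Mapping.single 0 (a k) * var k) (vec_nth (x + t *s v))) has_field_derivative
     (\<Sum>k\<in>UNIV. a k * v $ k)) (at 0)"
    unfolding mpeval_linear_form by (auto intro!: derivative_eq_intros sum.cong)
qed

text \<open>Near \<open>p\<close> the tangent spaces are the kernels of finitely many gradients; completing these by
  constant rows to an invertible matrix, Cramer's rule gives bases of the kernels with form entries.\<close>

lemma polynomial_frame:
  fixes X :: "'n::finite proj set"
  assumes dim: "\<And>p. p \<in> X \<Longrightarrow> vec.dim (tangent_space X p) = 4" and p: "p \<in> X"
  obtains V e and w :: "3 \<Rightarrow> 'n \<Rightarrow> 'n mpoly" and u :: "3 \<Rightarrow> 'n proj \<Rightarrow> complex"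
  where "openin (subtopology zariski X) V" "p \<in> V" "\<forall>j k. homogeneous e (w j k)"
    "\<forall>y\<in>V. tangent_frame X y (\<lambda>j. form_vector (w j) y)" "\<forall>i. regular_on X V (u i)"
    "\<forall>y\<in>V. jacobian X u y (\<lambda>j. form_vector (w j) y) \<noteq> 0"
proof -
  \<comment> \<open>The gradients at p of all forms in the ideal; the tangent space at p is their
    common kernel.\<close>
  define R where "R = {(\<chi> k. form_at (mpderiv k F) p) | F d. F \<in> homog_ideal X d}"
  obtain f :: "'n \<Rightarrow> complex^'n" and S where f: "det (\<chi> i. f i) \<noteq> 0" "\<And>i. i \<notin> S \<Longrightarrow> f i \<in> R"
    "R \<subseteq> vec.span (f ` (- S))"
    using basis_matrix[of R] by metis
  have "\<forall>i. \<exists>F d. i \<notin> S \<longrightarrow> F \<in> homog_ideal X d \<and> f i = (\<chi> k. form_at (mpderiv k F) p)"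
    using f(2) unfolding R_def by blast
  then obtain F d where F: "\<And>i. i \<notin> S \<Longrightarrow> F i \<in> homog_ideal X (d i)"
    "\<And>i. i \<notin> S \<Longrightarrow> f i = (\<chi> k. form_at (mpderiv k (F i)) p)"
    by metis
  define N :: "'n mpoly^'n^'n" where
    "N = (\<chi> i k. if i \<in> S then Poly_Mapping.single 0 (f i $ k) else mpderiv k (F i))"
  define D where "D i = (if i \<in> S then 0 else d i - 1)" for i
  define M where "M y = (\<chi> i k. form_at (N $ i $ k) y)" for y
  define L where "L s = (\<Sum>k\<in>UNIV. Poly_Mapping.single 0 (f s $ k) * var k)" for s
  define K where "K y = {v. \<forall>i. i \<notin> S \<longrightarrow> (M y *v v) $ i = 0}" for y
  define c where "c s y = cramer_column (M y) s" for s y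
  have hN: "homogeneous (D i) (N $ i $ k)" for i k
    using homogeneous_mpderiv[of "d i" "F i" k] F(1)[of i] by (simp add: N_def D_def homog_ideal_def)
  have Mp: "M p = (\<chi> i. f i)"
    using F(2) by (auto simp: M_def N_def vec_eq_iff)
  have MS: "(M y *v v) $ s = (\<Sum>k\<in>UNIV. f s $ k * v $ k)" if "s \<in> S" for s y v
    using that by (simp add: M_def N_def matrix_vector_mult_def)
  have MnS: "(M y *v v) $ i = grad (F i) (coords y) v" if "i \<notin> S" for i y v
    using that by (simp add: M_def N_def matrix_vector_mult_def grad_def)
  have TK: "tangent_space X y \<subseteq> K y" for y
    using F(1) by (auto simp: K_def MnS tangent_space_alt)
  have dimK: "vec.dim (K y) = card S" if "det (M y) \<noteq> 0" for y
    unfolding K_def by (rule dim_kernel[OF that])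
  have subK: "vec.subspace (K y)" for y
    unfolding K_def by (rule subspace_kernel)
  have "K p \<subseteq> tangent_space X p"
  proof
    fix v assume v: "v \<in> K p"
    let ?A = "{r :: complex^'n. (\<Sum>k\<in>UNIV. r $ k * v $ k) = 0}"
    have "vec.span (f ` (- S)) \<subseteq> ?A"
    proof (rule vec.span_minimal)
      show "vec.subspace ?A"
      proof (rule vec.subspaceI)
        fix c and x :: "complex^'n" assume "x \<in> ?A"
        then show "c *s x \<in> ?A"
          by (simp add: mult.assoc flip: sum_distrib_left)
      qed (auto simp: distrib_right sum.distrib)
      show "f ` (- S) \<subseteq> ?A"
        using v F(2) by (auto simp: K_def MnS grad_def)
    qed
    then have "R \<subseteq> ?A" using f(3) by blast
    then show "v \<in> tangent_space X p"
      unfolding tangent_space_alt grad_def R_def by fastforce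
  qed
  then have "tangent_space X p = K p" using TK by blast
  then have cardS: "card S = 4"
    using dimK[of p] dim[OF p] f(1) Mp by simp
  \<comment> \<open>At p the chosen gradients span all gradients, so the kernel is the tangent space
    and S has 4 elements. At other points the tangent space is a priori only contained in the
    kernel, but both have dimension 4.\<close>
  have T: "tangent_space X y = K y" if "y \<in> X" "det (M y) \<noteq> 0" for y
    using TK subK dimK[OF that(2)] dim[OF that(1)] cardS tangent_space_subspace
    by (intro vec.subspace_dim_equal) auto
  \<comment> \<open>One of the four constant rows is nonzero on p, since the gradient rows kill it.
    Its linear form becomes the denominator of the local parameters, and its index is left out of
    the frame.\<close>
  have "M p *v coords p \<noteq> 0"
  proof
    assume "M p *v coords p = 0"
    moreover have "inj ((*v) (M p))"
      using f(1) Mp by (intro inj_matrix_vector_mult) (simp add: invertible_det_nz)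
    ultimately have "coords p = 0" by (metis inj_eq matrix_vector_mult_0_right)
    then show False using coords_nonzero by blast
  qed
  then obtain s0 where s0: "(M p *v coords p) $ s0 \<noteq> 0" by (auto simp: vec_eq_iff)
  have "coords p \<in> K p" using coords_tangent[OF p] TK by blast
  with s0 have s0S: "s0 \<in> S" unfolding K_def by auto
  have finS: "finite S" by simp
  have "card (S - {s0}) = CARD(3)" using cardS s0S by simp
  then obtain \<sigma> :: "3 \<Rightarrow> 'n" where \<sigma>: "bij_betw \<sigma> UNIV (S - {s0})"
    using finite_same_card_bij[of "UNIV :: 3 set" "S - {s0}"] by auto
  have \<sigma>S: "\<sigma> j \<in> S" "\<sigma> j \<noteq> s0" for j using bij_betwE[OF \<sigma>] by auto
  have \<sigma>i: "\<sigma> i = \<sigma> j \<longleftrightarrow> i = j" for i j using \<sigma> by (auto simp: bij_betw_def inj_eq)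
  have hL: "homogeneous (Suc 0) (L s)" for s
    unfolding L_def by (rule homogeneous_linear_form)
  have Ly: "form_at (L s) y = (M y *v coords y) $ s" if "s \<in> S" for s y
    using that by (simp add: L_def mpeval_linear_form MS)
  have hdet: "homogeneous (\<Sum>i\<in>UNIV. D i) (det N)"
    by (rule homogeneous_det) (rule hN)
  have dety: "form_at (det N) y = det (M y)" for y
    by (simp add: mpeval_det M_def)
  define V where "V = {y\<in>X. form_at (det N * L s0) y \<noteq> 0}"
  have V: "y \<in> V \<longleftrightarrow> y \<in> X \<and> det (M y) \<noteq> 0 \<and> form_at (L s0) y \<noteq> 0" for y
    by (auto simp: V_def mpeval_mult dety)
  define w where "w j k = cramer_column N (\<sigma> j) $ k" for j k
  have "homogeneous (\<Sum>i\<in>UNIV. D i) (w j k)" for j k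
    unfolding w_def cramer_column_def using hN \<sigma>S[of j]
    by (auto intro!: homogeneous_det simp: D_def)
  moreover have wc: "form_vector (w j) y = c (\<sigma> j) y" for j y
    by (auto simp: form_vector_def w_def c_def cramer_column_def mpeval_det M_def vec_eq_iff
        intro!: arg_cong[where f = det])
  have Mc: "(M y *v c s y) $ i = (if i = s then det (M y) else 0)" if "det (M y) \<noteq> 0" for i s y
    using mult_cramer_column[OF that, of s] by (simp add: c_def axis_def)
  have frame: "tangent_frame X y (\<lambda>j. form_vector (w j) y)" if y: "y \<in> V" for y
    unfolding tangent_frame_def
  proof (intro conjI allI subsetI)
    have d: "det (M y) \<noteq> 0" and yX: "y \<in> X" and L0: "form_at (L s0) y \<noteq> 0" using y V by auto
    show "form_vector (w j) y \<in> tangent_space X y" for j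
      using \<sigma>S[of j] by (auto simp: T[OF yX d] K_def wc Mc[OF d])
    let ?Sp = "vec.span (insert (coords y) (range (\<lambda>j. form_vector (w j) y)))"
    have c\<sigma>: "c s y \<in> ?Sp" if "s \<in> S - {s0}" for s
    proof -
      have "s \<in> range \<sigma>" using that unfolding bij_betw_imp_surj_on[OF \<sigma>] .
      then obtain j where "s = \<sigma> j" by (rule rangeE)
      then have "c s y = form_vector (w j) y" by (simp add: wc)
      then show ?thesis by (simp add: vec.span_base)
    qed
    have expand: "v = ((M y *v v) $ s0 / det (M y)) *s c s0 y +
        (\<Sum>s\<in>S - {s0}. ((M y *v v) $ s / det (M y)) *s c s y)" if "v \<in> K y" for v
    proof -
      have "v = (\<Sum>s\<in>S. ((M y *v v) $ s / det (M y)) *s c s y)"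
        unfolding c_def using that by (intro kernel_expansion d) (simp add: K_def)
      then show ?thesis unfolding sum.remove[OF finS s0S] .
    qed
    have rest: "(\<Sum>s\<in>S - {s0}. a s *s c s y) \<in> ?Sp" for a
      by (intro vec.span_sum vec.span_scale c\<sigma>)
    \<comment> \<open>The omitted column is recovered from \<open>coords y\<close>, whose
      coefficient along it is the value of L s0 at y divided by det (M y), nonzero on V.\<close>
    have c0: "c s0 y \<in> ?Sp"
    proof -
      obtain a r where ar: "a \<noteq> 0" "r \<in> ?Sp" "coords y = a *s c s0 y + r"
      proof
        show "(M y *v coords y) $ s0 / det (M y) \<noteq> 0" using L0 d Ly[OF s0S] by simp
        show "(\<Sum>s\<in>S - {s0}. ((M y *v coords y) $ s / det (M y)) *s c s y) \<in> ?Sp" by (rule rest)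
        show "coords y = ((M y *v coords y) $ s0 / det (M y)) *s c s0 y +
            (\<Sum>s\<in>S - {s0}. ((M y *v coords y) $ s / det (M y)) *s c s y)"
          using coords_tangent[OF yX] TK by (intro expand) blast
      qed
      have "coords y \<in> ?Sp" by (rule vec.span_base) simp
      then have "coords y - r \<in> ?Sp" using ar(2) by (rule vec.span_diff)
      then have "inverse a *s (coords y - r) \<in> ?Sp" by (rule vec.span_scale)
      moreover have "inverse a *s (coords y - r) = c s0 y"
        unfolding ar(3) add_diff_cancel_right' vec.scale_scale left_inverse[OF ar(1)] vec.scale_one ..
      ultimately show ?thesis by simp
    qed
    fix v assume "v \<in> tangent_space X y"
    then have "v \<in> K y" using TK by blast
    then show "v \<in> ?Sp"
      by (subst expand, assumption) (intro vec.span_add vec.span_scale c0 rest)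
  qed
  \<comment> \<open>Parameters dual to the frame: for s in S, row s of M y is the gradient of L s,
    and M y maps the column of index \<sigma> j to det (M y) times a unit vector. Hence the jacobian
    matrix is diagonal.\<close>
  define u where "u i y = form_at (L (\<sigma> i)) y / form_at (L s0) y" for i y
  have oV: "openin (subtopology zariski X) V"
    unfolding V_def by (rule openin_subtopology_basic[OF homogeneous_mult[OF hdet hL]])
  have qu: "quotient_on X V (u i) (L (\<sigma> i)) (L s0)" for i
    unfolding quotient_on_def using hL oV V by (auto simp: u_def)
  have "regular_on X V (u i)" for i
    using qu by (intro regular_onI) blast
  moreover have "jacobian X u y (\<lambda>j. form_vector (w j) y) \<noteq> 0" if y: "y \<in> V" for y
  proof -
    have d: "det (M y) \<noteq> 0" and yX: "y \<in> X" and L0: "form_at (L s0) y \<noteq> 0" using y V by auto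
    have gL: "grad (L s) (coords y) v = (M y *v v) $ s" if "s \<in> S" for s v
      using that by (simp add: L_def grad_linear_form MS)
    have "qdiff (L (\<sigma> i)) (L s0) (coords y) (c (\<sigma> j) y) = (if i = j then det (M y) / form_at (L s0) y else 0)" for i j
      using L0 \<sigma>S[of i] \<sigma>S[of j] s0S
      by (simp add: qdiff_def gL Mc[OF d] \<sigma>i power2_eq_square)
    moreover have "form_vector (w j) y \<in> tangent_space X y" for j
      using \<sigma>S[of j] by (auto simp: T[OF yX d] K_def wc Mc[OF d])
    ultimately have "jacobian X u y (\<lambda>j. form_vector (w j) y) =
        det (\<chi> i j. if i = j then det (M y) / form_at (L s0) y else 0 :: complex^3^3)"
      by (subst jacobian_quotient[OF qu y]) (simp_all add: wc)
    also have "\<dots> = (\<Prod>i\<in>(UNIV :: 3 set). det (M y) / form_at (L s0) y)"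
      by (subst det_diagonal) simp_all
    also have "\<dots> \<noteq> 0" using d L0 by simp
    finally show ?thesis .
  qed
  moreover have "p \<in> V"
    using s0 f(1) Mp p s0S by (simp add: V Ly)
  ultimately show thesis
    using oV frame by (intro that[of V "\<Sum>i\<in>UNIV. D i" w u] allI ballI)
qed

section \<open>The canonical class\<close>

definition frame_data ::
  "'n::finite proj set \<Rightarrow> 'n proj \<Rightarrow> 'n proj set \<Rightarrow> nat \<Rightarrow> (3 \<Rightarrow> 'n \<Rightarrow> 'n mpoly) \<Rightarrow> (3 \<Rightarrow> 'n proj \<Rightarrow> complex) \<Rightarrow> bool"
where
  "frame_data X p V e w u \<longleftrightarrow> openin (subtopology zariski X) V \<and> p \<in> V \<and> (\<forall>j k. homogeneous e (w j k)) \<and>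
    (\<forall>y\<in>V. tangent_frame X y (\<lambda>j. form_vector (w j) y)) \<and> (\<forall>i. regular_on X V (u i)) \<and>
    (\<forall>y\<in>V. jacobian X u y (\<lambda>j. form_vector (w j) y) \<noteq> 0)"

lemma ex_frame_data:
  assumes "\<And>p. p \<in> X \<Longrightarrow> vec.dim (tangent_space X p) = 4"
  shows "\<exists>V e w u. \<forall>p\<in>X. frame_data X p (V p) (e p) (w p) (u p)"
proof -
  have "\<exists>V e w u. frame_data X p V e w u" if p: "p \<in> X" for p
    using polynomial_frame[OF assms p] unfolding frame_data_def by (smt (verit, best))
  then show ?thesis by metis
qed

lemma frame_dataD:
  assumes "frame_data X p V e w u"
  shows "openin (subtopology zariski X) V" "p \<in> V" "homogeneous e (w j k)"
    "y \<in> V \<Longrightarrow> tangent_frame X y (\<lambda>j. form_vector (w j) y)"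
    "y \<in> V \<Longrightarrow> form_vector (w j) y \<in> tangent_space X y"
    "regular_on X V (u i)" "y \<in> V \<Longrightarrow> jacobian X u y (\<lambda>j. form_vector (w j) y) \<noteq> 0"
  using assms unfolding frame_data_def tangent_frame_def by auto

text \<open>Existence and uniqueness are both needed to make sense of \<^const>\<open>anticanonical_class\<close>: without a
  canonical bundle \<^const>\<open>canonical_class\<close> would be empty, and with two non-isomorphic ones it would not
  be a single class; in either case its inverse in the Picard group would be a junk value.\<close>

lemma canonical_bundle_exists:
  assumes "\<And>p. p \<in> X \<Longrightarrow> vec.dim (tangent_space X p) = 4"
  shows "\<exists>K. canonical_bundle_threefold X K"
proof -
  obtain V e w u where fd: "\<And>p. p \<in> X \<Longrightarrow> frame_data X p (V p) (e p) (w p) (u p)"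
    using ex_frame_data[OF assms] by blast
  define fr where "fr p x j = form_vector (w p j) x" for p x j
  define J where "J q x v = jacobian X (u q) x v" for q x v
  note D = frame_dataD[OF fd, folded fr_def]
  have nz: "J q x (fr p x) \<noteq> 0" if "p \<in> X" "q \<in> X" "x \<in> V p" "x \<in> V q" for p q x
    unfolding J_def
  proof (rule jacobian_frame_nonzero[of X "V q" "u q" x "fr p x" "fr q x"])
    show "tangent_frame X x (fr p x)" using frame_dataD(4)[OF fd] that unfolding fr_def by blast
    show "jacobian X (u q) x (fr q x) \<noteq> 0" using frame_dataD(7)[OF fd] that unfolding fr_def by blast
  qed (use D that in auto)
  have cross: "J q x v * J p x (fr p x) = J p x v * J q x (fr p x)"
    if "p \<in> X" "q \<in> X" "x \<in> V p" "x \<in> V q" "\<And>j. v j \<in> tangent_space X x" for p q x v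
    unfolding J_def
  proof (rule jacobian_cross[of X "V p" "u p" x "V q" "u q" "fr p x" v])
    show "tangent_frame X x (fr p x)" using frame_dataD(4)[OF fd] that unfolding fr_def by blast
  qed (use D that in auto)
  have tan: "fr p x j \<in> tangent_space X x" if "p \<in> X" "x \<in> V p" for p x j
    using D that by auto
  \<comment> \<open>The transition function is the quotient of the 3-forms of u q and u p, tested on
    the polynomial frame attached to p. By \<open>cross\<close> the quotient does not depend on the
    frame, which gives the cocycle rule; the polynomial entries make it regular.\<close>
  define K where "K = LBundle V (\<lambda>p q x. J q x (fr p x) / J p x (fr p x))"
  have "line_bundle X K"
    unfolding line_bundle_def
  proof (intro conjI ballI)
    fix p q assume pq: "p \<in> X" "q \<in> X"
    have "unit_on X (V p \<inter> V q) (\<lambda>x. jacobian X (u q) x (\<lambda>j. form_vector (w p j) x) /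
        jacobian X (u p) x (\<lambda>j. form_vector (w p j) x))"
    proof (rule jacobian_ratio_unit)
      show "openin (subtopology zariski X) (V p \<inter> V q)"
        using D(1) pq by (intro openin_Int)
      show "homogeneous (e p) (w p j k)" for j k using D(3) pq by blast
      fix y assume y: "y \<in> V p \<inter> V q"
      show "jacobian X (u p) y (\<lambda>j. form_vector (w p j) y) \<noteq> 0"
        "jacobian X (u q) y (\<lambda>j. form_vector (w p j) y) \<noteq> 0"
        using nz[of p p y] nz[of p q y] pq y unfolding J_def fr_def by auto
      show "form_vector (w p j) y \<in> tangent_space X y" for j
        using tan[of p y j] pq y unfolding fr_def by auto
    qed (use D(6) pq in \<open>auto intro: regular_on_subset\<close>)
    then show "unit_on X (chart K p \<inter> chart K q) (transition K p q)"
      unfolding K_def J_def fr_def by simp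
  next
    fix p q r x assume *: "p \<in> X" "q \<in> X" "r \<in> X" "x \<in> chart K p \<inter> chart K q \<inter> chart K r"
    then have x: "x \<in> V p" "x \<in> V q" "x \<in> V r" by (auto simp: K_def)
    have "J r x (fr p x) * J q x (fr q x) = J q x (fr p x) * J r x (fr q x)"
      using cross[of q r x "fr p x"] * x tan by auto
    moreover have "J q x (fr q x) \<noteq> 0" "J p x (fr p x) \<noteq> 0" using nz * x by auto
    ultimately show "transition K p q x * transition K q r x = transition K p r x"
      unfolding K_def by (simp add: field_simps)
  qed (use D in \<open>auto simp: K_def\<close>)
  moreover have "jacobian X (u q) x v = transition K p q x * jacobian X (u p) x v"
    if "p \<in> X" "q \<in> X" "x \<in> chart K p \<inter> chart K q" "\<forall>j. v j \<in> tangent_space X x" for p q x v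
    using cross[of p q x v] nz[of p p x] that unfolding K_def J_def by (simp add: field_simps)
  moreover have "\<exists>v. (\<forall>j. v j \<in> tangent_space X x) \<and> jacobian X (u p) x v \<noteq> 0"
    if "p \<in> X" "x \<in> chart K p" for p x
    using that nz[of p p x] tan[of p x] unfolding K_def J_def by (intro exI[of _ "fr p x"]) auto
  moreover have "regular_on X (chart K p) (u p i)" if "p \<in> X" for p i
    using D(6) that by (simp add: K_def)
  ultimately have "canonical_bundle_threefold X K"
    unfolding canonical_bundle_threefold_def by (intro conjI exI[of _ u] ballI allI impI)
  then show ?thesis by blast
qed

text \<open>Both bundles are framed by nowhere zero 3-forms on X, and the ratio of these forms is
  the isomorphism. At x it is tested on the polynomial frame centred at x, which always exists but
  varies with x without control; \<open>jacobian_cross\<close> replaces it locally by the frame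
  centred at a fixed r, for which the ratio is regular.\<close>

lemma canonical_bundle_unique:
  assumes dim: "\<And>p. p \<in> X \<Longrightarrow> vec.dim (tangent_space X p) = 4"
    and "canonical_bundle_threefold X K" "canonical_bundle_threefold X K'"
  shows "bundle_iso X K K'"
proof -
  obtain V e w u0 where fd: "\<And>p. p \<in> X \<Longrightarrow> frame_data X p (V p) (e p) (w p) (u0 p)"
    using ex_frame_data[OF dim] by blast
  define fr where "fr p x j = form_vector (w p j) x" for p x j
  note D = frame_dataD[OF fd, folded fr_def]
  obtain u where K: "line_bundle X K" and u: "\<And>p i. p \<in> X \<Longrightarrow> regular_on X (chart K p) (u p i)"
    "\<And>p x. p \<in> X \<Longrightarrow> x \<in> chart K p \<Longrightarrow> \<exists>v. (\<forall>j. v j \<in> tangent_space X x) \<and> jacobian X (u p) x v \<noteq> 0"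
    "\<And>p q x v. p \<in> X \<Longrightarrow> q \<in> X \<Longrightarrow> x \<in> chart K p \<inter> chart K q \<Longrightarrow> (\<forall>j. v j \<in> tangent_space X x) \<Longrightarrow>
           jacobian X (u q) x v = transition K p q x * jacobian X (u p) x v"
    using assms(2) unfolding canonical_bundle_threefold_def by metis
  obtain u' where K': "line_bundle X K'" and u': "\<And>p i. p \<in> X \<Longrightarrow> regular_on X (chart K' p) (u' p i)"
    "\<And>p x. p \<in> X \<Longrightarrow> x \<in> chart K' p \<Longrightarrow> \<exists>v. (\<forall>j. v j \<in> tangent_space X x) \<and> jacobian X (u' p) x v \<noteq> 0"
    "\<And>p q x v. p \<in> X \<Longrightarrow> q \<in> X \<Longrightarrow> x \<in> chart K' p \<inter> chart K' q \<Longrightarrow> (\<forall>j. v j \<in> tangent_space X x) \<Longrightarrow>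
           jacobian X (u' q) x v = transition K' p q x * jacobian X (u' p) x v"
    using assms(3) unfolding canonical_bundle_threefold_def by metis
  have tan: "fr p x j \<in> tangent_space X x" if "p \<in> X" "x \<in> V p" for p x j
    using D that by auto
  have frame: "tangent_frame X x (fr p x)" if "p \<in> X" "x \<in> V p" for p x
    using frame_dataD(4)[OF fd] that unfolding fr_def by blast
  have nz: "jacobian X (u p) x (fr r x) \<noteq> 0" if r: "r \<in> X" "x \<in> V r" and p: "p \<in> X" "x \<in> chart K p" for p r x
  proof -
    obtain v where v: "\<forall>j. v j \<in> tangent_space X x" "jacobian X (u p) x v \<noteq> 0" using u(2)[OF p] by blast
    show ?thesis
      by (rule jacobian_frame_nonzero[of X "chart K p" "u p" x "fr r x" v]) (use u(1) p v frame r in auto)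
  qed
  have nz': "jacobian X (u' p) x (fr r x) \<noteq> 0" if r: "r \<in> X" "x \<in> V r" and p: "p \<in> X" "x \<in> chart K' p" for p r x
  proof -
    obtain v where v: "\<forall>j. v j \<in> tangent_space X x" "jacobian X (u' p) x v \<noteq> 0" using u'(2)[OF p] by blast
    show ?thesis
      by (rule jacobian_frame_nonzero[of X "chart K' p" "u' p" x "fr r x" v]) (use u'(1) p v frame r in auto)
  qed
  define \<phi> where "\<phi> p q x = jacobian X (u p) x (fr x x) / jacobian X (u' q) x (fr x x)" for p q x
  show ?thesis
    unfolding bundle_iso_def
  proof (intro exI[of _ \<phi>] conjI ballI)
    fix p q assume pq: "p \<in> X" "q \<in> X"
    show "unit_on X (chart K p \<inter> chart K' q) (\<phi> p q)"
    proof (rule unit_on_local)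
      fix r assume r: "r \<in> chart K p \<inter> chart K' q"
      then have rX: "r \<in> X" using line_bundle_chart[OF K] pq by blast
      let ?U = "chart K p \<inter> chart K' q \<inter> V r"
      let ?g = "\<lambda>y. jacobian X (u p) y (\<lambda>j. form_vector (w r j) y) / jacobian X (u' q) y (\<lambda>j. form_vector (w r j) y)"
      have o: "openin (subtopology zariski X) ?U"
        using D(1)[OF rX] line_bundle_chart[OF K] line_bundle_chart[OF K'] pq by (intro openin_Int)
      have "unit_on X ?U ?g"
      proof (rule jacobian_ratio_unit[OF o])
        show "homogeneous (e r) (w r j k)" for j k using D(3) rX by blast
        show "regular_on X ?U (u p i)" for i by (rule regular_on_subset[OF u(1)[OF pq(1)]]) auto
        show "regular_on X ?U (u' q i)" for i by (rule regular_on_subset[OF u'(1)[OF pq(2)]]) auto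
        fix y assume y: "y \<in> ?U"
        show "form_vector (w r j) y \<in> tangent_space X y" for j
          using tan[of r y j] rX y unfolding fr_def by auto
        show "jacobian X (u p) y (\<lambda>j. form_vector (w r j) y) \<noteq> 0"
          "jacobian X (u' q) y (\<lambda>j. form_vector (w r j) y) \<noteq> 0"
          using nz[of r y p] nz'[of r y q] pq rX y unfolding fr_def by auto
      qed
      moreover have "\<phi> p q y = ?g y" if y: "y \<in> ?U" for y
      proof -
        have yX: "y \<in> X" using y line_bundle_chart[OF K] pq by blast
        have yV: "y \<in> V y" using D(2) yX by blast
        have "jacobian X (u' q) y (fr y y) * jacobian X (u p) y (fr r y) =
            jacobian X (u p) y (fr y y) * jacobian X (u' q) y (fr r y)"
          by (rule jacobian_cross[of X "chart K p" "u p" y "chart K' q" "u' q" "fr r y" "fr y y"])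
             (use u(1) u'(1) pq y frame rX tan yX yV in auto)
        then show ?thesis
          using nz[of r y p] nz'[of r y q] nz'[of y y q] pq rX y yX yV
          unfolding \<phi>_def fr_def[symmetric] by (simp add: frac_eq_eq mult.commute)
      qed
      moreover have "r \<in> ?U" using r D(2)[OF rX] by auto
      ultimately show "\<exists>U g. openin (subtopology zariski X) U \<and> r \<in> U \<and> unit_on X U g \<and> (\<forall>y\<in>U. \<phi> p q y = g y)"
        using o by (intro exI[of _ ?U] exI[of _ ?g] conjI ballI)
    qed
  next
    fix p p' q q' x
    assume *: "p \<in> X" "p' \<in> X" "q \<in> X" "q' \<in> X" "x \<in> chart K p \<inter> chart K p' \<inter> chart K' q \<inter> chart K' q'"
    then have xX: "x \<in> X" using line_bundle_chart[OF K] by blast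
    have xV: "x \<in> V x" using D(2) xX by blast
    have t: "\<forall>j. fr x x j \<in> tangent_space X x" using tan xX xV by blast
    have "jacobian X (u p') x (fr x x) = transition K p p' x * jacobian X (u p) x (fr x x)"
      using u(3)[of p p' x "fr x x"] * t by auto
    moreover have "jacobian X (u' q) x (fr x x) = transition K' q' q x * jacobian X (u' q') x (fr x x)"
      using u'(3)[of q' q x "fr x x"] * t by auto
    moreover have "transition K' q' q x \<noteq> 0" using transition_nonzero[OF K'] * by auto
    ultimately show "\<phi> p' q' x = transition K' q' q x * \<phi> p q x * transition K p p' x"
      unfolding \<phi>_def by simp
  qed
qed

lemma canonical_class_eq:
  assumes "\<And>p. p \<in> X \<Longrightarrow> vec.dim (tangent_space X p) = 4" "canonical_bundle_threefold X K"
  shows "canonical_class X = bundle_class X K"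
proof -
  have "bundle_class X K' = bundle_class X K" if "canonical_bundle_threefold X K'" for K'
  proof -
    have "line_bundle X K" "line_bundle X K'"
      using assms(2) that by (auto simp: canonical_bundle_threefold_def)
    then show ?thesis
      using canonical_bundle_unique[OF assms(1) that assms(2)] by (simp add: bundle_class_eq_iff)
  qed
  then have "\<Union> (bundle_class X ` {K. canonical_bundle_threefold X K}) = bundle_class X K"
    using assms(2) by blast
  then show ?thesis unfolding canonical_class_def by blast
qed

lemma hyperplane_canonical_dual:
  assumes "\<And>p. p \<in> X \<Longrightarrow> vec.dim (tangent_space X p) = 4"
    and "hyperplane_bundle X \<in> anticanonical_class X"
  obtains K where "canonical_bundle_threefold X K"
    "bundle_iso X (bundle_tensor K (hyperplane_bundle X)) (trivial_bundle X)"
proof -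
  obtain K where K: "canonical_bundle_threefold X K" using canonical_bundle_exists[OF assms(1)] by blast
  have "hyperplane_bundle X \<in> inv\<^bsub>Pic X\<^esub> (bundle_class X K)"
    using assms(2) canonical_class_eq[OF assms(1) K] unfolding anticanonical_class_def by simp
  then show thesis
    using K inverse_class_iso that unfolding canonical_bundle_threefold_def by blast
qed

section \<open>The rational normal curve and its osculating spaces\<close>

text \<open>The coefficient i (i - 1) ... (i - k + 1) in the k-th derivative of t^i. Truncated
  subtraction does no harm: for i < k one factor is 0.\<close>

primrec falling :: "nat \<Rightarrow> nat \<Rightarrow> nat" where
  "falling i 0 = 1"
| "falling i (Suc k) = falling i k * (i - k)"

lemma falling_zero: "i < k \<Longrightarrow> falling i k = 0"
  by (induction k) (auto simp: less_Suc_eq)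

lemma of_nat_falling_Suc:
  "(of_nat (falling i (Suc k)) :: complex) = of_nat (falling i k) * (of_nat i - of_nat k)"
  by (cases "k \<le> i") (auto simp: of_nat_diff falling_zero)

text \<open>The \<open>k\<close>-th derivative of the affine parametrization of the curve.\<close>

definition osc :: "nat \<Rightarrow> (nat \<Rightarrow> complex^'n::finite) \<Rightarrow> nat \<Rightarrow> complex \<Rightarrow> complex^'n" where
  "osc g e k t = (\<Sum>i\<le>g. (of_nat (falling i k) * t ^ (i - k)) *s e i)"

lemma osc_component: "osc g e k t $ l = (\<Sum>i\<le>g. of_nat (falling i k) * t ^ (i - k) * e i $ l)"
  by (simp add: osc_def sum_component)

lemma DERIV_osc: "((\<lambda>t. osc g e k t $ l) has_field_derivative osc g e (Suc k) t $ l) (at t)"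
proof -
  have "((\<lambda>t. of_nat (falling i k) * t ^ (i - k) * e i $ l) has_field_derivative
     of_nat (falling i (Suc k)) * t ^ (i - Suc k) * e i $ l) (at t)" for i
  proof -
    have "((\<lambda>t. of_nat (falling i k) * t ^ (i - k) * e i $ l) has_field_derivative
       of_nat (falling i k) * (of_nat (i - k) * t ^ (i - k - 1)) * e i $ l) (at t)"
      by (auto intro!: derivative_eq_intros)
    moreover have "of_nat (falling i k) * (of_nat (i - k) * t ^ (i - k - 1)) * e i $ l =
        of_nat (falling i (Suc k)) * t ^ (i - Suc k) * e i $ l"
      by (simp only: falling.simps of_nat_mult mult.assoc) simp
    ultimately show ?thesis by metis
  qed
  then show ?thesis unfolding osc_component by (intro DERIV_sum)
qed

lemma DERIV_osc_shift:
  "((\<lambda>u. osc g e k (t + u) $ l) has_field_derivative osc g e (Suc k) (t + u) $ l) (at u)"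
proof -
  have "((\<lambda>u. t + u) has_field_derivative 1) (at u)"
    by (auto intro!: derivative_eq_intros)
  from DERIV_chain2[OF DERIV_osc this] show ?thesis by simp
qed

text \<open>Independence of an indexed family: equal vectors at different indices are excluded, and
  reversing the index amounts to reindexing a sum.\<close>

definition family_independent :: "nat \<Rightarrow> (nat \<Rightarrow> complex^'n::finite) \<Rightarrow> bool" where
  "family_independent g e \<longleftrightarrow> (\<forall>a. (\<Sum>i\<le>g. a i *s e i) = 0 \<longrightarrow> (\<forall>i\<le>g. a i = 0))"

lemma family_independentD:
  "family_independent g e \<Longrightarrow> (\<Sum>i\<le>g. a i *s e i) = 0 \<Longrightarrow> i \<le> g \<Longrightarrow> a i = 0"
  by (simp add: family_independent_def)

lemma family_independentI:
  fixes e :: "nat \<Rightarrow> complex^'n::finite"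
  assumes "inj_on e {..g}" "vec.independent (e ` {..g})"
  shows "family_independent g e"
  unfolding family_independent_def
proof (intro allI impI)
  fix a i assume a: "(\<Sum>i\<le>g. a i *s e i) = 0" and i: "i \<le> g"
  have "(\<Sum>v\<in>e ` {..g}. a (inv_into {..g} e v) *s v) = (\<Sum>i\<le>g. a i *s e i)"
    using assms(1) by (simp add: sum.reindex inv_into_f_f)
  then have "a (inv_into {..g} e (e i)) = 0"
    using vec.independentD[OF assms(2) _ order_refl, of "\<lambda>v. a (inv_into {..g} e v)" "e i"] a i by auto
  then show "a i = 0" using assms(1) i by (simp add: inv_into_f_f)
qed

lemma family_independent_set:
  fixes e :: "nat \<Rightarrow> complex^'n::finite"
  assumes "family_independent g e"
  shows "inj_on e {..g}" "vec.independent (e ` {..g})"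
proof -
  show inj: "inj_on e {..g}"
  proof (rule inj_onI, rule ccontr)
    fix i j assume ij: "i \<in> {..g}" "j \<in> {..g}" "e i = e j" "i \<noteq> j"
    let ?a = "\<lambda>k. (if k = i then 1 else 0) - (if k = j then 1 else 0 :: complex)"
    have d: "(\<Sum>k\<le>g. (if k = m then 1 else 0) *s e k) = e m" if "m \<in> {..g}" for m
    proof -
      have "(\<Sum>k\<le>g. (if k = m then 1 else 0) *s e k) = (\<Sum>k\<le>g. if k = m then e m else 0)"
        by (rule sum.cong) auto
      then show ?thesis using that by simp
    qed
    have "(\<Sum>k\<le>g. ?a k *s e k) = 0"
      unfolding vec.scale_left_diff_distrib sum_subtractf using ij d by simp
    then have "?a i = 0" by (rule family_independentD[OF assms]) (use ij(1) in simp)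
    then show False using ij(4) by simp
  qed
  show "vec.independent (e ` {..g})"
  proof (rule vec.independent_if_scalars_zero)
    fix f x assume f: "(\<Sum>x\<in>e ` {..g}. f x *s x) = 0" and x: "x \<in> e ` {..g}"
    have "(\<Sum>i\<le>g. f (e i) *s e i) = 0"
      using f inj by (simp add: sum.reindex)
    then have "f (e i) = 0" if "i \<le> g" for i
      using family_independentD[OF assms, of "\<lambda>i. f (e i)"] that by blast
    then show "f x = 0" using x by auto
  qed simp
qed

lemma family_independent_rev:
  assumes "family_independent g e"
  shows "family_independent g (\<lambda>i. e (g - i))"
  unfolding family_independent_def
proof (intro allI impI)
  fix a i assume a: "(\<Sum>i\<le>g. a i *s e (g - i)) = 0" and i: "i \<le> g"
  have "(\<Sum>i\<le>g. a (g - i) *s e i) = (\<Sum>i\<le>g. a i *s e (g - i))"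
    by (rule sum.reindex_bij_witness[of _ "\<lambda>i. g - i" "\<lambda>i. g - i"]) auto
  then have "a (g - (g - i)) = 0"
    using assms a i unfolding family_independent_def by (metis diff_le_self)
  then show "a i = 0" using i by simp
qed

text \<open>The coefficient of e i involves only derivatives of order at most i, the one of order i
  with the factor i!. Reading off e 0, ..., e 3, which exist as g \<ge> 3, gives a triangular
  system.\<close>

lemma osc_independent:
  assumes "family_independent g e" "3 \<le> g"
  shows "family_independent 3 (\<lambda>k. osc g e k t)"
  unfolding family_independent_def
proof (intro allI impI)
  fix b k assume b: "(\<Sum>k\<le>3. b k *s osc g e k t) = 0" and k: "k \<le> (3::nat)"
  have "(\<Sum>k\<le>3. b k *s osc g e k t) = (\<Sum>k\<le>3. \<Sum>i\<le>g. (b k * (of_nat (falling i k) * t ^ (i - k))) *s e i)"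
    by (simp add: osc_def vec.scale_sum_right vec.scale_scale)
  also have "\<dots> = (\<Sum>i\<le>g. (\<Sum>k\<le>3. b k * (of_nat (falling i k) * t ^ (i - k))) *s e i)"
    by (subst sum.swap) (simp add: vec.scale_sum_left)
  finally have z: "(\<Sum>k\<le>3. b k * (of_nat (falling i k) * t ^ (i - k))) = 0" if "i \<le> g" for i
    using family_independentD[OF assms(1), of "\<lambda>i. \<Sum>k\<le>3. b k * (of_nat (falling i k) * t ^ (i - k))"] b that
    by (simp only:)
  have "b 0 = 0" using z[of 0] by (simp add: numeral_eq_Suc)
  moreover from this have "b 1 = 0" using z[of 1] assms(2) by (simp add: numeral_eq_Suc)
  moreover from calculation have "b 2 = 0" using z[of 2] assms(2) by (simp add: numeral_eq_Suc)
  moreover from calculation have "b 3 = 0" using z[of 3] assms(2) by (simp add: numeral_eq_Suc)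
  moreover have "k = 0 \<or> k = 1 \<or> k = 2 \<or> k = 3" using k by linarith
  ultimately show "b k = 0" by metis
qed

lemma osc_01_nonzero:
  assumes "family_independent g e" "3 \<le> g"
  shows "osc g e 0 t + v *s osc g e 1 t \<noteq> 0"
proof
  assume "osc g e 0 t + v *s osc g e 1 t = 0"
  then have "(\<Sum>k\<le>3. ((\<lambda>_. 0)(0 := 1, 1 := v)) k *s osc g e k t) = 0"
    by (simp add: numeral_eq_Suc)
  then have "((\<lambda>_. 0)(0 := 1, 1 := v)) (0::nat) = (0::complex)"
    using osc_independent[OF assms, of t] unfolding family_independent_def by blast
  then show False by simp
qed

lemma osc_0_nonzero: "family_independent g e \<Longrightarrow> 3 \<le> g \<Longrightarrow> osc g e 0 t \<noteq> 0"
  using osc_01_nonzero[of g e t 0] by simp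

definition curve_of :: "nat \<Rightarrow> (nat \<Rightarrow> complex^'n::finite) \<Rightarrow> 'n proj set" where
  "curve_of g e = {p. \<exists>s0 s1. (s0, s1) \<noteq> (0, 0) \<and> (\<Sum>i\<le>g. (s0 ^ (g - i) * s1 ^ i) *s e i) \<in> line_of p}"

text \<open>Interchanging the two homogeneous parameters moves the point at infinity to the
  parameter 0, so what is proved for one affine chart applies to the other.\<close>

lemma curve_of_rev: "curve_of g (\<lambda>i. e (g - i)) = curve_of g e"
proof -
  have rev: "(\<Sum>i\<le>g. (s0 ^ (g - i) * s1 ^ i) *s e (g - i)) = (\<Sum>i\<le>g. (s1 ^ (g - i) * s0 ^ i) *s e i)" for s0 s1
    by (rule sum.reindex_bij_witness[of _ "\<lambda>i. g - i" "\<lambda>i. g - i"]) (auto simp: mult.commute)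
  show ?thesis unfolding curve_of_def rev by (auto simp: mult.commute)
qed

lemma osc_in_curve:
  assumes "family_independent g e" "3 \<le> g"
  shows "pt (osc g e 0 t) \<in> curve_of g e"
proof -
  have "osc g e 0 t \<in> line_of (pt (osc g e 0 t))"
    using osc_0_nonzero[OF assms] by (simp add: line_of_pt vec.span_base)
  then have "(1 :: complex, t) \<noteq> (0, 0) \<and> (\<Sum>i\<le>g. (1 ^ (g - i) * t ^ i) *s e i) \<in> line_of (pt (osc g e 0 t))"
    unfolding osc_def by simp
  then show ?thesis unfolding curve_of_def by blast
qed

lemma form_vanish_pt:
  assumes "F \<in> homog_ideal Z d" "v \<noteq> 0" "pt v \<in> Z"
  shows "mpeval F (vec_nth v) = 0"
proof -
  obtain c where "c \<noteq> 0" "coords (pt v) = c *s v" using coords_pt[OF assms(2)] .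
  then show ?thesis
    using assms form_zero_iff[of d F "pt v" c v] by (auto simp: homog_ideal_def)
qed

text \<open>A form vanishing on the curve vanishes along c(t): Euler's identity gives the claim for
  c, differentiation in t the one for c'. So the tangent line at c(t) lies in the Zariski tangent
  space used to define the scroll.\<close>

lemma osc_01_tangent:
  assumes e: "family_independent g e" "3 \<le> g"
  shows "osc g e 0 t \<in> tangent_space (curve_of g e) (pt (osc g e 0 t))"
    "osc g e 1 t \<in> tangent_space (curve_of g e) (pt (osc g e 0 t))"
proof -
  let ?c = "osc g e 0"
  obtain c where c: "c \<noteq> 0" "coords (pt (?c t)) = c *s ?c t" using coords_pt[OF osc_0_nonzero[OF e]] .
  have "grad F (?c t) (?c t) = 0 \<and> grad F (?c t) (osc g e 1 t) = 0"
    if F: "F \<in> homog_ideal (curve_of g e) d" for F d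
  proof
    have z: "mpeval F (vec_nth (?c t)) = 0" for t
      using form_vanish_pt[OF F osc_0_nonzero[OF e] osc_in_curve[OF e]] .
    then show "grad F (?c t) (?c t) = 0"
      using F z grad_self[of d F "?c t"] by (simp add: homog_ideal_def)
    have "((\<lambda>t. mpeval F (vec_nth (?c t))) has_field_derivative grad F (?c t) (osc g e 1 t)) (at t)"
      by (rule DERIV_mpeval) (use DERIV_osc[of g e 0] in simp)
    then show "grad F (?c t) (osc g e 1 t) = 0"
      unfolding z by (metis DERIV_const DERIV_unique)
  qed
  then show "osc g e 0 t \<in> tangent_space (curve_of g e) (pt (?c t))"
    "osc g e 1 t \<in> tangent_space (curve_of g e) (pt (?c t))"
    unfolding tangent_space_scale[OF c(2,1)] by blast+
qed

lemma scroll_point: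
  assumes e: "family_independent g e" "3 \<le> g"
  shows "pt (osc g e 0 t + v *s osc g e 1 t) \<in> tangent_scroll (curve_of g e)"
proof -
  let ?T = "tangent_space (curve_of g e) (pt (osc g e 0 t))"
  have "osc g e 0 t + v *s osc g e 1 t \<in> ?T"
    using osc_01_tangent[OF e] tangent_space_subspace by (meson vec.subspace_add vec.subspace_scale)
  then have "vec.span {osc g e 0 t + v *s osc g e 1 t} \<subseteq> ?T"
    using tangent_space_subspace by (intro vec.span_minimal) auto
  then show ?thesis
    using osc_in_curve[OF e, of t] line_of_pt[OF osc_01_nonzero[OF e, of t v]]
    unfolding tangent_scroll_def by auto
qed

text \<open>The scroll is cuspidal along the curve: the arc \<open>u \<mapsto> c(t + u) - u c'(t + u)\<close> has
  velocity \<open>- u c''(t + u)\<close>.  So a form vanishing on the scroll has, along this arc, zero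
  differential on \<open>c''(t + u)\<close>, and differentiating once more at \<open>u = 0\<close> gives \<open>c'''(t)\<close>.\<close>

lemma osc_tangent:
  assumes e: "family_independent g e" "3 \<le> g" and X: "tangent_scroll (curve_of g e) \<subseteq> X" and k: "k \<le> 3"
  shows "osc g e k t \<in> tangent_space X (pt (osc g e 0 t))"
proof -
  let ?c = "osc g e 0"
  obtain c where c: "c \<noteq> 0" "coords (pt (?c t)) = c *s ?c t" using coords_pt[OF osc_0_nonzero[OF e]] .
  have "grad F (?c t) (osc g e k t) = 0" if F: "F \<in> homog_ideal X d" for F d
  proof -
    have z: "mpeval F (vec_nth (?c t + v *s osc g e 1 t)) = 0" for t v
      using form_vanish_pt[OF F osc_01_nonzero[OF e]] scroll_point[OF e] X by blast
    have z0: "mpeval F (vec_nth (?c t)) = 0" for t using z[of t 0] by simp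
    have 0: "grad F (?c t) (?c t) = 0"
      using F z0 grad_self[of d F "?c t"] by (simp add: homog_ideal_def)
    have "((\<lambda>t. mpeval F (vec_nth (?c t))) has_field_derivative grad F (?c t) (osc g e 1 t)) (at t)"
      by (rule DERIV_mpeval) (use DERIV_osc[of g e 0] in simp)
    then have 1: "grad F (?c t) (osc g e 1 t) = 0"
      unfolding z0 by (metis DERIV_const DERIV_unique)
    define \<gamma> where "\<gamma> u = ?c (t + u) + (- u) *s osc g e 1 (t + u)" for u
    have d\<gamma>: "((\<lambda>u. \<gamma> u $ l) has_field_derivative ((- u) *s osc g e 2 (t + u)) $ l) (at u)" for u l
      unfolding \<gamma>_def using DERIV_osc_shift[of g e 0 t l u] DERIV_osc_shift[of g e 1 t l u]
      by (auto intro!: derivative_eq_intros simp: numeral_2_eq_2)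
    have "grad F (\<gamma> u) ((- u) *s osc g e 2 (t + u)) = 0" for u
    proof -
      have "((\<lambda>u. mpeval F (vec_nth (\<gamma> u))) has_field_derivative grad F (\<gamma> u) ((- u) *s osc g e 2 (t + u))) (at u)"
        by (rule DERIV_mpeval) (rule d\<gamma>)
      then show ?thesis
        unfolding \<gamma>_def z by (metis DERIV_const DERIV_unique)
    qed
    \<comment> \<open>The relation for c'' comes with the factor - u, which can be cancelled only
      away from u = 0.\<close>
    then have off0: "grad F (\<gamma> u) (osc g e 2 (t + u)) = 0" if "u \<noteq> 0" for u
      using that by (metis grad_scale mult_eq_0_iff neg_equal_0_iff_equal)
    define \<Phi> where "\<Phi> u = grad F (\<gamma> u) (osc g e 2 (t + u))" for u
    have "((\<lambda>u. mpeval (mpderiv i F) (vec_nth (\<gamma> u)) * osc g e 2 (t + u) $ i) has_field_derivative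
        mpeval (mpderiv i F) (vec_nth (\<gamma> 0)) * osc g e 3 t $ i) (at 0)" for i
    proof -
      \<comment> \<open>At u = 0 the arc has velocity 0, so differentiating the product affects only
        the factor c'' and produces c'''.\<close>
      have "((\<lambda>u. mpeval (mpderiv i F) (vec_nth (\<gamma> u))) has_field_derivative
          grad (mpderiv i F) (\<gamma> 0) ((- 0) *s osc g e 2 (t + 0))) (at 0)"
        by (rule DERIV_mpeval) (rule d\<gamma>)
      then have "((\<lambda>u. mpeval (mpderiv i F) (vec_nth (\<gamma> u))) has_field_derivative 0) (at 0)" by simp
      from DERIV_mult[OF this DERIV_osc_shift[of g e 2 t i 0]] show ?thesis
        by (simp add: numeral_3_eq_3 numeral_2_eq_2 mult.commute)
    qed
    then have d\<Phi>: "(\<Phi> has_field_derivative grad F (\<gamma> 0) (osc g e 3 t)) (at 0)"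
      unfolding \<Phi>_def grad_def by (intro DERIV_sum)
    \<comment> \<open>Continuity supplies the missing value at u = 0, which is the claim for c''.
      Then \<Phi> vanishes identically, and its derivative gives the claim for c'''.\<close>
    have "(\<Phi> \<longlongrightarrow> \<Phi> 0) (at 0)"
      using DERIV_isCont[OF d\<Phi>] by (simp add: isCont_def)
    moreover have "(\<Phi> \<longlongrightarrow> 0) (at 0)"
      by (rule tendsto_eventually) (auto simp: eventually_at_filter \<Phi>_def off0)
    ultimately have \<Phi>0: "\<Phi> 0 = 0" by (rule LIM_unique)
    then have "\<Phi> u = 0" for u using off0[of u] by (cases "u = 0") (auto simp: \<Phi>_def)
    then have "\<Phi> = (\<lambda>_. 0)" by blast
    then have "(\<Phi> has_field_derivative 0) (at 0)" by simp
    with d\<Phi> have "grad F (\<gamma> 0) (osc g e 3 t) = 0" by (rule DERIV_unique)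
    then have 3: "grad F (?c t) (osc g e 3 t) = 0" by (simp add: \<gamma>_def)
    have 2: "grad F (?c t) (osc g e 2 t) = 0"
      using \<Phi>0 by (simp add: \<Phi>_def \<gamma>_def)
    have "k = 0 \<or> k = 1 \<or> k = 2 \<or> k = 3" using k by linarith
    then show ?thesis using 0 1 2 3 by blast
  qed
  then show ?thesis unfolding tangent_space_scale[OF c(2,1)] by blast
qed

lemma curve_in_X:
  assumes e: "family_independent g e" "3 \<le> g" and X: "tangent_scroll (curve_of g e) \<subseteq> X"
  shows "pt (osc g e 0 t) \<in> X"
  using scroll_point[OF e, of t 0] X by auto

text \<open>In the finite type \<open>3\<close> the numeral 3 equals 0, so this is not a coercion;
  that element stands for the third derivative.\<close>

definition osc_index :: "3 \<Rightarrow> nat" where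
  "osc_index j = (if j = 1 then 1 else if j = 2 then 2 else 3)"

text \<open>The vectors c, c', c'', c''' are independent and lie in a tangent space of dimension 4,
  so they span it. The scalar l is the one of \<open>coords\<close>, as the evaluation of
  differentials requires.\<close>

lemma osc_frame:
  assumes e: "family_independent g e" "3 \<le> g" and X: "tangent_scroll (curve_of g e) \<subseteq> X"
    and dim: "vec.dim (tangent_space X (pt (osc g e 0 t))) = 4"
    and l: "l \<noteq> 0" "coords (pt (osc g e 0 t)) = l *s osc g e 0 t"
  shows "tangent_frame X (pt (osc g e 0 t)) (\<lambda>j. l *s osc g e (osc_index j) t)"
  unfolding tangent_frame_def
proof (intro conjI allI)
  let ?T = "tangent_space X (pt (osc g e 0 t))"
  have T: "osc g e k t \<in> ?T" if "k \<le> 3" for k using osc_tangent[OF e X that] .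
  show "l *s osc g e (osc_index j) t \<in> ?T" for j
    by (intro vec.subspace_scale tangent_space_subspace T) (simp add: osc_index_def)
  let ?B = "(\<lambda>k. osc g e k t) ` {..3::nat}"
  note ind = family_independent_set[OF osc_independent[OF e, of t]]
  have "card ?B = 4" using card_image[OF ind(1)] by simp
  then have "?T \<subseteq> vec.span ?B"
    using ind(2) T dim by (intro vec.card_ge_dim_independent) auto
  moreover have "vec.span ?B \<subseteq> vec.span (insert (coords (pt (osc g e 0 t))) (range (\<lambda>j. l *s osc g e (osc_index j) t)))"
    (is "_ \<subseteq> ?S")
  proof (rule vec.span_minimal)
    show "?B \<subseteq> ?S"
    proof
      fix x assume "x \<in> ?B"
      then obtain k where k: "k \<le> 3" "x = osc g e k t" by blast
      have "l *s x \<in> ?S"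
      proof (cases "k = 0")
        case True
        then show ?thesis using k l(2) by (intro vec.span_base) simp
      next
        case False
        then have "k = osc_index 1 \<or> k = osc_index 2 \<or> k = osc_index 3"
          using k(1) by (auto simp: osc_index_def)
        then show ?thesis using k by (intro vec.span_base) auto
      qed
      then have "inverse l *s (l *s x) \<in> ?S" by (rule vec.span_scale)
      then show "x \<in> ?S" using l(1) by (simp add: vec.scale_scale)
    qed
  qed simp
  ultimately show "?T \<subseteq> ?S" by blast
qed

section \<open>Comparing the two affine charts\<close>

text \<open>The scalar by which the chosen \<open>coords\<close> differs from an explicit
  representative. Its dependence on c is uncontrolled, so it has to cancel before anything can be
  differentiated in t.\<close>

definition coords_factor :: "complex^'n::finite \<Rightarrow> complex" where
  "coords_factor c = (SOME l. l \<noteq> 0 \<and> coords (pt c) = l *s c)"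

lemma coords_factor:
  assumes "c \<noteq> 0"
  shows "coords_factor c \<noteq> 0" "coords (pt c) = coords_factor c *s c"
proof -
  have "\<exists>l. l \<noteq> 0 \<and> coords (pt c) = l *s c"
    using coords_pt[OF assms] by metis
  then have "coords_factor c \<noteq> 0 \<and> coords (pt c) = coords_factor c *s c"
    unfolding coords_factor_def by (rule someI_ex)
  then show "coords_factor c \<noteq> 0" "coords (pt c) = coords_factor c *s c" by auto
qed

lemma coords_factor_scale:
  assumes "c \<noteq> 0" "a \<noteq> 0"
  shows "coords_factor c = coords_factor (a *s c) * a"
proof -
  have "a *s c \<noteq> 0" using assms by simp
  then have "coords_factor c *s c = coords_factor (a *s c) *s (a *s c)"
    using coords_factor(2)[OF assms(1)] coords_factor(2)[of "a *s c"] pt_scale[OF assms(2), of c] by metis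
  then have "coords_factor c *s c = (coords_factor (a *s c) * a) *s c"
    by (simp add: vec.scale_scale)
  then show ?thesis using assms(1) by (simp only: vec.scale_cancel_right simp_thms)
qed

lemma pivot_nonzero: "coords p $ pivot p \<noteq> 0"
proof -
  have "\<exists>i. coords p $ i \<noteq> 0" using coords_nonzero[of p] by (auto simp: vec_eq_iff)
  then show ?thesis unfolding pivot_def by (rule someI_ex)
qed

section \<open>Forms, differentials and open sets along the parametrized curve\<close>

lemma mpeval_osc_differentiable: "(\<lambda>t. mpeval F (vec_nth (osc g e 0 t))) field_differentiable at t"
  using DERIV_mpeval[OF DERIV_osc] unfolding field_differentiable_def by blast

lemma osc_differentiable: "(\<lambda>t. osc g e k t $ i) field_differentiable at t"
  using DERIV_osc field_differentiable_def by blast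

lemma grad_osc_differentiable: "(\<lambda>t. grad F (osc g e 0 t) (osc g e k t)) field_differentiable at t"
  unfolding grad_def
  by (intro derivative_intros field_differentiable_sum mpeval_osc_differentiable osc_differentiable)

lemma qdiff_osc_differentiable:
  assumes "mpeval G (vec_nth (osc g e 0 t)) \<noteq> 0"
  shows "(\<lambda>t. qdiff F G (osc g e 0 t) (osc g e k t)) field_differentiable at t"
  unfolding qdiff_def
  by (intro derivative_intros mpeval_osc_differentiable grad_osc_differentiable) (use assms in simp)

text \<open>Zariski open sets pull back to sets of parameters open in the usual topology, since
  forms are continuous along c. The filter \<open>nhds\<close> includes t0 itself, as is needed to
  transfer a derivative at t0.\<close>

lemma eventually_pt_osc:
  assumes e: "family_independent g e" "3 \<le> g" and X: "\<And>t. pt (osc g e 0 t) \<in> X"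
    and W: "openin (subtopology zariski X) W" "pt (osc g e 0 t0) \<in> W"
  shows "\<forall>\<^sub>F t in nhds t0. pt (osc g e 0 t) \<in> W"
proof -
  obtain d A where A: "homogeneous d A" "form_at A (pt (osc g e 0 t0)) \<noteq> 0" "{q\<in>X. form_at A q \<noteq> 0} \<subseteq> W"
    by (rule subtopology_zariski_basis[OF W])
  have iff: "form_at A (pt (osc g e 0 t)) = 0 \<longleftrightarrow> mpeval A (vec_nth (osc g e 0 t)) = 0" for t
    using coords_factor[OF osc_0_nonzero[OF e]] form_zero_iff[OF A(1)] by blast
  have "isCont (\<lambda>t. mpeval A (vec_nth (osc g e 0 t))) t0"
    using mpeval_osc_differentiable by (rule field_differentiable_imp_continuous_at)
  then have "((\<lambda>t. mpeval A (vec_nth (osc g e 0 t))) \<longlongrightarrow> mpeval A (vec_nth (osc g e 0 t0))) (nhds t0)"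
    using tendsto_at_iff_tendsto_nhds[of "\<lambda>t. mpeval A (vec_nth (osc g e 0 t))" t0]
    unfolding isCont_def by blast
  then have "\<forall>\<^sub>F t in nhds t0. mpeval A (vec_nth (osc g e 0 t)) \<noteq> 0"
    using A(2) iff by (intro tendsto_imp_eventually_ne) auto
  then show ?thesis
    by (rule eventually_mono) (use A(3) X iff in blast)
qed

text \<open>Vandermonde's identity for the falling factorial of g - j: the m-th falling factorial of
  j occurs with coefficient (-1)^m binom(k, m) (g - m) ... (g - k + 1).\<close>

lemma falling_reverse:
  fixes i g :: nat
  assumes "i \<le> g"
  defines "j \<equiv> g - i" and "G \<equiv> of_nat g :: complex"
  shows "(of_nat (falling i 1) :: complex) = G * of_nat (falling j 0) - of_nat (falling j 1)"
    "(of_nat (falling i 2) :: complex) = G * (G - 1) * of_nat (falling j 0)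
       - 2 * (G - 1) * of_nat (falling j 1) + of_nat (falling j 2)"
    "(of_nat (falling i 3) :: complex) = G * (G - 1) * (G - 2) * of_nat (falling j 0)
       - 3 * (G - 1) * (G - 2) * of_nat (falling j 1) + 3 * (G - 2) * of_nat (falling j 2)
       - of_nat (falling j 3)"
proof -
  have f: "(of_nat (falling n 0) :: complex) = 1" "(of_nat (falling n 1) :: complex) = of_nat n"
    "(of_nat (falling n 2) :: complex) = of_nat n * (of_nat n - 1)"
    "(of_nat (falling n 3) :: complex) = of_nat n * (of_nat n - 1) * (of_nat n - 2)" for n
    using of_nat_falling_Suc[of n 0] of_nat_falling_Suc[of n 1] of_nat_falling_Suc[of n 2]
    by (simp_all add: numeral_2_eq_2 numeral_3_eq_3 del: falling.simps(2) of_nat_mult)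
  have i: "(of_nat i :: complex) = G - of_nat j"
    using assms(1) by (simp add: j_def G_def of_nat_diff)
  show "(of_nat (falling i 1) :: complex) = G * of_nat (falling j 0) - of_nat (falling j 1)"
    unfolding f i by simp
  show "(of_nat (falling i 2) :: complex) = G * (G - 1) * of_nat (falling j 0)
       - 2 * (G - 1) * of_nat (falling j 1) + of_nat (falling j 2)"
    unfolding f i by algebra
  show "(of_nat (falling i 3) :: complex) = G * (G - 1) * (G - 2) * of_nat (falling j 0)
       - 3 * (G - 1) * (G - 2) * of_nat (falling j 1) + 3 * (G - 2) * of_nat (falling j 2)
       - of_nat (falling j 3)"
    unfolding f i by algebra
qed

text \<open>The operator t^k d^k/dt^k is diagonal on the monomials t^i, with the falling factorials
  as eigenvalues; the truncated exponents i - k disappear.\<close>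

lemma osc_scaled:
  "t ^ k *s osc g e k t = (\<Sum>i\<le>g. (of_nat (falling i k) * t ^ i) *s e i)"
proof -
  have *: "t ^ k * (of_nat (falling i k) * t ^ (i - k)) = of_nat (falling i k) * t ^ i" for i
    by (cases "k \<le> i") (auto simp: falling_zero simp flip: power_add)
  show ?thesis unfolding osc_def vec.scale_sum_right vec.scale_scale * ..
qed

lemma osc_scaled_rev:
  assumes "t * s = 1"
  shows "(t ^ g * s ^ k) *s osc g (\<lambda>i. e (g - i)) k s = (\<Sum>i\<le>g. (of_nat (falling (g - i) k) * t ^ i) *s e i)"
proof -
  have "t ^ g * s ^ (g - i) = t ^ i" if "i \<le> g" for i
  proof -
    have "t ^ g = t ^ i * t ^ (g - i)" using that by (simp flip: power_add)
    then show ?thesis using assms by (simp add: mult.assoc flip: power_mult_distrib)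
  qed
  then have *: "t ^ g * (of_nat n * s ^ (g - i)) = of_nat n * t ^ i" if "i \<le> g" for i n
    using that by (simp add: mult.left_commute)
  have "(t ^ g * s ^ k) *s osc g (\<lambda>i. e (g - i)) k s =
      t ^ g *s (\<Sum>i\<le>g. (of_nat (falling i k) * s ^ i) *s e (g - i))"
    unfolding vec.scale_scale[symmetric] osc_scaled ..
  also have "\<dots> = t ^ g *s (\<Sum>i\<le>g. (of_nat (falling (g - i) k) * s ^ (g - i)) *s e i)"
    by (rule arg_cong[where f = "\<lambda>x. _ *s x"], rule sum.reindex_bij_witness[of _ "\<lambda>i. g - i" "\<lambda>i. g - i"]) auto
  also have "\<dots> = (\<Sum>i\<le>g. (of_nat (falling (g - i) k) * t ^ i) *s e i)"
    unfolding vec.scale_sum_right vec.scale_scale by (rule sum.cong) (simp_all only: * atMost_iff)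
  finally show ?thesis .
qed

text \<open>The chain rule for the relation between c and the parametrization with reversed basis,
  stated first in the proof. In scaled form it is a comparison of the coefficients of t^i e i, that
  is, \<open>falling_reverse\<close>.\<close>

lemma osc_reverse:
  fixes e :: "nat \<Rightarrow> complex^'n::finite" and g :: nat
  assumes ts: "t * s = 1"
  defines "e' \<equiv> \<lambda>i. e (g - i)" and "G \<equiv> of_nat g :: complex"
  shows "osc g e 0 t = t ^ g *s osc g e' 0 s"
    "t *s osc g e 1 t = t ^ g *s (G *s osc g e' 0 s - s *s osc g e' 1 s)"
    "t\<^sup>2 *s osc g e 2 t = t ^ g *s ((G * (G - 1)) *s osc g e' 0 s - (2 * (G - 1) * s) *s osc g e' 1 s
       + s\<^sup>2 *s osc g e' 2 s)"
    "t ^ 3 *s osc g e 3 t = t ^ g *s ((G * (G - 1) * (G - 2)) *s osc g e' 0 s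
       - (3 * (G - 1) * (G - 2) * s) *s osc g e' 1 s + (3 * (G - 2) * s\<^sup>2) *s osc g e' 2 s
       - s ^ 3 *s osc g e' 3 s)"
proof -
  define E where "E k = (\<Sum>i\<le>g. (of_nat (falling (g - i) k) * t ^ i) *s e i)" for k
  have E: "E k = (t ^ g * s ^ k) *s osc g e' k s" for k
    unfolding E_def e'_def by (rule osc_scaled_rev[OF ts, symmetric])
  show "osc g e 0 t = t ^ g *s osc g e' 0 s"
    using osc_scaled[of t 0 g e] E[of 0] by (simp add: E_def)
  note combine = vec.scale_left_diff_distrib[symmetric] vec.scale_left_distrib[symmetric]
  have "t ^ 1 *s osc g e 1 t = G *s E 0 - 1 *s E 1"
    unfolding osc_scaled E_def vec.scale_sum_right vec.scale_scale sum_subtractf[symmetric] combine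
    by (rule sum.cong[OF refl], rule arg_cong[where f = "\<lambda>x. x *s _"], subst falling_reverse(1))
       (auto simp: G_def algebra_simps)
  then have "t *s osc g e 1 t = G *s E 0 - E 1" by simp
  then show "t *s osc g e 1 t = t ^ g *s (G *s osc g e' 0 s - s *s osc g e' 1 s)"
    unfolding E by (simp add: vec_eq_iff algebra_simps)
  have "t\<^sup>2 *s osc g e 2 t = (G * (G - 1)) *s E 0 - (2 * (G - 1)) *s E 1 + E 2"
    unfolding osc_scaled E_def vec.scale_sum_right vec.scale_scale sum_subtractf[symmetric]
      sum.distrib[symmetric] combine
    by (rule sum.cong[OF refl], rule arg_cong[where f = "\<lambda>x. x *s _"], subst falling_reverse(2))
       (auto simp: G_def algebra_simps)
  then show "t\<^sup>2 *s osc g e 2 t = t ^ g *s ((G * (G - 1)) *s osc g e' 0 s - (2 * (G - 1) * s) *s osc g e' 1 s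
       + s\<^sup>2 *s osc g e' 2 s)"
    unfolding E by (simp add: vec_eq_iff algebra_simps)
  have "t ^ 3 *s osc g e 3 t = (G * (G - 1) * (G - 2)) *s E 0 - (3 * (G - 1) * (G - 2)) *s E 1
      + (3 * (G - 2)) *s E 2 - E 3"
    unfolding osc_scaled E_def vec.scale_sum_right vec.scale_scale sum_subtractf[symmetric]
      sum.distrib[symmetric] combine
    by (rule sum.cong[OF refl], rule arg_cong[where f = "\<lambda>x. x *s _"], subst falling_reverse(3))
       (auto simp: G_def algebra_simps)
  then show "t ^ 3 *s osc g e 3 t = t ^ g *s ((G * (G - 1) * (G - 2)) *s osc g e' 0 s
       - (3 * (G - 1) * (G - 2) * s) *s osc g e' 1 s + (3 * (G - 2) * s\<^sup>2) *s osc g e' 2 s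
       - s ^ 3 *s osc g e' 3 s)"
    unfolding E by (simp add: vec_eq_iff algebra_simps)
qed

text \<open>Modulo the 0-th derivative, which every D i kills, the change of frame is triangular
  with diagonal entries - t^g s^2, t^g s^4, - t^g s^6, whose product is t^(3 g) s^12. Off the
  diagonal it is enough that the coefficients are the same for all i.\<close>

lemma det_triangular_change:
  fixes D :: "3 \<Rightarrow> complex^'n::finite \<Rightarrow> complex"
  assumes add: "\<And>i x y. D i (x + y) = D i x + D i y" and scale: "\<And>i c x. D i (c *s x) = c * D i x"
    and ts: "t * s = 1" and D0: "\<And>i. D i (osc g (\<lambda>i. e (g - i)) 0 s) = 0"
  shows "det (\<chi> i j. D i (osc g e (osc_index j) t)) =
     t ^ (3 * g) * s ^ 12 * det (\<chi> i j. D i (osc g (\<lambda>i. e (g - i)) (osc_index j) s))"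
proof -
  let ?e = "\<lambda>i. e (g - i)" and ?G = "of_nat g :: complex"
  have diff: "D i (x - y) = D i x - D i y" for i x y
    using add[of i x "(-1) *s y"] scale[of i "-1" y] by simp
  have st: "s ^ k * (t ^ k * z) = z" for k and z :: complex
  proof -
    have "s ^ k * (t ^ k * z) = (t * s) ^ k * z" by (simp only: power_mult_distrib mult_ac)
    then show ?thesis using ts by simp
  qed
  have 1: "D i (osc g e 1 t) = - (t ^ g * s ^ 2) * D i (osc g ?e 1 s)" for i
  proof -
    have "t * D i (osc g e 1 t) = t ^ g * (- s * D i (osc g ?e 1 s))"
      using arg_cong[OF osc_reverse(2)[OF ts, of g e], of "D i"] by (simp add: scale diff D0 algebra_simps)
    then have "s * (t * D i (osc g e 1 t)) = s * (t ^ g * (- s * D i (osc g ?e 1 s)))" by simp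
    also have "s * (t * D i (osc g e 1 t)) = D i (osc g e 1 t)" using st[of 1] by simp
    finally show ?thesis by (simp add: power2_eq_square mult_ac)
  qed
  have 2: "\<exists>b. \<forall>i. D i (osc g e 2 t) = t ^ g * s ^ 4 * D i (osc g ?e 2 s) + b * D i (osc g ?e 1 s)"
  proof (intro exI allI)
    fix i
    have "t\<^sup>2 * D i (osc g e 2 t) = t ^ g * (- (2 * (?G - 1) * s) * D i (osc g ?e 1 s) + s\<^sup>2 * D i (osc g ?e 2 s))"
      using arg_cong[OF osc_reverse(3)[OF ts, of g e], of "D i"] by (simp add: scale add diff D0 algebra_simps)
    then have "s\<^sup>2 * (t\<^sup>2 * D i (osc g e 2 t)) =
      s\<^sup>2 * (t ^ g * (- (2 * (?G - 1) * s) * D i (osc g ?e 1 s) + s\<^sup>2 * D i (osc g ?e 2 s)))" by simp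
    then show "D i (osc g e 2 t) = t ^ g * s ^ 4 * D i (osc g ?e 2 s) +
        (- (s\<^sup>2 * t ^ g * (2 * (?G - 1) * s))) * D i (osc g ?e 1 s)"
      unfolding st by (simp add: algebra_simps power2_eq_square power4_eq_xxxx)
  qed
  have 3: "\<exists>b c. \<forall>i. D i (osc g e 3 t) = - (t ^ g * s ^ 6) * D i (osc g ?e 3 s) + b * D i (osc g ?e 2 s) + c * D i (osc g ?e 1 s)"
  proof (intro exI allI)
    fix i
    have "t ^ 3 * D i (osc g e 3 t) = t ^ g * (- (3 * (?G - 1) * (?G - 2) * s) * D i (osc g ?e 1 s)
       + 3 * (?G - 2) * s\<^sup>2 * D i (osc g ?e 2 s) - s ^ 3 * D i (osc g ?e 3 s))"
      using arg_cong[OF osc_reverse(4)[OF ts, of g e], of "D i"] by (simp add: scale add diff D0 algebra_simps)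
    then have "s ^ 3 * (t ^ 3 * D i (osc g e 3 t)) = s ^ 3 * (t ^ g * (- (3 * (?G - 1) * (?G - 2) * s) * D i (osc g ?e 1 s)
       + 3 * (?G - 2) * s\<^sup>2 * D i (osc g ?e 2 s) - s ^ 3 * D i (osc g ?e 3 s)))" by simp
    then have eq: "D i (osc g e 3 t) = s ^ 3 * (t ^ g * (- (3 * (?G - 1) * (?G - 2) * s) * D i (osc g ?e 1 s)
       + 3 * (?G - 2) * s\<^sup>2 * D i (osc g ?e 2 s) - s ^ 3 * D i (osc g ?e 3 s)))" unfolding st .
    have ring: "s ^ 3 * (T * (- (a * s) * x + b * s\<^sup>2 * y - s ^ 3 * z)) =
        - (T * s ^ 6) * z + (s ^ 3 * T * (b * s\<^sup>2)) * y + (- (s ^ 3 * T * (a * s))) * x" for T a b x y z :: complex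
      by algebra
    show "D i (osc g e 3 t) = - (t ^ g * s ^ 6) * D i (osc g ?e 3 s) +
        (s ^ 3 * t ^ g * (3 * (?G - 2) * s\<^sup>2)) * D i (osc g ?e 2 s) +
        (- (s ^ 3 * t ^ g * (3 * (?G - 1) * (?G - 2) * s))) * D i (osc g ?e 1 s)"
      unfolding eq by (rule ring)
  qed
  obtain b2 where b2: "\<And>i. D i (osc g e 2 t) = t ^ g * s ^ 4 * D i (osc g ?e 2 s) + b2 * D i (osc g ?e 1 s)"
    using 2 by blast
  obtain b3 c3 where b3: "\<And>i. D i (osc g e 3 t) = - (t ^ g * s ^ 6) * D i (osc g ?e 3 s) + b3 * D i (osc g ?e 2 s) + c3 * D i (osc g ?e 1 s)"
    using 3 by blast
  have idx: "osc_index 1 = 1" "osc_index 2 = 2" "osc_index 3 = 3"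
    by (simp_all add: osc_index_def)
  define T where "T = t ^ g"
  define x y z where "x i = D i (osc g ?e 1 s)" and "y i = D i (osc g ?e 2 s)" and "z i = D i (osc g ?e 3 s)" for i
  have "t ^ (3 * g) = T ^ 3" by (simp add: T_def power_mult mult.commute[of 3])
  moreover have "det (\<chi> i j. D i (osc g e (osc_index j) t)) = T ^ 3 * s ^ 12 * det (\<chi> i j. D i (osc g ?e (osc_index j) s))"
    unfolding det_3 vec_lambda_beta idx 1 b2 b3 T_def[symmetric] x_def[symmetric] y_def[symmetric] z_def[symmetric]
    by algebra
  ultimately show ?thesis by simp
qed

text \<open>Local parameters u whose 3-forms frame K, and a trivialization \<phi> of K tensored with
  the hyperplane bundle. All charts of the trivial bundle are X with transition function 1, so the
  diagonal \<phi> p p carries the whole trivialization; its change of chart is recorded at the index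
  point q.\<close>

locale canonical_trivialization =
  fixes X :: "'n::finite proj set" and K :: "'n lbundle"
    and u :: "'n proj \<Rightarrow> 3 \<Rightarrow> 'n proj \<Rightarrow> complex" and \<phi> :: "'n proj \<Rightarrow> 'n proj \<Rightarrow> 'n proj \<Rightarrow> complex"
  assumes dim: "p \<in> X \<Longrightarrow> vec.dim (tangent_space X p) = 4"
    and K: "line_bundle X K"
    and u_regular: "p \<in> X \<Longrightarrow> regular_on X (chart K p) (u p i)"
    and u_nonzero: "p \<in> X \<Longrightarrow> x \<in> chart K p \<Longrightarrow> \<exists>v. (\<forall>j. v j \<in> tangent_space X x) \<and> jacobian X (u p) x v \<noteq> 0"
    and u_transition: "p \<in> X \<Longrightarrow> q \<in> X \<Longrightarrow> x \<in> chart K p \<Longrightarrow> x \<in> chart K q \<Longrightarrow> (\<And>j. v j \<in> tangent_space X x) \<Longrightarrow>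
       jacobian X (u q) x v = transition K p q x * jacobian X (u p) x v"
    and \<phi>_unit: "p \<in> X \<Longrightarrow> unit_on X (chart K p \<inter> {x\<in>X. coords x $ pivot p \<noteq> 0}) (\<phi> p p)"
    and \<phi>_transition: "p \<in> X \<Longrightarrow> q \<in> X \<Longrightarrow> q \<in> chart K p \<Longrightarrow> coords q $ pivot p \<noteq> 0 \<Longrightarrow>
       \<phi> q q q = \<phi> p p q * (transition K p q q * (coords q $ pivot q / coords q $ pivot p))"
begin

text \<open>Scaled like \<open>coords\<close>, so that \<open>differential\<close>, which depends on
  that choice, takes the value computed from c and its derivatives.\<close>

definition osc_vectors :: "nat \<Rightarrow> (nat \<Rightarrow> complex^'n) \<Rightarrow> complex \<Rightarrow> 3 \<Rightarrow> complex^'n" where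
  "osc_vectors g e t j = coords_factor (osc g e 0 t) *s osc g e (osc_index j) t"

text \<open>The trivialization \<open>\<phi>\<close> of \<open>K\<close> tensored with the hyperplane bundle, expressed along the curve
  in the frame of \<open>K\<close> dual to \<open>c', c'', c'''\<close> and the frame of the hyperplane bundle given by \<open>c\<close>.\<close>

definition degree_function :: "nat \<Rightarrow> (nat \<Rightarrow> complex^'n) \<Rightarrow> complex \<Rightarrow> complex" where
  "degree_function g e t = (let p = pt (osc g e 0 t) in
     \<phi> p p p / (jacobian X (u p) p (osc_vectors g e t) * osc g e 0 t $ pivot p))"

context
  fixes g :: nat and e :: "nat \<Rightarrow> complex^'n"
  assumes e: "family_independent g e" "3 \<le> g" and scroll: "tangent_scroll (curve_of g e) \<subseteq> X"
begin

lemma point_in_X: "pt (osc g e 0 t) \<in> X"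
  by (rule curve_in_X[OF e scroll])

lemma osc_vectors_frame: "tangent_frame X (pt (osc g e 0 t)) (osc_vectors g e t)"
  using osc_frame[OF e scroll dim[OF point_in_X] coords_factor[OF osc_0_nonzero[OF e]]]
  unfolding osc_vectors_def[abs_def] .

lemma osc_vectors_tangent: "osc_vectors g e t j \<in> tangent_space X (pt (osc g e 0 t))"
  using osc_vectors_frame unfolding tangent_frame_def by blast

lemma jacobian_osc_nonzero:
  assumes "p \<in> X" "pt (osc g e 0 t) \<in> chart K p"
  shows "jacobian X (u p) (pt (osc g e 0 t)) (osc_vectors g e t) \<noteq> 0"
proof -
  obtain v where v: "\<forall>j. v j \<in> tangent_space X (pt (osc g e 0 t))" "jacobian X (u p) (pt (osc g e 0 t)) v \<noteq> 0"
    using u_nonzero[OF assms] by blast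
  show ?thesis
    by (rule jacobian_frame_nonzero[of X "chart K p" "u p" _ _ v])
       (use u_regular assms v osc_vectors_frame in auto)
qed

lemma osc_pivot_nonzero:
  "coords (pt (osc g e 0 t)) $ i = coords_factor (osc g e 0 t) * osc g e 0 t $ i"
  "coords (pt (osc g e 0 t)) $ i \<noteq> 0 \<longleftrightarrow> osc g e 0 t $ i \<noteq> 0"
  using coords_factor[OF osc_0_nonzero[OF e, of t]] by (auto simp: vec_eq_iff)

text \<open>The definition uses the chart indexed by the moving point. Passing to a fixed p changes
  numerator and denominator by the same transition functions of K and of the hyperplane
  bundle.\<close>

lemma degree_function_local:
  assumes p: "p \<in> X" "pt (osc g e 0 t) \<in> chart K p" "coords (pt (osc g e 0 t)) $ pivot p \<noteq> 0"
  shows "degree_function g e t = \<phi> p p (pt (osc g e 0 t)) /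
     (jacobian X (u p) (pt (osc g e 0 t)) (osc_vectors g e t) * osc g e 0 t $ pivot p)"
proof -
  let ?q = "pt (osc g e 0 t)"
  define l where "l = coords_factor (osc g e 0 t)"
  have l: "l \<noteq> 0" using coords_factor[OF osc_0_nonzero[OF e]] by (simp add: l_def)
  have q: "?q \<in> X" "?q \<in> chart K ?q" using point_in_X line_bundle_chart[OF K] by auto
  have "osc g e 0 t $ pivot p \<noteq> 0" "osc g e 0 t $ pivot ?q \<noteq> 0"
    using p(3) pivot_nonzero osc_pivot_nonzero(2) by blast+
  moreover have "transition K p ?q ?q \<noteq> 0" using transition_nonzero[OF K p(1) q(1) p(2) q(2)] .
  moreover have "\<phi> ?q ?q ?q = \<phi> p p ?q * (transition K p ?q ?q * (coords ?q $ pivot ?q / coords ?q $ pivot p))"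
    by (rule \<phi>_transition[OF p(1) q(1) p(2,3)])
  moreover have "jacobian X (u ?q) ?q (osc_vectors g e t) = transition K p ?q ?q * jacobian X (u p) ?q (osc_vectors g e t)"
    by (rule u_transition[OF p(1) q(1) p(2) q(2) osc_vectors_tangent])
  moreover have "jacobian X (u p) ?q (osc_vectors g e t) \<noteq> 0" by (rule jacobian_osc_nonzero[OF p(1,2)])
  ultimately show ?thesis
    unfolding degree_function_def Let_def osc_pivot_nonzero(1) l_def[symmetric] using l by simp
qed

lemma degree_function_nonzero: "degree_function g e t \<noteq> 0"
proof -
  let ?q = "pt (osc g e 0 t)"
  have q: "?q \<in> X" "?q \<in> chart K ?q" using point_in_X line_bundle_chart[OF K] by auto
  moreover have "\<phi> ?q ?q ?q \<noteq> 0"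
    using \<phi>_unit[OF q(1)] q pivot_nonzero unfolding unit_on_def by blast
  moreover have "osc g e 0 t $ pivot ?q \<noteq> 0" using pivot_nonzero osc_pivot_nonzero(2) by blast
  ultimately show ?thesis
    using jacobian_osc_nonzero[OF q] by (simp add: degree_function_def Let_def)
qed

text \<open>Near t0 the chart is fixed at p, and there \<phi> and the parameters are quotients of
  forms. Invariance of \<open>qdiff\<close> under common scaling removes
  \<open>coords_factor\<close>, leaving a rational expression h in t with nonzero denominators at
  t0.\<close>

lemma degree_function_differentiable: "degree_function g e field_differentiable at t0"
proof -
  let ?c = "osc g e 0"
  define p where "p = pt (?c t0)"
  have p: "p \<in> X" "p \<in> chart K p" using point_in_X line_bundle_chart[OF K] by (auto simp: p_def)
  obtain W F G d where W: "p \<in> W" "\<forall>i. quotient_on X W (u p i) (F i) (G i)"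
      "\<forall>i. homogeneous (Suc (d i)) (F i)" "\<forall>i. homogeneous (Suc (d i)) (G i)"
    by (rule regular_triple[where u = "u p", OF u_regular[OF p(1)] p(2)])
  have "p \<in> chart K p \<inter> {x\<in>X. coords x $ pivot p \<noteq> 0}" using p pivot_nonzero by blast
  then obtain W' A B where W': "p \<in> W'" "quotient_on X W' (\<phi> p p) A B"
    using \<phi>_unit[OF p(1)] regular_onE unfolding unit_on_def by metis
  obtain d' where d': "homogeneous d' A" "homogeneous d' B" using W'(2) unfolding quotient_on_def by blast
  define V where "V = W \<inter> W' \<inter> chart K p \<inter> {x\<in>X. form_at (var (pivot p)) x \<noteq> 0}"
  have "openin (subtopology zariski X) V"
    unfolding V_def
  proof (intro openin_Int)
    show "openin (subtopology zariski X) W" "openin (subtopology zariski X) W'"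
      using W(2) W'(2) unfolding quotient_on_def by blast+
    show "openin (subtopology zariski X) (chart K p)" by (rule line_bundle_chart[OF K p(1)])
    show "openin (subtopology zariski X) {x\<in>X. form_at (var (pivot p)) x \<noteq> 0}"
      by (rule openin_subtopology_basic[OF homogeneous_var])
  qed
  moreover have pV: "pt (?c t0) \<in> V"
    unfolding p_def[symmetric] V_def using p W(1) W'(1) pivot_nonzero by (auto simp: mpeval_var)
  ultimately have ev: "\<forall>\<^sub>F t in nhds t0. pt (?c t) \<in> V"
    by (rule eventually_pt_osc[OF e point_in_X])
  define D where "D t = det (\<chi> i j. qdiff (F i) (G i) (?c t) (osc g e (osc_index j) t))" for t
  define h where "h t = (mpeval A (vec_nth (?c t)) / mpeval B (vec_nth (?c t))) / (D t * ?c t $ pivot p)" for t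
  have nzG: "mpeval (G i) (vec_nth (?c t)) \<noteq> 0" and nzB: "mpeval B (vec_nth (?c t)) \<noteq> 0"
    and jac: "jacobian X (u p) (pt (?c t)) (osc_vectors g e t) = D t"
    and val: "\<phi> p p (pt (?c t)) = mpeval A (vec_nth (?c t)) / mpeval B (vec_nth (?c t))"
    if "pt (?c t) \<in> V" for t i
  proof -
    note l = coords_factor[OF osc_0_nonzero[OF e, of t]]
    have tV: "pt (?c t) \<in> W" "pt (?c t) \<in> W'" using that by (auto simp: V_def)
    have "form_at (G i) (pt (?c t)) \<noteq> 0" using W(2) tV(1) unfolding quotient_on_def by blast
    then show "mpeval (G i) (vec_nth (?c t)) \<noteq> 0"
      using form_zero_iff[OF W(4)[rule_format] l(2,1)] by blast
    have "form_at B (pt (?c t)) \<noteq> 0" using W'(2) tV(2) unfolding quotient_on_def by blast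
    then show "mpeval B (vec_nth (?c t)) \<noteq> 0"
      using form_zero_iff[OF d'(2) l(2,1)] by blast
    have "\<phi> p p (pt (?c t)) = form_at A (pt (?c t)) / form_at B (pt (?c t))"
      using W'(2) tV(2) unfolding quotient_on_def by blast
    also have "\<dots> = mpeval A (vec_nth (?c t)) / mpeval B (vec_nth (?c t))"
      by (rule form_quotient_scale[OF d' l(2,1)])
    finally show "\<phi> p p (pt (?c t)) = mpeval A (vec_nth (?c t)) / mpeval B (vec_nth (?c t))" .
    have "qdiff (F i) (G i) (coords (pt (?c t))) (osc_vectors g e t j) =
        qdiff (F i) (G i) (?c t) (osc g e (osc_index j) t)" for i j
      unfolding osc_vectors_def l(2) by (rule qdiff_scale[OF W(3,4)[rule_format] l(1)])
    then show "jacobian X (u p) (pt (?c t)) (osc_vectors g e t) = D t"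
      unfolding D_def jacobian_quotient[where u = "u p", OF W(2)[rule_format] tV(1) osc_vectors_tangent] by simp
  qed
  have eq: "degree_function g e t = h t" if "pt (?c t) \<in> V" for t
    unfolding h_def using degree_function_local[OF p(1), of t] jac[OF that] val[OF that] that
    by (simp add: V_def mpeval_var)
  have "D t0 \<noteq> 0"
    using jac[OF pV] jacobian_osc_nonzero[OF p(1), of t0] p(2) by (simp add: p_def)
  moreover have "?c t0 $ pivot p \<noteq> 0"
    using pivot_nonzero osc_pivot_nonzero(2) unfolding p_def by blast
  moreover have "D field_differentiable at t0"
    unfolding D_def[abs_def] det_3 vec_lambda_beta
    by (intro derivative_intros qdiff_osc_differentiable nzG[OF pV])
  ultimately have "h field_differentiable at t0"
    unfolding h_def[abs_def]
    by (intro derivative_intros mpeval_osc_differentiable osc_differentiable) (use nzB[OF pV] in auto)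
  then obtain h' where "(h has_field_derivative h') (at t0)" unfolding field_differentiable_def by blast
  moreover have "\<forall>\<^sub>F t in nhds t0. degree_function g e t = h t"
    using ev by (rule eventually_mono) (rule eq)
  ultimately have "(degree_function g e has_field_derivative h') (at t0)"
    using DERIV_cong_ev[OF refl _ refl] by blast
  then show ?thesis unfolding field_differentiable_def by blast
qed

text \<open>The exponents reflect that \<open>- K\<close> has degree 12 on the curve, and the hyperplane bundle
  degree \<open>g\<close>.\<close>

lemma degree_function_reverse:
  assumes ts: "t * s = 1"
  shows "degree_function g (\<lambda>i. e (g - i)) s = t ^ g * s ^ 12 * degree_function g e t"
proof -
  let ?e = "\<lambda>i. e (g - i)"
  define q where "q = pt (osc g e 0 t)"
  have t0: "t \<noteq> 0" using ts by auto
  note e' = family_independent_rev[OF e(1)] e(2)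
  have c: "osc g e 0 t = t ^ g *s osc g ?e 0 s" by (rule osc_reverse(1)[OF ts])
  have q': "pt (osc g ?e 0 s) = q" unfolding q_def c using t0 by (simp add: pt_scale)
  have q: "q \<in> X" "q \<in> chart K q" unfolding q_def using point_in_X line_bundle_chart[OF K] by auto
  define l where "l = coords_factor (osc g e 0 t)"
  have l: "l \<noteq> 0" "coords q = l *s osc g e 0 t"
    unfolding l_def q_def using coords_factor[OF osc_0_nonzero[OF e]] by auto
  have l': "coords_factor (osc g ?e 0 s) = l * t ^ g"
    unfolding l_def c by (rule coords_factor_scale[OF osc_0_nonzero[OF e']]) (use t0 in simp)
  obtain W F G d where W: "q \<in> W" "\<forall>i. quotient_on X W (u q i) (F i) (G i)"
      "\<forall>i. homogeneous (Suc (d i)) (F i)" "\<forall>i. homogeneous (Suc (d i)) (G i)"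
    by (rule regular_triple[where u = "u q", OF u_regular[OF q(1)] q(2)])
  define D where "D i v = qdiff (F i) (G i) (coords q) v" for i v
  have D: "D i (x + y) = D i x + D i y" "D i (a *s x) = a * D i x" for i x y a
    unfolding D_def by (rule qdiff_add, rule qdiff_cmult)
  have "D i (coords q) = 0" for i unfolding D_def by (rule qdiff_self[OF W(3,4)[rule_format]])
  then have D0: "D i (osc g ?e 0 s) = 0" for i
    using l t0 unfolding l(2) c D by simp
  have scale: "det (\<chi> i j. D i (a *s v j)) = a ^ 3 * det (\<chi> i j. D i (v j))" for a and v :: "3 \<Rightarrow> complex^'n"
    unfolding D det_3 vec_lambda_beta by algebra
  have tan': "osc_vectors g ?e s j \<in> tangent_space X q" for j
  proof -
    have "tangent_scroll (curve_of g ?e) \<subseteq> X" using scroll curve_of_rev[of g e] by simp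
    from osc_tangent[OF e' this, of "osc_index j" s] show ?thesis
      unfolding q' osc_vectors_def
      by (intro vec.subspace_scale tangent_space_subspace) (simp add: osc_index_def)
  qed
  have J: "jacobian X (u q) q (osc_vectors g e t) = l ^ 3 * det (\<chi> i j. D i (osc g e (osc_index j) t))"
    using jacobian_quotient[where u = "u q", OF W(2)[rule_format] W(1) osc_vectors_tangent[of t, folded q_def]]
    unfolding D_def[symmetric] osc_vectors_def l_def[symmetric] scale .
  have J': "jacobian X (u q) q (osc_vectors g ?e s) = (l * t ^ g) ^ 3 * det (\<chi> i j. D i (osc g ?e (osc_index j) s))"
    using jacobian_quotient[where u = "u q", OF W(2)[rule_format] W(1) tan']
    unfolding D_def[symmetric] osc_vectors_def l' scale .
  \<comment> \<open>The t^(3 g) of the determinant is absorbed by the third power of the factor l *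
    t^g in the reversed chart, leaving s^12. The t^g of the claim comes from the pivot coordinate of
    c.\<close>
  have "jacobian X (u q) q (osc_vectors g e t) = s ^ 12 * jacobian X (u q) q (osc_vectors g ?e s)"
    unfolding J J' det_triangular_change[where D = D and e = e, OF D ts D0] by (simp add: power_mult_distrib power_mult[symmetric] mult_ac)
  then show ?thesis
    unfolding degree_function_def Let_def q' q_def[symmetric] using t0 ts c by (auto simp: divide_simps)
qed

end

text \<open>f and h express the same trivialization in the two affine charts of C. Since h is
  continuous and nonzero at 0, the point at infinity of the first chart, 1 / f(1/s) = s^(12 - g) /
  h(s) tends to 0 with s if g < 12. Then 1/f is entire with limit 0 at infinity, hence 0, although
  it is the inverse of a nonzero value.\<close>

lemma scroll_degree:
  assumes e: "family_independent g e" "3 \<le> g" and scroll: "tangent_scroll (curve_of g e) \<subseteq> X"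
  shows "12 \<le> g"
proof (rule ccontr)
  assume g: "\<not> 12 \<le> g"
  let ?e = "\<lambda>i. e (g - i)"
  have scroll': "tangent_scroll (curve_of g ?e) \<subseteq> X" using scroll curve_of_rev[of g e] by simp
  note e' = family_independent_rev[OF e(1)] e(2)
  define f where "f = degree_function g e"
  define h where "h = degree_function g ?e"
  \<comment> \<open>The subtraction 12 - g on natural numbers is exact, and positive, because g < 12
    is assumed for contradiction.\<close>
  have fh: "h s = s ^ (12 - g) * f (inverse s)" if "s \<noteq> 0" for s
  proof -
    have "h s = inverse s ^ g * s ^ 12 * f (inverse s)"
      unfolding f_def h_def using degree_function_reverse[OF e scroll, of "inverse s" s] that by simp
    moreover have "s ^ 12 = s ^ g * s ^ (12 - g)" using g by (simp flip: power_add)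
    ultimately show ?thesis using that by (simp add: field_simps)
  qed
  have "((\<lambda>t. inverse (f t)) \<longlongrightarrow> 0) at_infinity"
  proof -
    have "isCont h 0"
      unfolding h_def using degree_function_differentiable[OF e' scroll']
      by (rule field_differentiable_imp_continuous_at)
    then have "(h \<longlongrightarrow> h 0) (at 0)" by (simp add: isCont_def)
    moreover have "h 0 \<noteq> 0" unfolding h_def by (rule degree_function_nonzero[OF e' scroll'])
    ultimately have "((\<lambda>s. s ^ (12 - g) * inverse (h s)) \<longlongrightarrow> 0 ^ (12 - g) * inverse (h 0)) (at 0)"
      by (intro tendsto_intros) auto
    moreover have "0 ^ (12 - g) * inverse (h 0) = 0" using g by (simp add: power_0_left)
    ultimately have "((\<lambda>s. s ^ (12 - g) * inverse (h s)) \<longlongrightarrow> 0) (at 0)" by metis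
    moreover have "\<forall>\<^sub>F s in at 0. s ^ (12 - g) * inverse (h s) = inverse (f (inverse s))"
      by (auto simp: eventually_at_filter fh)
    ultimately have "((\<lambda>s. inverse (f (inverse s))) \<longlongrightarrow> 0) (at 0)"
      by (rule Lim_transform_eventually)
    then show ?thesis unfolding lim_at_infinity_0 by (simp add: comp_def)
  qed
  moreover have "(\<lambda>t. inverse (f t)) holomorphic_on UNIV"
  proof -
    have "f holomorphic_on UNIV"
      unfolding f_def holomorphic_on_def using degree_function_differentiable[OF e scroll] by simp
    then show ?thesis
      using degree_function_nonzero[OF e scroll] by (intro holomorphic_intros) (auto simp: f_def)
  qed
  ultimately have "inverse (f 0) = 0" by (rule Liouville_weak[rotated])
  then show False using degree_function_nonzero[OF e scroll, of 0] by (simp add: f_def)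
qed

end

theorem mainTheorem3:
  fixes g :: nat and X C :: "'n::finite proj set"
  assumes "3 \<le> g" and "g \<le> 9"
    and "CARD('n) = g + 2"
    and "prime_fano_threefold X" and "has_degree X (2 * g - 2)"
    and "rational_normal_curve g C"
  shows "\<not> tangent_scroll C \<subseteq> X"
proof
  assume scroll: "tangent_scroll C \<subseteq> X"
  have dim: "vec.dim (tangent_space X p) = 4" if "p \<in> X" for p
    using assms(4) that
    by (simp add: prime_fano_threefold_def fano_threefold_def smooth_projective_variety_def)
  have "hyperplane_bundle X \<in> anticanonical_class X"
    using assms(4) by (simp add: prime_fano_threefold_def)
  then obtain K where K: "canonical_bundle_threefold X K"
    "bundle_iso X (bundle_tensor K (hyperplane_bundle X)) (trivial_bundle X)"
    using hyperplane_canonical_dual[OF dim] by blast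
  obtain u where u: "line_bundle X K" "\<forall>p\<in>X. \<forall>i. regular_on X (chart K p) (u p i)"
    "\<forall>p\<in>X. \<forall>x\<in>chart K p. \<exists>v. (\<forall>j. v j \<in> tangent_space X x) \<and> jacobian X (u p) x v \<noteq> 0"
    "\<forall>p\<in>X. \<forall>q\<in>X. \<forall>x\<in>chart K p \<inter> chart K q. \<forall>v. (\<forall>j. v j \<in> tangent_space X x) \<longrightarrow>
           jacobian X (u q) x v = transition K p q x * jacobian X (u p) x v"
    using K(1) unfolding canonical_bundle_threefold_def by blast
  let ?L = "bundle_tensor K (hyperplane_bundle X)"
  obtain \<phi> where \<phi>: "\<forall>p\<in>X. \<forall>q\<in>X. unit_on X (chart ?L p \<inter> chart (trivial_bundle X) q) (\<phi> p q)"
     "\<forall>p\<in>X. \<forall>p'\<in>X. \<forall>q\<in>X. \<forall>q'\<in>X. \<forall>x\<in>chart ?L p \<inter> chart ?L p' \<inter> chart (trivial_bundle X) q \<inter> chart (trivial_bundle X) q'.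
        \<phi> p' q' x = transition (trivial_bundle X) q' q x * \<phi> p q x * transition ?L p p' x"
    using K(2) unfolding bundle_iso_def by blast
  have L: "chart ?L p = chart K p \<inter> {x\<in>X. coords x $ pivot p \<noteq> 0}" for p
    by (simp add: hyperplane_bundle_def)
  \<comment> \<open>The isomorphism to the trivial bundle is specialized to equal indices: the
    transition functions of the trivial bundle are 1, and those of the hyperplane bundle are the
    quotients of coordinates in the last locale assumption.\<close>
  interpret canonical_trivialization X K u \<phi>
  proof
    fix p assume p: "p \<in> X"
    have "chart ?L p \<inter> chart (trivial_bundle X) p = chart ?L p" unfolding L by (auto simp: trivial_bundle_def)
    then show "unit_on X (chart K p \<inter> {x\<in>X. coords x $ pivot p \<noteq> 0}) (\<phi> p p)"
      using \<phi>(1) p L by metis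
    fix q assume q: "q \<in> X" "q \<in> chart K p" "coords q $ pivot p \<noteq> 0"
    have "q \<in> chart ?L p \<inter> chart ?L q \<inter> chart (trivial_bundle X) p \<inter> chart (trivial_bundle X) q"
      using p q pivot_nonzero line_bundle_chart[OF u(1) q(1)] unfolding L by (auto simp: trivial_bundle_def)
    then have "\<phi> q q q = transition (trivial_bundle X) q p q * \<phi> p p q * transition ?L p q q"
      using \<phi>(2) p q(1) by blast
    then show "\<phi> q q q = \<phi> p p q * (transition K p q q * (coords q $ pivot q / coords q $ pivot p))"
      by (simp add: trivial_bundle_def hyperplane_bundle_def)
  next
    show "line_bundle X K" by (rule u(1))
  next
    fix p i assume "p \<in> X"
    then show "regular_on X (chart K p) (u p i)" using u(2) by blast
  next
    fix p x assume "p \<in> X" "x \<in> chart K p"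
    then show "\<exists>v. (\<forall>j. v j \<in> tangent_space X x) \<and> jacobian X (u p) x v \<noteq> 0" using u(3) by blast
  next
    fix p q x and v :: "3 \<Rightarrow> complex^'n" assume "p \<in> X" "q \<in> X" "x \<in> chart K p" "x \<in> chart K q" "\<And>j. v j \<in> tangent_space X x"
    then show "jacobian X (u q) x v = transition K p q x * jacobian X (u p) x v" using u(4) by blast
  qed (fact dim)
  obtain e :: "nat \<Rightarrow> complex^'n" where "inj_on e {..g}" "vec.independent (e ` {..g})" "C = curve_of g e"
    using assms(6) unfolding rational_normal_curve_def curve_of_def by blast
  then have "12 \<le> g"
    using scroll_degree[OF family_independentI assms(1)] scroll by blast
  then show False using assms(2) by simp
qed

end
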